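(* Let $\mathcal{C}$ be a $d$-uniform clutter on the vertex set $X=\{x_1,\ldots,x_n\}$, without isolated vertices. Let $$Y=\{y_{ij}\mid 1\leq i\leq n;\ 1\leq j\leq d-1\}$$ be a set of new variables, and let $\mathcal{C}'$ be the clutter with vertex set $V(\mathcal{C}')=X\cup Y$ and edge set $$E(\mathcal{C}')=E(\mathcal{C})\cup\{\{x_1,y_{11},\ldots,y_{1(d-1)}\},\ldots,\{x_n,y_{n1},\ldots,y_{n(d-1)}\}\}.$$ Then the edge ideal $I(\mathcal{C}')$ is Cohen-Macaulay, i.e. $K[X\cup Y]/I(\mathcal{C}')$ is a Cohen-Macaulay ring, where $K$ is a field. Moreover, if $\mathcal{C}$ satisfies the packing property (resp. the max-flow min-cut property), then $\mathcal{C}'$ satisfies the packing property (resp. the max-flow min-cut property).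
   Context: A clutter with finite vertex set $X$ is a family $E(\mathcal{C})$ of subsets of $X$ (edges), none of which is included in another. It is $d$-uniform if all edges have exactly $d$ vertices. A vertex is isolated if it lies in no edge. The edge ideal $I(\mathcal{C})$ is the ideal of $K[X]$ generated by all monomials $\prod_{x\in e}x$ with $e\in E(\mathcal{C})$; this gives a one to one correspondence between clutters and square-free monomial ideals. $\alpha_0(\mathcal{C})$ is the minimum size of a vertex cover (a set of vertices meeting every edge), $\beta_1(\mathcal{C})$ is the maximum number of pairwise disjoint edges; $\mathcal{C}$ has the König property if $\alpha_0(\mathcal{C})=\beta_1(\mathcal{C})$. A minor of $\mathcal{C}$ is a clutter corresponding to a nonzero proper ideal $I'$ obtained from $I(\mathcal{C})$ by setting some of the variables equal to $0$ and some others equal to $1$ ($\mathcal{C}$ itself is a minor); its edges are the supports of the minimal monomial generators of $I'$. $\mathcal{C}$ satisfies the packing property if all its minors have the König property. $\mathcal{C}$, with incidence matrix $A$ (columns the characteristic vectors of the edges), satisfies the max-flow min-cut property if both sides of $$\min\{\langle w,x\rangle\mid x\geq 0;\ xA\geq\mathbf{1}\}=\max\{\langle y,\mathbf{1}\rangle\mid y\geq 0;\ Ay\leq w\}$$ have integral optimum solutions $x$ and $y$ for each non-negative integral vector $w$, where $\mathbf{1}$ is the all-ones vector. *)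

theory Defs
  imports
    Complex_Main
    "HOL-Library.Poly_Mapping"
    "HOL-Library.Extended_Nat"
    "HOL-Algebra.Ring_Divisibility"
begin

section \<open>Clutters\<close>

text \<open>A clutter is given by its vertex set \<open>V\<close> and its edge set \<open>E\<close>.\<close>

definition clutter :: "'v set \<Rightarrow> 'v set set \<Rightarrow> bool" where
  "clutter V E \<longleftrightarrow>
     finite V \<and> (\<forall>e\<in>E. e \<subseteq> V) \<and> (\<forall>e\<in>E. \<forall>f\<in>E. e \<subseteq> f \<longrightarrow> e = f)"

definition uniform :: "nat \<Rightarrow> 'v set set \<Rightarrow> bool" where
  "uniform d E \<longleftrightarrow> (\<forall>e\<in>E. card e = d)"

definition isolated_vertex :: "'v set \<Rightarrow> 'v set set \<Rightarrow> 'v \<Rightarrow> bool" where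
  "isolated_vertex V E v \<longleftrightarrow> v \<in> V \<and> (\<forall>e\<in>E. v \<notin> e)"

definition vertex_cover :: "'v set \<Rightarrow> 'v set set \<Rightarrow> 'v set \<Rightarrow> bool" where
  "vertex_cover V E S \<longleftrightarrow> S \<subseteq> V \<and> (\<forall>e\<in>E. S \<inter> e \<noteq> {})"

definition covering_number :: "'v set \<Rightarrow> 'v set set \<Rightarrow> nat" where
  "covering_number V E = Min {card S |S. vertex_cover V E S}"

definition matching_number :: "'v set set \<Rightarrow> nat" where
  "matching_number E = Max {card M |M. M \<subseteq> E \<and> pairwise disjnt M}"

definition konig_property :: "'v set \<Rightarrow> 'v set set \<Rightarrow> bool" where
  "konig_property V E \<longleftrightarrow> covering_number V E = matching_number E"


section \<open>Polynomial rings and edge ideals\<close>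

text \<open>A monomial is its exponent vector, and a polynomial is a finitely supported family of
  coefficients indexed by monomials. The ring \<open>K[V]\<close> consists of those polynomials all of whose
  monomials only involve variables from \<open>V\<close>.\<close>

type_synonym ('v, 'k) mpoly = "('v \<Rightarrow>\<^sub>0 nat) \<Rightarrow>\<^sub>0 'k"

definition poly_ring :: "'v set \<Rightarrow> ('v, 'k::comm_ring_1) mpoly ring" where
  "poly_ring V =
     \<lparr>carrier = {p. \<forall>m \<in> Poly_Mapping.keys p. Poly_Mapping.keys m \<subseteq> V},
      mult = (*), one = 1, zero = 0, add = (+)\<rparr>"

definition mconst :: "'k \<Rightarrow> ('v, 'k::comm_ring_1) mpoly" where
  "mconst c = Poly_Mapping.single 0 c"

definition mvar :: "'v \<Rightarrow> ('v, 'k::comm_ring_1) mpoly" where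
  "mvar v = Poly_Mapping.single (Poly_Mapping.single v 1) 1"

definition mmonom :: "('v \<Rightarrow>\<^sub>0 nat) \<Rightarrow> ('v, 'k::comm_ring_1) mpoly" where
  "mmonom m = Poly_Mapping.single m 1"

definition edge_ideal :: "'v set \<Rightarrow> 'v set set \<Rightarrow> ('v, 'k::comm_ring_1) mpoly set" where
  "edge_ideal V E = Idl\<^bsub>poly_ring V\<^esub> ((\<lambda>e. \<Prod>x\<in>e. mvar x) ` E)"


section \<open>Minors and the packing property\<close>

text \<open>The result of setting the variables in \<open>Z\<close> to \<open>0\<close> and those in \<open>U\<close> to \<open>1\<close>
  (for disjoint \<open>Z\<close> and \<open>U\<close>).\<close>

definition set_vars :: "'v set \<Rightarrow> 'v set \<Rightarrow> ('v, 'k::comm_ring_1) mpoly \<Rightarrow> ('v, 'k) mpoly" where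
  "set_vars Z U p =
     (\<Sum>m\<in>Poly_Mapping.keys p. mconst (Poly_Mapping.lookup p m) *
        (\<Prod>v\<in>Poly_Mapping.keys m.
           (if v \<in> Z then 0 else if v \<in> U then 1 else mvar v) ^ Poly_Mapping.lookup m v))"

text \<open>The minimal monomial generators of a monomial ideal are the monomials it contains that are
  minimal with respect to divisibility.\<close>

definition minimal_monomials :: "('v, 'k::comm_ring_1) mpoly set \<Rightarrow> ('v \<Rightarrow>\<^sub>0 nat) set" where
  "minimal_monomials I =
     {m. mmonom m \<in> I \<and>
         (\<forall>m'. mmonom m' \<in> I \<and> (\<forall>v. Poly_Mapping.lookup m' v \<le> Poly_Mapping.lookup m v)
            \<longrightarrow> m' = m)}"

text \<open>The polynomial ring lives over the field \<open>'k\<close>, which the clutters themselves do not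
  mention; hence the type argument.\<close>

definition is_minor ::
  "'k::field itself \<Rightarrow> 'v set \<Rightarrow> 'v set set \<Rightarrow> 'v set \<Rightarrow> 'v set set \<Rightarrow> bool" where
  "is_minor _ V E V' E' \<longleftrightarrow>
     (\<exists>Z U (I' :: ('v, 'k) mpoly set).
        Z \<subseteq> V \<and> U \<subseteq> V \<and> Z \<inter> U = {} \<and> V' = V - (Z \<union> U) \<and>
        I' = set_vars Z U ` edge_ideal V E \<and>
        I' \<noteq> {0} \<and> I' \<noteq> carrier (poly_ring V') \<and>
        E' = Poly_Mapping.keys ` minimal_monomials I')"

definition packing_property :: "'k::field itself \<Rightarrow> 'v set \<Rightarrow> 'v set set \<Rightarrow> bool" where
  "packing_property k V E \<longleftrightarrow> (\<forall>V' E'. is_minor k V E V' E' \<longrightarrow> konig_property V' E')"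


section \<open>The max-flow min-cut property\<close>

definition incidence :: "'v \<Rightarrow> 'v set \<Rightarrow> real" where
  "incidence v e = (if v \<in> e then 1 else 0)"

definition primal_feasible :: "'v set \<Rightarrow> 'v set set \<Rightarrow> ('v \<Rightarrow> real) \<Rightarrow> bool" where
  "primal_feasible V E x \<longleftrightarrow>
     (\<forall>v\<in>V. 0 \<le> x v) \<and> (\<forall>e\<in>E. 1 \<le> (\<Sum>v\<in>V. x v * incidence v e))"

definition dual_feasible ::
  "'v set \<Rightarrow> 'v set set \<Rightarrow> ('v \<Rightarrow> nat) \<Rightarrow> ('v set \<Rightarrow> real) \<Rightarrow> bool" where
  "dual_feasible V E w y \<longleftrightarrow>
     (\<forall>e\<in>E. 0 \<le> y e) \<and> (\<forall>v\<in>V. (\<Sum>e\<in>E. incidence v e * y e) \<le> real (w v))"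

definition primal_value :: "'v set \<Rightarrow> ('v \<Rightarrow> nat) \<Rightarrow> ('v \<Rightarrow> real) \<Rightarrow> real" where
  "primal_value V w x = (\<Sum>v\<in>V. real (w v) * x v)"

definition dual_value :: "'v set set \<Rightarrow> ('v set \<Rightarrow> real) \<Rightarrow> real" where
  "dual_value E y = (\<Sum>e\<in>E. y e)"

definition primal_optimal ::
  "'v set \<Rightarrow> 'v set set \<Rightarrow> ('v \<Rightarrow> nat) \<Rightarrow> ('v \<Rightarrow> real) \<Rightarrow> bool" where
  "primal_optimal V E w x \<longleftrightarrow> primal_feasible V E x \<and>
     (\<forall>x'. primal_feasible V E x' \<longrightarrow> primal_value V w x \<le> primal_value V w x')"

definition dual_optimal ::
  "'v set \<Rightarrow> 'v set set \<Rightarrow> ('v \<Rightarrow> nat) \<Rightarrow> ('v set \<Rightarrow> real) \<Rightarrow> bool" where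
  "dual_optimal V E w y \<longleftrightarrow> dual_feasible V E w y \<and>
     (\<forall>y'. dual_feasible V E w y' \<longrightarrow> dual_value E y' \<le> dual_value E y)"

text \<open>The equality of the two optimal values is the displayed min-max equation; the optima
  are taken over all real solutions.\<close>

definition max_flow_min_cut :: "'v set \<Rightarrow> 'v set set \<Rightarrow> bool" where
  "max_flow_min_cut V E \<longleftrightarrow>
     (\<forall>w :: 'v \<Rightarrow> nat. \<exists>x y.
        primal_optimal V E w x \<and> (\<forall>v\<in>V. x v \<in> \<int>) \<and>
        dual_optimal V E w y \<and> (\<forall>e\<in>E. y e \<in> \<int>) \<and>
        primal_value V w x = dual_value E y)"


section \<open>Cohen-Macaulay rings\<close>

definition regular_sequence :: "('a, 'b) ring_scheme \<Rightarrow> 'a list \<Rightarrow> bool" where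
  "regular_sequence R as \<longleftrightarrow>
     set as \<subseteq> carrier R \<and> Idl\<^bsub>R\<^esub> (set as) \<noteq> carrier R \<and>
     (\<forall>i<length as. \<forall>r\<in>carrier R.
        as ! i \<otimes>\<^bsub>R\<^esub> r \<in> Idl\<^bsub>R\<^esub> (set (take i as)) \<longrightarrow> r \<in> Idl\<^bsub>R\<^esub> (set (take i as)))"

definition ideal_depth :: "('a, 'b) ring_scheme \<Rightarrow> 'a set \<Rightarrow> enat" where
  "ideal_depth R I = Sup {enat (length as) |as. set as \<subseteq> I \<and> regular_sequence R as}"

text \<open>A chain \<open>Q\<^sub>0 \<subset> ... \<subset> Q\<^sub>k = P\<close> of primes descending from \<open>P\<close> has length \<open>k\<close>; the list below
  contains \<open>Q\<^sub>0, ..., Q\<^sub>k\<^sub>-\<^sub>1\<close>.\<close>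

definition prime_height :: "('a, 'b) ring_scheme \<Rightarrow> 'a set \<Rightarrow> enat" where
  "prime_height R P =
     Sup {enat (length Qs) |Qs. (\<forall>Q\<in>set Qs. primeideal Q R) \<and> sorted_wrt (\<subset>) (Qs @ [P])}"

text \<open>This is the definition of Eisenbud (Commutative Algebra with a View Toward Algebraic
  Geometry, Section 18.2) and Kaplansky: a commutative Noetherian ring in which the depth of every
  maximal ideal, that is, the length of a longest regular sequence in it, equals its height.\<close>

definition cohen_macaulay_ring :: "('a, 'b) ring_scheme \<Rightarrow> bool" where
  "cohen_macaulay_ring R \<longleftrightarrow> cring R \<and> noetherian_ring R \<and>
     (\<forall>P. maximalideal P R \<longrightarrow> ideal_depth R P = prime_height R P)"

end

theory Submission
  imports Defs "HOL-Computational_Algebra.Polynomial"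
begin

text \<open>
Call \<open>{x\<^sub>i, y\<^sub>i\<^sub>1, \<dots>}\<close> the whisker at \<open>x\<^sub>i\<close> and the \<open>y\<^sub>i\<^sub>j\<close> its leaves; their number plays no role. After the
substitution \<open>y\<^sub>i\<^sub>j \<mapsto> y\<^sub>i\<^sub>j + x\<^sub>i\<close> the monomial of a whisker becomes \<open>x\<^sub>i \<Prod>\<^sub>j (x\<^sub>i + y\<^sub>i\<^sub>j)\<close>, which is monic in \<open>x\<^sub>i\<close>, and
the quotient ring becomes a free module over \<open>K[Y]\<close>. A maximal ideal contains a monic polynomial in each single leaf
(Zariski's lemma), and these polynomials form a regular sequence of length \<open>card Y\<close>. On the other hand every prime
contains a variable of each whisker, so that a chain of primes lives in a polynomial ring in \<open>card Y\<close> variables and has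
length at most \<open>card Y\<close>. As the depth never exceeds the height, both are equal to \<open>card Y\<close>.

For the combinatorial claims an optimal cover and an optimal packing of the original clutter (for a suitable
minor or weight) are extended by the whiskers and by one vertex from each of them.
\<close>

section \<open>Ideals and primes of a commutative ring\<close>

text \<open>The Cohen-Macaulay condition concerns all maximal ideals, and \<open>K\<close> is an
  arbitrary field. At the origin the shifted leaves themselves would form a regular sequence; at a
  maximal ideal with larger residue field only monic polynomials of higher degree in a leaf are
  available. Depth is moreover measured in the quotient ring itself and not in a localization, so
  regularity has to hold globally. Both are met by a \<open>K\<close>-basis made of products of
  powers of the chosen monic polynomials: every ideal in question is spanned by a part of this
  basis, and multiplication by such a polynomial merely shifts indices. Subrings and primes are
  subsets of one type class ring, and residue rings are replaced by congruences modulo a prime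
  \<open>M\<close>. Ideals of the quotient ring are pulled back to the polynomial ring in all
  variables of the type, where the variables outside the vertex set belong to the kernel.\<close>

definition is_ideal :: "'a::comm_ring_1 set \<Rightarrow> bool" where
  "is_ideal J \<longleftrightarrow> 0 \<in> J \<and> (\<forall>a\<in>J. \<forall>b\<in>J. a + b \<in> J) \<and> (\<forall>r. \<forall>a\<in>J. r * a \<in> J)"

lemma is_ideal_zero: "is_ideal J \<Longrightarrow> 0 \<in> J"
  and is_ideal_add: "is_ideal J \<Longrightarrow> a \<in> J \<Longrightarrow> b \<in> J \<Longrightarrow> a + b \<in> J"
  and is_ideal_mult: "is_ideal J \<Longrightarrow> a \<in> J \<Longrightarrow> r * a \<in> J"
  by (auto simp: is_ideal_def)

lemma is_ideal_mult_right: "is_ideal J \<Longrightarrow> a \<in> J \<Longrightarrow> a * r \<in> J"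
  using is_ideal_mult[of J a r] by (simp add: mult.commute)

lemma is_ideal_uminus: "is_ideal J \<Longrightarrow> a \<in> J \<Longrightarrow> - a \<in> J"
  using is_ideal_mult[of J a "-1"] by simp

lemma is_ideal_diff: "is_ideal J \<Longrightarrow> a \<in> J \<Longrightarrow> b \<in> J \<Longrightarrow> a - b \<in> J"
  using is_ideal_add[of J a "- b"] is_ideal_uminus[of J b] by simp

lemma is_ideal_sum: "is_ideal J \<Longrightarrow> (\<And>i. i \<in> I \<Longrightarrow> f i \<in> J) \<Longrightarrow> (\<Sum>i\<in>I. f i) \<in> J"
  by (induction I rule: infinite_finite_induct) (auto simp: is_ideal_zero is_ideal_add)

lemma is_ideal_Inter: "\<forall>J\<in>T. is_ideal J \<Longrightarrow> is_ideal (\<Inter>T)"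
  by (auto simp: is_ideal_def)

lemma is_ideal_hull: "is_ideal (is_ideal hull F)"
  by (rule hull_in) (rule is_ideal_Inter)

lemma is_ideal_add_principal:
  assumes J: "is_ideal J"
  shows "is_ideal {q + c * u |q c. q \<in> J}" "J \<subseteq> {q + c * u |q c. q \<in> J}" "u \<in> {q + c * u |q c. q \<in> J}"
proof -
  let ?I = "{q + c * u |q c. q \<in> J}"
  have mem: "q + c * u \<in> ?I" if "q \<in> J" for q c using that by blast
  show "J \<subseteq> ?I" using mem[of _ 0] by fastforce
  show "u \<in> ?I" using mem[OF is_ideal_zero[OF J], of 1] by simp
  show "is_ideal ?I"
    unfolding is_ideal_def
  proof (intro conjI ballI allI)
    show "0 \<in> ?I" using mem[OF is_ideal_zero[OF J], of 0] by simp
  next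
    fix v w assume "v \<in> ?I" "w \<in> ?I"
    then obtain q c q' c' where "v = q + c * u" "w = q' + c' * u" "q \<in> J" "q' \<in> J" by blast
    then show "v + w \<in> ?I"
      using mem[OF is_ideal_add[OF J, of q q'], of "c + c'"] by (simp add: algebra_simps)
  next
    fix r v assume "v \<in> ?I"
    then obtain q c where "v = q + c * u" "q \<in> J" by blast
    then show "r * v \<in> ?I"
      using mem[OF is_ideal_mult[OF J, of q r], of "r * c"] by (simp add: distrib_left mult.assoc)
  qed
qed

locale prime_set =
  fixes M :: "'a::comm_ring_1 set"
  assumes is_ideal: "is_ideal M"
    and one_notin: "1 \<notin> M"
    and prime: "a * b \<in> M \<Longrightarrow> a \<in> M \<or> b \<in> M"
begin

lemmas zero_in = is_ideal_zero[OF is_ideal]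
lemmas add_in = is_ideal_add[OF is_ideal]
lemmas mult_in = is_ideal_mult[OF is_ideal]
lemmas mult_right_in = is_ideal_mult_right[OF is_ideal]
lemmas diff_in = is_ideal_diff[OF is_ideal]
lemmas sum_in = is_ideal_sum[OF is_ideal]

lemma mult_in_iff: "a * b \<in> M \<longleftrightarrow> a \<in> M \<or> b \<in> M"
  using prime mult_in mult_right_in by blast

lemma power_in: "a ^ k \<in> M \<Longrightarrow> a \<in> M"
  by (induction k) (auto simp: one_notin mult_in_iff)

lemma diff_trans: "a - b \<in> M \<Longrightarrow> b - c \<in> M \<Longrightarrow> a - c \<in> M"
  using add_in[of "a - b" "b - c"] by simp

lemma diff_mult: "a - b \<in> M \<Longrightarrow> c - e \<in> M \<Longrightarrow> a * c - b * e \<in> M"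
  using add_in[of "(a - b) * c" "b * (c - e)"] mult_in[of "c - e" b] mult_right_in[of "a - b" c]
  by (simp add: algebra_simps)

lemma diff_power: "a - b \<in> M \<Longrightarrow> a ^ k - b ^ k \<in> M"
  by (induction k) (auto simp: zero_in diff_mult)

end

text \<open>An ideal containing \<open>J\<close> that is maximal among those missing \<open>{a ^ k * t | k t. t \<notin> P}\<close> is
  a prime with the required properties.\<close>

lemma smaller_prime:
  assumes J: "is_ideal J" and P: "prime_set P" and JP: "J \<subseteq> P" and aP: "a \<in> P"
    and nzd: "\<And>r. a * r \<in> J \<Longrightarrow> r \<in> J"
  shows "\<exists>Q. prime_set Q \<and> J \<subseteq> Q \<and> Q \<subset> P"
proof -
  interpret P: prime_set P by fact
  define S where "S = {a ^ k * t |k t. t \<notin> P}"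
  define T where "T = {I. is_ideal I \<and> J \<subseteq> I \<and> I \<inter> S = {}}"
  have S_mult: "s * t \<in> S" if "s \<in> S" "t \<in> S" for s t
  proof -
    obtain k u l v where "s = a ^ k * u" "u \<notin> P" "t = a ^ l * v" "v \<notin> P"
      using \<open>s \<in> S\<close> \<open>t \<in> S\<close> unfolding S_def by blast
    then have "s * t = a ^ (k + l) * (u * v)" "u * v \<notin> P"
      by (auto simp: power_add algebra_simps P.mult_in_iff)
    then show ?thesis unfolding S_def by blast
  qed
  \<comment> \<open>As \<open>J\<close> lies in \<open>P\<close>, this shows that \<open>J\<close>
    misses \<open>S\<close> and so belongs to the family \<open>T\<close>.\<close>
  have pow: "a ^ k * t \<in> J \<Longrightarrow> t \<in> J" for k t
    by (induction k) (auto simp: mult.assoc intro: nzd)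
  have "J \<in> T"
    using J JP pow by (force simp: T_def S_def)
  have "\<exists>Q\<in>T. \<forall>I\<in>T. Q \<subseteq> I \<longrightarrow> I = Q"
  proof (rule subset_Zorn_nonempty)
    show "T \<noteq> {}" using \<open>J \<in> T\<close> by blast
  next
    fix \<C> assume ne: "\<C> \<noteq> {}" and ch: "subset.chain T \<C>"
    have mem: "\<And>I. I \<in> \<C> \<Longrightarrow> I \<in> T"
      and tot: "\<And>I K. I \<in> \<C> \<Longrightarrow> K \<in> \<C> \<Longrightarrow> I \<subseteq> K \<or> K \<subseteq> I"
      using ch by (auto simp: subset_chain_def)
    have "is_ideal (\<Union>\<C>)"
      unfolding is_ideal_def
    proof (intro conjI ballI allI)
      show "0 \<in> \<Union>\<C>" using ne mem by (auto simp: T_def is_ideal_def)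
    next
      fix u v assume "u \<in> \<Union>\<C>" "v \<in> \<Union>\<C>"
      then obtain I K where "I \<in> \<C>" "K \<in> \<C>" "u \<in> I" "v \<in> K" by blast
      then obtain L where "L \<in> \<C>" "u \<in> L" "v \<in> L" using tot by blast
      moreover from this have "u + v \<in> L" using mem[of L] by (simp add: T_def is_ideal_def)
      ultimately show "u + v \<in> \<Union>\<C>" by blast
    next
      fix r u assume "u \<in> \<Union>\<C>"
      then obtain I where "I \<in> \<C>" "u \<in> I" by blast
      moreover from this have "r * u \<in> I" using mem[of I] by (simp add: T_def is_ideal_def)
      ultimately show "r * u \<in> \<Union>\<C>" by blast
    qed
    then show "\<Union>\<C> \<in> T" using mem ne unfolding T_def by blast
  qed
  then obtain Q where "Q \<in> T" and maxT: "\<And>I. I \<in> T \<Longrightarrow> Q \<subseteq> I \<Longrightarrow> I = Q"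
    by meson
  then have Q: "is_ideal Q" "J \<subseteq> Q" "Q \<inter> S = {}"
    and max: "\<And>I. is_ideal I \<Longrightarrow> J \<subseteq> I \<Longrightarrow> I \<inter> S = {} \<Longrightarrow> Q \<subseteq> I \<Longrightarrow> I = Q"
    unfolding T_def by simp_all
  have notin_S: "t \<in> S" if "t \<notin> P" for t
    unfolding S_def using that by (intro CollectI exI[of _ 0] exI[of _ t]) simp
  have aS: "a \<in> S"
    unfolding S_def using P.one_notin by (intro CollectI exI[of _ 1]) simp
  \<comment> \<open>By maximality, enlarging \<open>Q\<close> by \<open>u\<close> forces it to meet
    \<open>S\<close>. Two such meetings multiply to an element of \<open>S\<close>, which would lie
    in \<open>Q\<close> if \<open>u * v\<close> did.\<close>
  have meets: "\<exists>s\<in>S. \<exists>q\<in>Q. \<exists>c. s = q + c * u" if "u \<notin> Q" for u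
  proof (rule ccontr)
    assume none: "\<not> ?thesis"
    define I where "I = {q + c * u |q c. q \<in> Q}"
    have "is_ideal I" "Q \<subseteq> I" "u \<in> I"
      unfolding I_def by (rule is_ideal_add_principal[OF Q(1)])+
    moreover have "I \<inter> S = {}" using none unfolding I_def by blast
    ultimately have "I = Q" using max Q(2) by blast
    then show False using \<open>u \<in> I\<close> that by blast
  qed
  have "prime_set Q"
  proof
    show "is_ideal Q" by fact
    show "1 \<notin> Q" using notin_S[OF P.one_notin] Q(3) by blast
  next
    fix u v assume uv: "u * v \<in> Q"
    show "u \<in> Q \<or> v \<in> Q"
    proof (rule ccontr)
      assume "\<not> ?thesis"
      then obtain s q c t q' c' where st: "s \<in> S" "t \<in> S" and "q \<in> Q" "q' \<in> Q"
        and "s = q + c * u" "t = q' + c' * v"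
        using meets[of u] meets[of v] by blast
      then have "s * t = (q' + c' * v) * q + ((c * u) * q' + (c * c') * (u * v))"
        by (simp add: algebra_simps)
      also have "\<dots> \<in> Q"
        using \<open>q \<in> Q\<close> \<open>q' \<in> Q\<close> uv is_ideal_mult[OF Q(1)]
        by (intro is_ideal_add[OF Q(1)]) blast+
      finally show False using S_mult[OF st] Q(3) by blast
    qed
  qed
  moreover have "Q \<subset> P" using Q(3) notin_S aS aP by blast
  ultimately show ?thesis using Q(2) by blast
qed

section \<open>Subrings generated by one element over a subring\<close>

definition is_subring :: "'a::comm_ring_1 set \<Rightarrow> bool" where
  "is_subring B \<longleftrightarrow> 1 \<in> B \<and> (\<forall>a\<in>B. \<forall>b\<in>B. a - b \<in> B \<and> a * b \<in> B)"

lemma is_subring_one: "is_subring B \<Longrightarrow> 1 \<in> B"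
  and is_subring_diff: "is_subring B \<Longrightarrow> a \<in> B \<Longrightarrow> b \<in> B \<Longrightarrow> a - b \<in> B"
  and is_subring_mult: "is_subring B \<Longrightarrow> a \<in> B \<Longrightarrow> b \<in> B \<Longrightarrow> a * b \<in> B"
  by (auto simp: is_subring_def)

lemma is_subring_zero: "is_subring B \<Longrightarrow> 0 \<in> B"
  using is_subring_diff[of B 1 1] is_subring_one[of B] by simp

lemma is_subring_uminus: "is_subring B \<Longrightarrow> a \<in> B \<Longrightarrow> - a \<in> B"
  using is_subring_diff[of B 0 a] is_subring_zero[of B] by simp

lemma is_subring_add: "is_subring B \<Longrightarrow> a \<in> B \<Longrightarrow> b \<in> B \<Longrightarrow> a + b \<in> B"
  using is_subring_diff[of B a "- b"] is_subring_uminus[of B b] by simp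

lemma is_subring_power: "is_subring B \<Longrightarrow> a \<in> B \<Longrightarrow> a ^ k \<in> B"
  by (induction k) (auto simp: is_subring_one is_subring_mult)

lemma is_subring_sum: "is_subring B \<Longrightarrow> (\<And>i. i \<in> I \<Longrightarrow> f i \<in> B) \<Longrightarrow> (\<Sum>i\<in>I. f i) \<in> B"
  by (induction I rule: infinite_finite_induct) (auto simp: is_subring_zero is_subring_add)

lemma is_subring_prod: "is_subring B \<Longrightarrow> (\<And>i. i \<in> I \<Longrightarrow> f i \<in> B) \<Longrightarrow> (\<Prod>i\<in>I. f i) \<in> B"
  by (induction I rule: infinite_finite_induct) (auto simp: is_subring_one is_subring_mult)

text \<open>Also applied to a prime \<open>M\<close>: then these are the polynomials that vanish
  after reduction of the coefficients modulo \<open>M\<close>.\<close>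

definition polys_over :: "'a::comm_ring_1 set \<Rightarrow> 'a poly set" where
  "polys_over B = {p. \<forall>i. coeff p i \<in> B}"

definition adjoin :: "'a::comm_ring_1 set \<Rightarrow> 'a \<Rightarrow> 'a set" where
  "adjoin B t = (\<lambda>p. poly p t) ` polys_over B"

lemma is_subring_polys_over: "is_subring B \<Longrightarrow> is_subring (polys_over B)"
  unfolding is_subring_def[of "polys_over B"]
  by (auto simp: polys_over_def coeff_mult is_subring_diff coeff_1 is_subring_zero is_subring_one
      intro!: is_subring_sum is_subring_mult)

lemma monom_in_polys_over: "is_subring B \<Longrightarrow> b \<in> B \<Longrightarrow> monom b k \<in> polys_over B"
  by (auto simp: polys_over_def is_subring_zero)

lemma const_in_polys_over: "is_subring B \<Longrightarrow> b \<in> B \<Longrightarrow> [:b:] \<in> polys_over B"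
  using monom_in_polys_over[of B b 0] by (simp add: monom_0)

lemma is_subring_adjoin:
  assumes "is_subring B" shows "is_subring (adjoin B t)"
  unfolding is_subring_def
proof (intro conjI ballI)
  note polys = is_subring_polys_over[OF assms]
  have "poly 1 t \<in> adjoin B t"
    unfolding adjoin_def using is_subring_one[OF polys] by blast
  then show "1 \<in> adjoin B t" by simp
  fix a b assume "a \<in> adjoin B t" "b \<in> adjoin B t"
  then obtain p q where "a = poly p t" "b = poly q t" "p \<in> polys_over B" "q \<in> polys_over B"
    unfolding adjoin_def by blast
  then have "a - b = poly (p - q) t" "a * b = poly (p * q) t"
    "p - q \<in> polys_over B" "p * q \<in> polys_over B"
    using is_subring_diff[OF polys] is_subring_mult[OF polys] by auto
  then show "a - b \<in> adjoin B t" "a * b \<in> adjoin B t"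
    unfolding adjoin_def by blast+
qed

lemma adjoin_base: "is_subring B \<Longrightarrow> b \<in> B \<Longrightarrow> b \<in> adjoin B t"
  unfolding adjoin_def by (rule image_eqI[of _ _ "[:b:]"]) (auto intro: const_in_polys_over)

lemma adjoin_self: "is_subring B \<Longrightarrow> t \<in> adjoin B t"
  unfolding adjoin_def
  by (rule image_eqI[of _ _ "monom 1 1"])
    (auto simp: poly_monom intro: monom_in_polys_over is_subring_one)

lemma adjoin_minimal:
  assumes "is_subring A" "B \<subseteq> A" "t \<in> A" shows "adjoin B t \<subseteq> A"
  using assms
  by (auto simp: adjoin_def polys_over_def poly_altdef
      intro!: is_subring_sum is_subring_mult is_subring_power)

section \<open>Zariski's lemma\<close>

context prime_set
begin

text \<open>Fraction-free Gaussian elimination over the domain that \<open>B\<close> becomes modulo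
  \<open>M\<close>: more unknowns than equations leave a nontrivial solution. With
  \<open>M = {0}\<close> in a field it is ordinary linear algebra.\<close>

lemma linear_dependence:
  assumes B: "is_subring B"
  shows "finite I \<Longrightarrow> finite J \<Longrightarrow> card I < card J \<Longrightarrow> (\<And>i j. i \<in> I \<Longrightarrow> j \<in> J \<Longrightarrow> A i j \<in> B) \<Longrightarrow>
    \<exists>l. (\<forall>j\<in>J. l j \<in> B) \<and> (\<exists>j\<in>J. l j \<notin> M) \<and> (\<forall>i\<in>I. (\<Sum>j\<in>J. l j * A i j) \<in> M)"
proof (induction I arbitrary: J A rule: finite_induct)
  case empty
  then obtain j where "j \<in> J" by fastforce
  then show ?case using one_notin is_subring_one[OF B] by (intro exI[of _ "\<lambda>_. 1"]) auto
next
  case (insert i I)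
  show ?case
  proof (cases "\<forall>j\<in>J. A i j \<in> M")
    case True
    have "card I < card J" using insert by simp
    then obtain l where "\<forall>j\<in>J. l j \<in> B" "\<exists>j\<in>J. l j \<notin> M" "\<forall>i\<in>I. (\<Sum>j\<in>J. l j * A i j) \<in> M"
      using insert.IH[OF insert.prems(1), of A] insert.prems(3) by blast
    moreover from this have "(\<Sum>j\<in>J. l j * A i j) \<in> M"
      using True by (intro sum_in mult_in) auto
    ultimately show ?thesis by auto
  next
    case False
    then obtain j0 where j0: "j0 \<in> J" "A i j0 \<notin> M" by blast
    let ?J = "J - {j0}"
    \<comment> \<open>Cross-multiplication with the pivot \<open>A i j0\<close> eliminates the
      unknown \<open>j0\<close>. Afterwards \<open>l'\<close> scales the other unknowns by the pivot
      and reads off the unknown \<open>j0\<close> from row \<open>i\<close>; as the pivot is outside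
      \<open>M\<close>, nontriviality survives.\<close>
    define A' where "A' k j = A i j0 * A k j - A k j0 * A i j" for k j
    have "card I < card ?J" using insert j0 by simp
    moreover have "A' k j \<in> B" if "k \<in> I" "j \<in> ?J" for k j
      unfolding A'_def using that insert.prems j0 by (intro is_subring_diff is_subring_mult B) auto
    ultimately obtain l where l: "\<forall>j\<in>?J. l j \<in> B" "\<exists>j\<in>?J. l j \<notin> M"
        "\<forall>k\<in>I. (\<Sum>j\<in>?J. l j * A' k j) \<in> M"
      using insert.IH[OF finite_Diff[OF insert.prems(1)], of "{j0}" A'] by blast
    define l' where "l' j = (if j = j0 then - (\<Sum>j\<in>?J. A i j * l j) else A i j0 * l j)" for j
    have split: "(\<Sum>j\<in>J. l' j * A k j) = l' j0 * A k j0 + (\<Sum>j\<in>?J. A i j0 * l j * A k j)" for k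
      using j0(1) insert.prems(1) by (simp add: sum.remove l'_def)
    have "(\<Sum>j\<in>J. l' j * A k j) \<in> M" if "k \<in> insert i I" for k
    proof (cases "k = i")
      case True
      have "(\<Sum>j\<in>J. l' j * A k j) = 0"
        unfolding split True by (simp add: l'_def sum_distrib_left sum_distrib_right algebra_simps)
      then show ?thesis using zero_in by simp
    next
      case False
      have "(\<Sum>j\<in>J. l' j * A k j) = (\<Sum>j\<in>?J. l j * A' k j)"
        unfolding split A'_def
        by (simp add: l'_def sum_distrib_left sum_distrib_right sum_subtractf algebra_simps)
      then show ?thesis using l(3) that False by simp
    qed
    moreover have "\<exists>j\<in>J. l' j \<notin> M"
      using l(2) j0(2) by (auto simp: l'_def mult_in_iff)
    moreover have "l' j \<in> B" if "j \<in> J" for j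
    proof (cases "j = j0")
      case True
      then show ?thesis
        using l(1) insert.prems(3)[of i] unfolding l'_def
        by (auto intro!: is_subring_uminus is_subring_sum is_subring_mult B)
    next
      case False
      then show ?thesis
        using l(1) insert.prems(3)[of i] j0 that unfolding l'_def
        by (auto intro!: is_subring_mult B)
    qed
    ultimately show ?thesis by blast
  qed
qed

text \<open>Modulo \<open>M\<close>, inverting \<open>r\<close> turns the ring \<open>B\<close> into a field.\<close>

definition goldman :: "'a set \<Rightarrow> bool" where
  "goldman B \<longleftrightarrow> (\<exists>r\<in>B. r \<notin> M \<and> (\<forall>b\<in>B. b \<notin> M \<longrightarrow> (\<exists>v\<in>B. \<exists>k. r ^ k - b * v \<in> M)))"

lemma goldmanE:
  assumes "goldman B"
  obtains r where "r \<in> B" "r \<notin> M" "\<And>b. b \<in> B \<Longrightarrow> b \<notin> M \<Longrightarrow> \<exists>v\<in>B. \<exists>k. r ^ k - b * v \<in> M"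
  using assms unfolding goldman_def by blast

definition algebraic :: "'a set \<Rightarrow> 'a \<Rightarrow> bool" where
  "algebraic B t \<longleftrightarrow> (\<exists>p\<in>polys_over B. p \<notin> polys_over M \<and> poly p t \<in> M)"

lemma poly_in: "p \<in> polys_over M \<Longrightarrow> poly p t \<in> M"
  by (auto simp: polys_over_def poly_altdef intro: sum_in mult_right_in)

lemma polys_over_mult: "p \<in> polys_over M \<Longrightarrow> q * p \<in> polys_over M"
  by (auto simp: polys_over_def coeff_mult intro: sum_in mult_in)

text \<open>The ordinary leading coefficient may lie in \<open>M\<close>; \<open>D\<close> is the
  degree of the reduction modulo \<open>M\<close>.\<close>

lemma top_coeff:
  assumes "p \<notin> polys_over M"
  obtains D where "coeff p D \<notin> M" "\<And>i. i > D \<Longrightarrow> coeff p i \<in> M"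
proof -
  let ?S = "{i. coeff p i \<notin> M}"
  have "?S \<subseteq> {..degree p}"
    using zero_in by (auto intro: ccontr simp: coeff_eq_0)
  then have fin: "finite ?S" by (rule finite_subset) simp
  have "?S \<noteq> {}" using assms by (auto simp: polys_over_def)
  then have "Max ?S \<in> ?S" using fin Max_in by blast
  moreover have "coeff p i \<in> M" if "i > Max ?S" for i
    using Max_ge[OF fin, of i] that by fastforce
  ultimately show ?thesis using that by blast
qed

lemma top_coeff_mult:
  assumes "coeff p D \<notin> M" "\<And>i. i > D \<Longrightarrow> coeff p i \<in> M"
    and "coeff q e \<notin> M" "\<And>i. i > e \<Longrightarrow> coeff q i \<in> M"
  shows "coeff (p * q) (D + e) \<notin> M"
proof
  assume *: "coeff (p * q) (D + e) \<in> M"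
  have "coeff (p * q) (D + e) =
      coeff p D * coeff q e + (\<Sum>i\<in>{..D + e} - {D}. coeff p i * coeff q (D + e - i))"
    unfolding coeff_mult by (subst sum.remove[of _ D]) auto
  moreover have "(\<Sum>i\<in>{..D + e} - {D}. coeff p i * coeff q (D + e - i)) \<in> M"
  proof (rule sum_in)
    fix i assume "i \<in> {..D + e} - {D}"
    then have "i > D \<or> D + e - i > e" by auto
    then show "coeff p i * coeff q (D + e - i) \<in> M"
      using assms(2,4) mult_in mult_right_in by blast
  qed
  ultimately have "coeff p D * coeff q e \<in> M"
    using * diff_in by (metis add_diff_cancel_right')
  then show False using assms mult_in_iff by blast
qed

text \<open>If \<open>t\<close> were transcendental modulo \<open>M\<close>, the ring
  \<open>B[t]\<close> would be a polynomial ring over a domain. The polynomial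
  \<open>f = 1 + x * g\<close> is coprime to \<open>g\<close>, yet inverting \<open>r = g(t)\<close>
  makes \<open>f\<close> a unit, so \<open>f\<close> divides a power of \<open>g\<close>. Hence
  \<open>f\<close> divides \<open>1\<close>, against its positive degree.\<close>

lemma goldman_adjoin_algebraic:
  assumes B: "is_subring B" and "goldman (adjoin B t)"
  shows "algebraic B t"
proof (rule ccontr)
  assume "\<not> algebraic B t"
  then have trans: "p \<in> polys_over M" if "p \<in> polys_over B" "poly p t \<in> M" for p
    using that by (auto simp: algebraic_def)
  obtain r where r: "r \<in> adjoin B t" "r \<notin> M"
      "\<And>b. b \<in> adjoin B t \<Longrightarrow> b \<notin> M \<Longrightarrow> \<exists>v\<in>adjoin B t. \<exists>k. r ^ k - b * v \<in> M"
    by (rule goldmanE[OF assms(2)]) blast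
  note P = is_subring_polys_over[OF B]
  obtain g where g: "g \<in> polys_over B" "r = poly g t" using r(1) by (auto simp: adjoin_def)
  define x where "x = monom (1 :: 'a) 1"
  have x: "x \<in> polys_over B" unfolding x_def by (intro monom_in_polys_over is_subring_one B)
  \<comment> \<open>The factor \<open>x\<close> makes \<open>f\<close> nonconstant modulo
    \<open>M\<close> even when \<open>g\<close> is constant there.\<close>
  define f where "f = 1 + x * g"
  have f: "f \<in> polys_over B"
    unfolding f_def using g x by (intro is_subring_add is_subring_mult is_subring_one P)
  have coeff_f: "coeff f 0 = 1" "coeff f (Suc i) = coeff g i" for i
    by (simp_all add: f_def x_def coeff_monom_mult[where n = 1, simplified])
  have "g \<notin> polys_over M" using r(2) g(2) poly_in by blast
  then obtain i where "coeff g i \<notin> M" by (auto simp: polys_over_def)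
  then have i: "coeff f (Suc i) \<notin> M" by (simp add: coeff_f)
  then have "f \<notin> polys_over M" by (auto simp: polys_over_def)
  then have "poly f t \<notin> M" using trans f by blast
  moreover have "poly f t \<in> adjoin B t" using f by (auto simp: adjoin_def)
  ultimately obtain v k where v: "v \<in> adjoin B t" "r ^ k - poly f t * v \<in> M" using r(3) by blast
  obtain h where h: "h \<in> polys_over B" "v = poly h t" using v(1) by (auto simp: adjoin_def)
  have "poly (g ^ k - f * h) t \<in> M" using v(2) by (simp add: g h)
  moreover have "g ^ k - f * h \<in> polys_over B"
    using f g h by (intro is_subring_diff is_subring_mult is_subring_power P)
  ultimately have "g ^ k - f * h \<in> polys_over M" by (rule trans[rotated])
  then have *: "(-1) ^ k * x ^ k * (g ^ k - f * h) \<in> polys_over M" by (rule polys_over_mult)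
  \<comment> \<open>Modulo \<open>f\<close> one has \<open>x * g = -1\<close>, so the multiple
    \<open>x ^ k * g ^ k\<close> of \<open>g ^ k\<close> is a sign; this turns divisibility of
    \<open>g ^ k\<close> into divisibility of \<open>1\<close>.\<close>
  obtain s where s: "(x * g) ^ k - (-1) ^ k = f * s"
    using power_diff_sumr2[of "x * g" k "-1"] by (simp add: f_def add.commute)
  have "(-1) ^ k * x ^ k * (g ^ k - f * h) = (-1) ^ k * ((x * g) ^ k - f * (x ^ k * h))"
    by (simp add: algebra_simps power_mult_distrib)
  also have "(x * g) ^ k = f * s + (-1) ^ k" using s by (simp add: algebra_simps)
  also have "(-1) ^ k * (f * s + (-1) ^ k - f * (x ^ k * h)) = f * ((-1) ^ k * (s - x ^ k * h)) + 1"
    by (simp add: algebra_simps flip: power_mult_distrib)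
  finally obtain w where w: "f * w + 1 \<in> polys_over M" using * by auto
  obtain D where D: "coeff f D \<notin> M" "\<And>i. i > D \<Longrightarrow> coeff f i \<in> M"
    using top_coeff[OF \<open>f \<notin> polys_over M\<close>] by blast
  have "D > 0" using D(2)[of "Suc i"] i by (cases D) auto
  show False
  proof (cases "w \<in> polys_over M")
    case True
    then have "f * w \<in> polys_over M" by (rule polys_over_mult)
    then have "coeff (f * w + 1) 0 - coeff (f * w) 0 \<in> M"
      using w unfolding polys_over_def by (blast intro: diff_in)
    then show False using one_notin by simp
  next
    case False
    then obtain e where e: "coeff w e \<notin> M" "\<And>i. i > e \<Longrightarrow> coeff w i \<in> M"
      using top_coeff by blast
    have "coeff (f * w + 1) (D + e) = coeff (f * w) (D + e)" using \<open>D > 0\<close> by simp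
    then show False using top_coeff_mult[OF D e] w unfolding polys_over_def by (metis mem_Collect_eq)
  qed
qed


text \<open>If \<open>t\<close> has degree \<open>q\<close> over \<open>B\<close> and \<open>c\<close> is the leading coefficient of its equation, then some
  \<open>c ^ N * v\<close> is a combination of \<open>1, t, ..., t ^ (q - 1)\<close>, which are independent over \<open>B\<close>. An element
  \<open>r\<close> inverting all of \<open>B[t]\<close> divides some \<open>e\<close> in \<open>B\<close>; comparing constant coefficients, \<open>c * e\<close> inverts
  all of \<open>B\<close>.\<close>

lemma goldman_descent:
  assumes B: "is_subring B" and gold: "goldman (adjoin B t)"
  shows "goldman B"
proof -
  note P = is_subring_polys_over[OF B]
  note A = is_subring_adjoin[OF B, of t]
  define eqn where
    "eqn n p \<longleftrightarrow> p \<in> polys_over B \<and> poly p t \<in> M \<and> degree p = n \<and> lead_coeff p \<notin> M" for n p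
  \<comment> \<open>Cutting \<open>g\<close> off after its last coefficient outside \<open>M\<close>
    changes its value only by an element of \<open>M\<close>, and gives an equation whose honest
    leading coefficient is nonzero modulo \<open>M\<close>.\<close>
  have trunc: "\<exists>n p. eqn n p \<and> n < q"
    if g: "g \<in> polys_over B" "poly g t \<in> M" "g \<notin> polys_over M" "\<And>i. i \<ge> q \<Longrightarrow> coeff g i \<in> M" for g q
  proof -
    obtain D where D: "coeff g D \<notin> M" "\<And>i. i > D \<Longrightarrow> coeff g i \<in> M"
      using top_coeff[OF g(3)] by blast
    define p where "p = (\<Sum>i\<le>D. monom (coeff g i) i)"
    have cp: "coeff p i = (if i \<le> D then coeff g i else 0)" for i
      unfolding p_def by (simp add: coeff_sum)
    have "degree p = D"
    proof (rule antisym)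
      show "degree p \<le> D" by (rule degree_le) (simp add: cp)
      have "coeff g D \<noteq> 0" using D(1) zero_in by metis
      then show "D \<le> degree p" by (intro le_degree) (simp add: cp)
    qed
    moreover have "g - p \<in> polys_over M" using D(2) zero_in by (simp add: polys_over_def cp)
    then have "poly (g - p) t \<in> M" by (rule poly_in)
    then have "poly p t \<in> M" using diff_in[OF g(2), of "poly g t - poly p t"] by simp
    moreover have "p \<in> polys_over B"
      using g(1) is_subring_zero[OF B] by (auto simp: polys_over_def cp)
    ultimately have "eqn D p" using D(1) by (simp add: eqn_def cp)
    moreover have "D < q" using D(1) g(4) not_le by blast
    ultimately show ?thesis by blast
  qed
  have "algebraic B t" by (rule goldman_adjoin_algebraic[OF assms])
  then obtain f where f: "f \<in> polys_over B" "f \<notin> polys_over M" "poly f t \<in> M"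
    by (auto simp: algebraic_def)
  have "\<exists>n p. eqn n p"
    using trunc[of f "Suc (degree f)"] f zero_in by (metis coeff_eq_0 less_eq_Suc_le)
  then obtain p where p: "eqn (LEAST n. \<exists>p. eqn n p) p" using LeastI_ex[of "\<lambda>n. \<exists>p. eqn n p"] by blast
  define q where "q = (LEAST n. \<exists>p. eqn n p)"
  define c where "c = lead_coeff p"
  have pB: "p \<in> polys_over B" "poly p t \<in> M" "degree p = q" "c \<notin> M" "c \<in> B"
    using p by (auto simp: eqn_def q_def c_def polys_over_def)
  have least: "\<not> eqn n g" if "n < q" for n g
    using that unfolding q_def using not_less_Least by blast
  \<comment> \<open>Independence of the powers of \<open>t\<close> below \<open>q\<close> modulo
    \<open>M\<close>: a nontrivial relation would be an equation of degree less than the minimum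
    \<open>q\<close>.\<close>
  have direct: "g \<in> polys_over M"
    if "g \<in> polys_over B" "poly g t \<in> M" "\<And>i. i \<ge> q \<Longrightarrow> coeff g i \<in> M" for g
    using trunc[OF that(1,2) _ that(3)] least by blast
  have "q > 0"
  proof (rule ccontr)
    assume "\<not> q > 0"
    then have "p = [:c:]" unfolding c_def using pB(3) by (auto elim: degree_eq_zeroE)
    then show False using pB(2,4) by simp
  qed
  \<comment> \<open>Pseudo-division by \<open>p\<close>: each elimination of a top term costs one
    factor \<open>c\<close>, because \<open>c\<close> cannot be inverted in
    \<open>B\<close>.\<close>
  have red: "\<exists>N. \<exists>g'\<in>polys_over B. (\<forall>i\<ge>q. coeff g' i = 0) \<and> c ^ N * poly g t - poly g' t \<in> M"
    if "g \<in> polys_over B" "\<And>i. i \<ge> n \<Longrightarrow> coeff g i = 0" for n g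
    using that
  proof (induction n arbitrary: g)
    case 0
    then show ?case using zero_in by (intro exI[of _ 0] bexI[of _ g]) auto
  next
    case (Suc n)
    show ?case
    proof (cases "Suc n \<le> q")
      case True
      then show ?thesis using Suc.prems zero_in by (intro exI[of _ 0] bexI[of _ g]) auto
    next
      case False
      define m where "m = monom (coeff g n) (n - q)"
      define h where "h = [:c:] * g - m * p"
      have mB: "m \<in> polys_over B"
        unfolding m_def using Suc.prems(1) by (intro monom_in_polys_over B) (auto simp: polys_over_def)
      then have hB: "h \<in> polys_over B"
        unfolding h_def using Suc.prems(1) pB const_in_polys_over[OF B]
        by (intro is_subring_diff is_subring_mult P) auto
      have "coeff h i = 0" if "i \<ge> n" for i
      proof (cases "i = n")
        case True
        then show ?thesis
          using False pB(3) by (auto simp: h_def m_def coeff_monom_mult c_def)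
      next
        case False
        then have "i > n" using that by simp
        moreover have "coeff p (i - (n - q)) = 0"
          using \<open>i > n\<close> \<open>\<not> Suc n \<le> q\<close> pB(3) by (intro coeff_eq_0) auto
        ultimately show ?thesis
          using Suc.prems(2)[of i] by (simp add: h_def m_def coeff_monom_mult)
      qed
      then obtain N g' where g': "g' \<in> polys_over B" "\<forall>i\<ge>q. coeff g' i = 0"
          "c ^ N * poly h t - poly g' t \<in> M"
        using Suc.IH[OF hB] by blast
      have "c ^ Suc N * poly g t - poly g' t =
          (c ^ N * poly h t - poly g' t) + c ^ N * poly m t * poly p t"
        by (simp add: h_def algebra_simps)
      then have "c ^ Suc N * poly g t - poly g' t \<in> M"
        using add_in[OF g'(3) mult_in[OF pB(2)]] by metis
      then show ?thesis using g' by blast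
    qed
  qed
  have red': "\<exists>N. \<exists>g\<in>polys_over B. (\<forall>i\<ge>q. coeff g i = 0) \<and> c ^ N * v - poly g t \<in> M"
    if v: "v \<in> adjoin B t" for v
  proof -
    obtain g where "g \<in> polys_over B" "v = poly g t" using v by (auto simp: adjoin_def)
    then show ?thesis using red[of g "Suc (degree g)"] by (auto simp: coeff_eq_0)
  qed
  obtain r where r: "r \<in> adjoin B t" "r \<notin> M"
      "\<And>b. b \<in> adjoin B t \<Longrightarrow> b \<notin> M \<Longrightarrow> \<exists>v\<in>adjoin B t. \<exists>k. r ^ k - b * v \<in> M"
    by (rule goldmanE[OF gold]) blast
  \<comment> \<open>The \<open>q + 1\<close> powers \<open>r ^ 0, ..., r ^ q\<close>, multiplied by
    a common power of \<open>c\<close>, are combinations of only \<open>q\<close> powers of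
    \<open>t\<close>. So \<open>r\<close> satisfies an equation over \<open>B\<close>; divided by
    its lowest power of \<open>r\<close>, its lowest coefficient becomes a multiple of
    \<open>r\<close>.\<close>
  have "\<exists>e w. e \<in> B \<and> e \<notin> M \<and> w \<in> adjoin B t \<and> e - r * w \<in> M"
  proof -
    have "\<forall>j. \<exists>N g. g \<in> polys_over B \<and> (\<forall>i\<ge>q. coeff g i = 0) \<and> c ^ N * r ^ j - poly g t \<in> M"
      using red'[of "r ^ j" for j] is_subring_power[OF A r(1)] by blast
    then obtain N g where g: "\<And>j. g j \<in> polys_over B" "\<And>i j. i \<ge> q \<Longrightarrow> coeff (g j) i = 0"
      "\<And>j. c ^ N j * r ^ j - poly (g j) t \<in> M" by metis
    define K where "K = Max (N ` {..q})"
    define g' where "g' j = [:c ^ (K - N j):] * g j" for j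
    have g'B: "g' j \<in> polys_over B" for j
      unfolding g'_def using g(1) const_in_polys_over[OF B] is_subring_power[OF B pB(5)]
      by (intro is_subring_mult P) auto
    have g'0: "i \<ge> q \<Longrightarrow> coeff (g' j) i = 0" for i j using g(2) by (simp add: g'_def)
    have g'M: "c ^ K * r ^ j - poly (g' j) t \<in> M" if "j \<le> q" for j
    proof -
      have "N j \<le> K" unfolding K_def using that by (intro Max_ge) auto
      then have "c ^ K = c ^ (K - N j) * c ^ N j" by (simp flip: power_add)
      then have "c ^ K * r ^ j - poly (g' j) t = c ^ (K - N j) * (c ^ N j * r ^ j - poly (g j) t)"
        by (simp add: g'_def algebra_simps)
      then show ?thesis using g(3) mult_in by simp
    qed
    obtain l where l: "\<forall>j\<in>{..q}. l j \<in> B" "\<exists>j\<in>{..q}. l j \<notin> M"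
        "\<forall>i\<in>{..<q}. (\<Sum>j\<le>q. l j * coeff (g' j) i) \<in> M"
      using linear_dependence[OF B, of "{..<q}" "{..q}" "\<lambda>i j. coeff (g' j) i"] g'B
      by (auto simp: polys_over_def)
    have "(\<Sum>j\<le>q. [:l j:] * g' j) \<in> polys_over M"
      unfolding polys_over_def
    proof (intro CollectI allI)
      fix i
      show "coeff (\<Sum>j\<le>q. [:l j:] * g' j) i \<in> M"
        using l(3) g'0[of i] zero_in by (cases "i < q") (auto simp: coeff_sum)
    qed
    then have "poly (\<Sum>j\<le>q. [:l j:] * g' j) t \<in> M" by (rule poly_in)
    moreover have "(\<Sum>j\<le>q. l j * (c ^ K * r ^ j - poly (g' j) t)) \<in> M"
      using g'M by (intro sum_in mult_in) auto
    ultimately have "poly (\<Sum>j\<le>q. [:l j:] * g' j) t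
        + (\<Sum>j\<le>q. l j * (c ^ K * r ^ j - poly (g' j) t)) \<in> M" by (rule add_in)
    moreover have "poly (\<Sum>j\<le>q. [:l j:] * g' j) t
        + (\<Sum>j\<le>q. l j * (c ^ K * r ^ j - poly (g' j) t)) = c ^ K * (\<Sum>j\<le>q. l j * r ^ j)"
      by (simp add: poly_sum sum_distrib_left algebra_simps flip: sum.distrib)
    ultimately have "c ^ K * (\<Sum>j\<le>q. l j * r ^ j) \<in> M" by simp
    then have sumM: "(\<Sum>j\<le>q. l j * r ^ j) \<in> M"
      using pB(4) power_in mult_in_iff by blast
    \<comment> \<open>Coefficients below \<open>j0\<close> lie in \<open>M\<close> and may be
      dropped. The common factor \<open>r ^ j0\<close> can then be cancelled, since \<open>r\<close>
      is outside the prime \<open>M\<close>.\<close>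
    define j0 where "j0 = (LEAST j. j \<le> q \<and> l j \<notin> M)"
    have j0: "j0 \<le> q" "l j0 \<notin> M"
      using LeastI_ex[of "\<lambda>j. j \<le> q \<and> l j \<notin> M"] l(2) by (auto simp: j0_def)
    have below: "l j \<in> M" if "j < j0" for j
      using not_less_Least[of j "\<lambda>j. j \<le> q \<and> l j \<notin> M"] that j0(1) by (auto simp: j0_def)
    define w where "w = - (\<Sum>j\<in>{j0<..q}. l j * r ^ (j - Suc j0))"
    have "{..q} = {..<j0} \<union> {j0} \<union> {j0<..q}" "{..<j0} \<inter> {j0<..q} = {}" using j0 by auto
    then have "(\<Sum>j\<le>q. l j * r ^ j) =
        (\<Sum>j<j0. l j * r ^ j) + l j0 * r ^ j0 + (\<Sum>j\<in>{j0<..q}. l j * r ^ j)"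
      by (simp add: sum.union_disjoint ivl_disj_int)
    also have "(\<Sum>j\<in>{j0<..q}. l j * r ^ j) = - (r ^ Suc j0 * w)"
      unfolding w_def sum_distrib_left minus_mult_right minus_minus
      by (intro sum.cong refl) (auto simp: algebra_simps simp flip: power_add power_Suc)
    finally have "(\<Sum>j\<le>q. l j * r ^ j) - (\<Sum>j<j0. l j * r ^ j) = r ^ j0 * (l j0 - r * w)"
      by (simp add: algebra_simps)
    moreover have "(\<Sum>j<j0. l j * r ^ j) \<in> M"
      using below by (intro sum_in mult_right_in) auto
    ultimately have "r ^ j0 * (l j0 - r * w) \<in> M" using sumM diff_in by metis
    then have "l j0 - r * w \<in> M" using r(2) power_in mult_in_iff by blast
    moreover have "w \<in> adjoin B t"
      unfolding w_def using l(1) r(1) adjoin_base[OF B]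
      by (intro is_subring_uminus is_subring_sum is_subring_mult is_subring_power A) auto
    ultimately show ?thesis using j0 l(1) by blast
  qed
  then obtain e w where e: "e \<in> B" "e \<notin> M" "w \<in> adjoin B t" "e - r * w \<in> M" by blast
  show ?thesis
    unfolding goldman_def
  proof (rule bexI[of _ "c * e"], intro conjI ballI impI)
    show "c * e \<notin> M" using e pB mult_in_iff by blast
    show "c * e \<in> B" using e pB is_subring_mult[OF B] by blast
  next
    fix b assume b: "b \<in> B" "b \<notin> M"
    then obtain v k where v: "v \<in> adjoin B t" "r ^ k - b * v \<in> M"
      using r(3) adjoin_base[OF B] by blast
    have "v * w ^ k \<in> adjoin B t" using v e by (intro is_subring_mult is_subring_power A)
    then obtain N g where g: "g \<in> polys_over B" "\<forall>i\<ge>q. coeff g i = 0"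
        "c ^ N * (v * w ^ k) - poly g t \<in> M"
      using red' by blast
    have "e ^ k - (r * w) ^ k \<in> M" by (rule diff_power) (rule e)
    moreover have "(r * w) ^ k - b * (v * w ^ k) \<in> M"
      using mult_right_in[OF v(2), of "w ^ k"] by (simp add: algebra_simps power_mult_distrib)
    ultimately have "c ^ N * (e ^ k - b * (v * w ^ k)) \<in> M" by (intro mult_in) (rule diff_trans)
    moreover have "b * (c ^ N * (v * w ^ k) - poly g t) \<in> M" by (intro mult_in g)
    ultimately have "c ^ N * (e ^ k - b * (v * w ^ k)) + b * (c ^ N * (v * w ^ k) - poly g t) \<in> M"
      by (rule add_in)
    then have "poly ([:c ^ N * e ^ k:] - [:b:] * g) t \<in> M" by (simp add: algebra_simps)
    moreover have "[:c ^ N * e ^ k:] - [:b:] * g \<in> polys_over B"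
      using b g e pB const_in_polys_over[OF B] is_subring_mult[OF B] is_subring_power[OF B]
      by (intro is_subring_diff is_subring_mult P) auto
    moreover have "coeff ([:c ^ N * e ^ k:] - [:b:] * g) i \<in> M" if "i \<ge> q" for i
      using that g(2) \<open>q > 0\<close> zero_in by (cases i) auto
    ultimately have "[:c ^ N * e ^ k:] - [:b:] * g \<in> polys_over M" by (intro direct)
    then have "coeff ([:c ^ N * e ^ k:] - [:b:] * g) 0 \<in> M" unfolding polys_over_def by blast
    then have "c ^ N * e ^ k - b * coeff g 0 \<in> M" by simp
    \<comment> \<open>The factor \<open>c ^ k * e ^ N\<close> equalizes the exponents, so that a
      power of the single element \<open>c * e\<close> appears.\<close>
    then have "c ^ k * e ^ N * (c ^ N * e ^ k - b * coeff g 0) \<in> M" by (rule mult_in)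
    then have "(c * e) ^ (N + k) - b * (c ^ k * e ^ N * coeff g 0) \<in> M"
      by (simp add: algebra_simps power_mult_distrib power_add)
    moreover have "c ^ k * e ^ N * coeff g 0 \<in> B"
      using e pB g by (intro is_subring_mult is_subring_power B) (auto simp: polys_over_def)
    ultimately show "\<exists>v\<in>B. \<exists>k. (c * e) ^ k - b * v \<in> M" by blast
  qed
qed

end

section \<open>Hilbert's basis theorem\<close>

definition ideal_of :: "'a::comm_ring_1 set \<Rightarrow> 'a set \<Rightarrow> bool" where
  "ideal_of B J \<longleftrightarrow> J \<subseteq> B \<and> 0 \<in> J \<and> (\<forall>a\<in>J. \<forall>b\<in>J. a + b \<in> J) \<and> (\<forall>r\<in>B. \<forall>a\<in>J. r * a \<in> J)"

text \<open>Generation of \<open>J\<close> by \<open>F\<close> is expressed by minimality, without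
  forming the ideal generated by \<open>F\<close> inside \<open>B\<close>.\<close>

definition noetherian_subring :: "'a::comm_ring_1 set \<Rightarrow> bool" where
  "noetherian_subring B \<longleftrightarrow> (\<forall>J. ideal_of B J \<longrightarrow>
     (\<exists>F. finite F \<and> F \<subseteq> J \<and> (\<forall>K. ideal_of B K \<and> F \<subseteq> K \<longrightarrow> J \<subseteq> K)))"

lemma ideal_of_combinations:
  assumes B: "is_subring B" and a: "\<And>i. i \<in> I \<Longrightarrow> a i \<in> B"
  shows "ideal_of B {\<Sum>i\<in>I. u i * a i |u. \<forall>i\<in>I. u i \<in> B}" (is "ideal_of B ?J")
  unfolding ideal_of_def
proof (intro conjI ballI)
  show "?J \<subseteq> B" using a by (auto intro!: is_subring_sum is_subring_mult B)
  show "0 \<in> ?J"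
    using is_subring_zero[OF B] by (intro CollectI exI[of _ "\<lambda>_. 0"]) auto
next
  fix v w assume "v \<in> ?J" "w \<in> ?J"
  then obtain u u' where "v = (\<Sum>i\<in>I. u i * a i)" "w = (\<Sum>i\<in>I. u' i * a i)"
    "\<forall>i\<in>I. u i \<in> B" "\<forall>i\<in>I. u' i \<in> B" by blast
  then show "v + w \<in> ?J"
    by (intro CollectI exI[of _ "\<lambda>i. u i + u' i"])
      (auto simp: algebra_simps sum.distrib intro: is_subring_add B)
next
  fix r v assume "r \<in> B" "v \<in> ?J"
  then obtain u where "v = (\<Sum>i\<in>I. u i * a i)" "\<forall>i\<in>I. u i \<in> B" by blast
  then show "r * v \<in> ?J"
    using \<open>r \<in> B\<close> by (intro CollectI exI[of _ "\<lambda>i. r * u i"])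
      (auto simp: algebra_simps sum_distrib_left intro: is_subring_mult B)
qed

lemma combination_self:
  assumes "is_subring B" "finite I" "j \<in> I"
  shows "a j \<in> {\<Sum>i\<in>I. u i * a i |u. \<forall>i\<in>I. u i \<in> B}"
proof -
  have "a j = (\<Sum>i\<in>I. (if i = j then 1 else 0) * a i)"
    using assms by (simp add: if_distrib[of "\<lambda>c. c * _"] cong: if_cong)
  then show ?thesis
    using is_subring_zero[OF assms(1)] is_subring_one[OF assms(1)]
    by (intro CollectI exI[of _ "\<lambda>i. if i = j then 1 else 0"]) auto
qed

text \<open>The ideals \<open>C N\<close> generated by the first \<open>N\<close> terms ascend.
  Their union is finitely generated, hence equal to one of them, and then the term
  \<open>a N\<close> is a combination of its predecessors.\<close>

lemma noetherian_subring_stationary: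
  fixes a :: "nat \<Rightarrow> 'a::comm_ring_1"
  assumes B: "is_subring B" and noeth: "noetherian_subring B" and a: "\<And>i. a i \<in> B"
  obtains N u where "\<And>i. u i \<in> B" "a N = (\<Sum>i<N. u i * a i)"
proof -
  define C where "C N = {\<Sum>i<N. u i * a i |u. \<forall>i\<in>{..<N}. u i \<in> B}" for N
  have C: "ideal_of B (C N)" for N
    unfolding C_def using a by (intro ideal_of_combinations B)
  have "C N \<subseteq> C (Suc N)" for N
  proof
    fix v assume "v \<in> C N"
    then obtain u where u: "v = (\<Sum>i<N. u i * a i)" "\<forall>i\<in>{..<N}. u i \<in> B"
      unfolding C_def by blast
    then have "v = (\<Sum>i<Suc N. (u(N := 0)) i * a i)" by simp
    then show "v \<in> C (Suc N)"
      unfolding C_def using u(2) is_subring_zero[OF B]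
      by (intro CollectI exI[of _ "u(N := 0)"]) auto
  qed
  then have mono: "C M \<subseteq> C N" if "M \<le> N" for M N
    using lift_Suc_mono_le[of C M N] that by blast
  have "ideal_of B (\<Union>N. C N)"
    unfolding ideal_of_def
  proof (intro conjI ballI)
    show "(\<Union>N. C N) \<subseteq> B" "0 \<in> (\<Union>N. C N)" using C unfolding ideal_of_def by blast+
  next
    fix v w assume "v \<in> (\<Union>N. C N)" "w \<in> (\<Union>N. C N)"
    then obtain M N where "v \<in> C M" "w \<in> C N" by blast
    then have "v \<in> C (max M N)" "w \<in> C (max M N)"
      using mono[of M "max M N"] mono[of N "max M N"] by auto
    then have "v + w \<in> C (max M N)" using C[of "max M N"] unfolding ideal_of_def by blast
    then show "v + w \<in> (\<Union>N. C N)" by blast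
  next
    fix r v assume "r \<in> B" "v \<in> (\<Union>N. C N)"
    then show "r * v \<in> (\<Union>N. C N)" using C unfolding ideal_of_def by blast
  qed
  then obtain F where F: "finite F" "F \<subseteq> (\<Union>N. C N)"
    "\<And>K. ideal_of B K \<Longrightarrow> F \<subseteq> K \<Longrightarrow> (\<Union>N. C N) \<subseteq> K"
    using noeth unfolding noetherian_subring_def by meson
  have "\<exists>N. F \<subseteq> C N"
    using F(1,2)
  proof (induction F rule: finite_induct)
    case empty
    show ?case by simp
  next
    case (insert f F)
    then obtain M N where "f \<in> C M" "F \<subseteq> C N" by auto
    then have "insert f F \<subseteq> C (max M N)"
      using mono[of M "max M N"] mono[of N "max M N"] by auto
    then show ?case by blast
  qed
  then obtain N where "F \<subseteq> C N" by blast
  then have "(\<Union>N. C N) \<subseteq> C N" using F(3) C by blast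
  moreover have "a N \<in> C (Suc N)"
    unfolding C_def using combination_self[OF B, of "{..<Suc N}" N a] by simp
  ultimately have "a N \<in> C N" by blast
  then obtain u where "a N = (\<Sum>i<N. u i * a i)" "\<forall>i\<in>{..<N}. u i \<in> B"
    unfolding C_def by blast
  then show ?thesis
    using that[of "\<lambda>i. if i < N then u i else 0" N] is_subring_zero[OF B] by simp
qed

text \<open>The argument of Sarges: generators are chosen one after the other, each the value of a polynomial of
  least degree outside the ideal generated by the previous ones.\<close>

lemma noetherian_subring_adjoin:
  assumes B: "is_subring B" and noeth: "noetherian_subring B"
  shows "noetherian_subring (adjoin B t)"
  unfolding noetherian_subring_def
proof (intro allI impI, rule ccontr)
  fix J assume J: "ideal_of (adjoin B t) J"
  assume nfg: "\<not> (\<exists>F. finite F \<and> F \<subseteq> J \<and> (\<forall>K. ideal_of (adjoin B t) K \<and> F \<subseteq> K \<longrightarrow> J \<subseteq> K))"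
  note A = is_subring_adjoin[OF B, of t]
  note P = is_subring_polys_over[OF B]
  define G where "G f k = {\<Sum>i<k. u i * poly (f i) t |u. \<forall>i\<in>{..<k}. u i \<in> adjoin B t}"
    for f :: "nat \<Rightarrow> 'a poly" and k
  define cand where "cand f k p \<longleftrightarrow> p \<in> polys_over B \<and> poly p t \<in> J \<and> poly p t \<notin> G f k" for f k p
  define R where "R f k p \<longleftrightarrow> cand f k p \<and> (\<forall>q. cand f k q \<longrightarrow> degree p \<le> degree q)" for f k p
  have G_ideal: "ideal_of (adjoin B t) (G f k)" if "\<And>i. i < k \<Longrightarrow> poly (f i) t \<in> J" for f k
    unfolding G_def using that J by (intro ideal_of_combinations A) (auto simp: ideal_of_def)
  \<comment> \<open>Dependent choice: the condition on \<open>f k\<close> refers to \<open>f\<close>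
    only below \<open>k\<close>. A candidate exists at each stage because otherwise \<open>J\<close>
    would be generated by the finitely many values chosen so far.\<close>
  have "\<exists>f. \<forall>k. R f k (f k)"
  proof (rule dependent_wellorder_choice)
    fix p :: "'a poly" and f g :: "nat \<Rightarrow> 'a poly" and k
    assume "\<And>i. i < k \<Longrightarrow> f i = g i"
    then have "G f k = G g k" unfolding G_def by (intro Collect_cong) (auto intro!: sum.cong)
    then show "R f k p = R g k p" unfolding R_def cand_def by simp
  next
    fix k and f :: "nat \<Rightarrow> 'a poly"
    assume IH: "\<And>i. i < k \<Longrightarrow> R f i (f i)"
    then have fJ: "\<And>i. i < k \<Longrightarrow> poly (f i) t \<in> J" unfolding R_def cand_def by blast
    have "\<not> J \<subseteq> G f k"
    proof
      assume le: "J \<subseteq> G f k"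
      have "G f k \<subseteq> K" if "ideal_of (adjoin B t) K" "(\<lambda>i. poly (f i) t) ` {..<k} \<subseteq> K" for K
      proof
        fix v assume "v \<in> G f k"
        then obtain u where u: "v = (\<Sum>i<k. u i * poly (f i) t)" "\<forall>i\<in>{..<k}. u i \<in> adjoin B t"
          unfolding G_def by blast
        have K: "0 \<in> K" "\<And>a b. a \<in> K \<Longrightarrow> b \<in> K \<Longrightarrow> a + b \<in> K"
          "\<And>r a. r \<in> adjoin B t \<Longrightarrow> a \<in> K \<Longrightarrow> r * a \<in> K"
          using that(1) unfolding ideal_of_def by blast+
        have sumK: "finite S \<Longrightarrow> (\<And>i. i \<in> S \<Longrightarrow> h i \<in> K) \<Longrightarrow> sum h S \<in> K" for S :: "nat set" and h
          by (induction S rule: finite_induct) (auto simp: K)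
        show "v \<in> K" unfolding u(1) using u(2) that(2) by (intro sumK K(3)) auto
      qed
      then have "finite ((\<lambda>i. poly (f i) t) ` {..<k}) \<and> (\<lambda>i. poly (f i) t) ` {..<k} \<subseteq> J \<and>
          (\<forall>K. ideal_of (adjoin B t) K \<and> (\<lambda>i. poly (f i) t) ` {..<k} \<subseteq> K \<longrightarrow> J \<subseteq> K)"
        using le fJ by blast
      then show False using nfg by blast
    qed
    then obtain v where "v \<in> J" "v \<notin> G f k" by blast
    moreover from this obtain q where "q \<in> polys_over B" "v = poly q t"
      using J by (auto simp: ideal_of_def adjoin_def)
    ultimately have "\<exists>q. cand f k q" unfolding cand_def by blast
    then show "\<exists>p. R f k p"
      unfolding R_def using ex_has_least_nat[of "cand f k" _ degree] by blast
  qed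
  then obtain f where f: "\<And>k. R f k (f k)" by blast
  have fB: "f k \<in> polys_over B" and fJ: "poly (f k) t \<in> J" and fG: "poly (f k) t \<notin> G f k"
    and fmin: "cand f k q \<Longrightarrow> degree (f k) \<le> degree q" for k q
    using f[of k] unfolding R_def cand_def by blast+
  have GG: "ideal_of (adjoin B t) (G f k)" for k using G_ideal fJ by blast
  have GJ: "v \<in> J" if v: "v \<in> G f k" for v k
  proof -
    obtain u where u: "v = (\<Sum>i<k. u i * poly (f i) t)" "\<forall>i\<in>{..<k}. u i \<in> adjoin B t"
      using v unfolding G_def by blast
    have sumJ: "finite S \<Longrightarrow> (\<And>i. i \<in> S \<Longrightarrow> h i \<in> J) \<Longrightarrow> sum h S \<in> J" for S :: "nat set" and h
      by (induction S rule: finite_induct) (use J in \<open>auto simp: ideal_of_def\<close>)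
    show ?thesis unfolding u(1) using u(2) fJ J by (intro sumJ) (auto simp: ideal_of_def)
  qed
  have Gmono: "G f i \<subseteq> G f k" if "i \<le> k" for i k
  proof
    fix v assume "v \<in> G f i"
    then obtain u where u: "v = (\<Sum>j<i. u j * poly (f j) t)" "\<forall>j\<in>{..<i}. u j \<in> adjoin B t"
      unfolding G_def by blast
    have "v = (\<Sum>j<k. (if j < i then u j else 0) * poly (f j) t)"
      unfolding u(1) using that by (intro sum.mono_neutral_cong_left) auto
    then show "v \<in> G f k"
      unfolding G_def using u(2) is_subring_zero[OF A]
      by (intro CollectI exI[of _ "\<lambda>j. if j < i then u j else 0"]) auto
  qed
  \<comment> \<open>The later choice \<open>f k\<close> was already a candidate at stage
    \<open>i\<close>, because \<open>G f i\<close> is contained in \<open>G f k\<close>.\<close>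
  have deg_mono: "degree (f i) \<le> degree (f k)" if "i \<le> k" for i k
    using fmin[of i "f k"] fB fJ fG[of k] Gmono[OF that] unfolding cand_def by blast
  have "lead_coeff (f i) \<in> B" for i using fB[of i] by (simp add: polys_over_def)
  then obtain N u where u: "\<And>i. u i \<in> B" "lead_coeff (f N) = (\<Sum>i<N. u i * lead_coeff (f i))"
    using noetherian_subring_stationary[OF B noeth, of "\<lambda>i. lead_coeff (f i)"] by blast
  \<comment> \<open>The dependence among leading coefficients is lifted: \<open>s\<close> has the
    leading term of \<open>f N\<close>, but its value lies in \<open>G f N\<close>. So
    \<open>f N - s\<close> is still a candidate, of degree too small for the choice of
    \<open>f N\<close>.\<close>
  define s where "s = (\<Sum>i<N. monom (u i) (degree (f N) - degree (f i)) * f i)"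
  define q where "q = f N - s"
  have sG: "poly s t \<in> G f N"
    unfolding s_def G_def poly_sum poly_mult
    using u(1) by (intro CollectI exI[of _ "\<lambda>i. poly (monom (u i) (degree (f N) - degree (f i))) t"])
      (auto simp: adjoin_def intro!: imageI monom_in_polys_over B)
  have "cand f N q"
    unfolding cand_def
  proof (intro conjI)
    show "q \<in> polys_over B"
      unfolding q_def s_def using u(1) fB
      by (intro is_subring_diff is_subring_sum is_subring_mult P monom_in_polys_over B) auto
    have "- 1 \<in> adjoin B t" using is_subring_uminus[OF A] is_subring_one[OF A] by blast
    then have "- 1 * poly s t \<in> J" using GJ[OF sG] J unfolding ideal_of_def by blast
    then have "poly (f N) t + - 1 * poly s t \<in> J" using fJ J unfolding ideal_of_def by blast
    then show "poly q t \<in> J" by (simp add: q_def)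
    show "poly q t \<notin> G f N"
    proof
      assume "poly q t \<in> G f N"
      then have "poly q t + poly s t \<in> G f N" using GG sG unfolding ideal_of_def by blast
      then show False using fG[of N] by (simp add: q_def)
    qed
  qed
  then have "degree (f N) \<le> degree q" and "q \<noteq> 0"
    using fmin GG[of N] by (auto simp: cand_def ideal_of_def)
  moreover have "coeff q i = 0" if "i \<ge> degree (f N)" for i
  proof (cases "i = degree (f N)")
    case True
    have "coeff s (degree (f N)) = (\<Sum>i<N. u i * lead_coeff (f i))"
      unfolding s_def coeff_sum using deg_mono
      by (intro sum.cong refl) (auto simp: coeff_monom_mult)
    then show ?thesis using u(2) True by (simp add: q_def)
  next
    case False
    have "coeff (monom (u j) (degree (f N) - degree (f j)) * f j) i = 0" if "j < N" for j
      using False \<open>i \<ge> degree (f N)\<close> deg_mono[of j N] that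
        coeff_eq_0[of "f j" "i - (degree (f N) - degree (f j))"]
      by (auto simp: coeff_monom_mult)
    then have "coeff s i = 0" unfolding s_def coeff_sum by (intro sum.neutral) auto
    then show ?thesis using False that by (simp add: q_def coeff_eq_0)
  qed
  ultimately show False by (metis leading_coeff_0_iff)
qed

section \<open>Polynomials and substitutions\<close>

abbreviation "lookup \<equiv> Poly_Mapping.lookup"
abbreviation "keys \<equiv> Poly_Mapping.keys"

lemma mconst_simps [simp]:
  "mconst 0 = 0" "mconst 1 = 1" "mconst (a + b) = mconst a + mconst b"
  "mconst (a - b) = mconst a - mconst b" "mconst (a * b) = mconst a * mconst b"
  "mconst (- a) = - mconst a"
  by (simp_all add: mconst_def single_add single_diff mult_single single_uminus)

lemma mmonom_simps [simp]: "mmonom 0 = 1" "mmonom (m + m') = mmonom m * mmonom m'"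
  by (simp_all add: mmonom_def mult_single)

lemma mvar_eq_mmonom: "mvar v = mmonom (Poly_Mapping.single v 1)"
  by (simp add: mvar_def mmonom_def)

lemma mconst_mmonom: "mconst c * mmonom m = Poly_Mapping.single m c"
  by (simp add: mconst_def mmonom_def mult_single)

lemma lookup_mconst_mult [simp]: "lookup (mconst c * p) m = c * lookup p m"
  by (simp add: mconst_def flip: mult_map_scale_conv_mult) (simp add: Poly_Mapping.map.rep_eq when_def)

text \<open>Linear extension from the monomial basis. A multiplicative \<open>b\<close> yields a
  substitution homomorphism; later \<open>b = basis\<close> yields a change of
  \<open>K\<close>-basis.\<close>

definition lin_ext ::
  "(('v \<Rightarrow>\<^sub>0 nat) \<Rightarrow> ('v, 'k::comm_ring_1) mpoly) \<Rightarrow> ('v, 'k) mpoly \<Rightarrow> ('v, 'k) mpoly" where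
  "lin_ext b p = (\<Sum>m\<in>keys p. mconst (lookup p m) * b m)"

lemma lin_ext_superset:
  "finite A \<Longrightarrow> keys p \<subseteq> A \<Longrightarrow> lin_ext b p = (\<Sum>m\<in>A. mconst (lookup p m) * b m)"
  unfolding lin_ext_def by (rule sum.mono_neutral_left) (auto simp: in_keys_iff)

lemma lin_ext_zero [simp]: "lin_ext b 0 = 0"
  by (simp add: lin_ext_def)

lemma lin_ext_add [simp]: "lin_ext b (p + q) = lin_ext b p + lin_ext b q"
  using keys_add[of p q]
  by (simp add: lin_ext_superset[of "keys p \<union> keys q"] lookup_add algebra_simps sum.distrib)

lemma lin_ext_sum [simp]: "lin_ext b (\<Sum>i\<in>I. f i) = (\<Sum>i\<in>I. lin_ext b (f i))"
  by (induction I rule: infinite_finite_induct) auto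

lemma lin_ext_mconst [simp]: "lin_ext b (mconst c * p) = mconst c * lin_ext b p"
proof -
  have "keys (mconst c * p) \<subseteq> keys p" by (auto simp: in_keys_iff)
  then have "lin_ext b (mconst c * p) = (\<Sum>m\<in>keys p. mconst (lookup (mconst c * p) m) * b m)"
    by (intro lin_ext_superset) auto
  then show ?thesis by (simp add: lin_ext_def sum_distrib_left mult.assoc)
qed

lemma lin_ext_uminus [simp]: "lin_ext b (- p) = - lin_ext b p"
  using lin_ext_mconst[of b "-1" p] by simp

lemma lin_ext_diff [simp]: "lin_ext b (p - q) = lin_ext b p - lin_ext b q"
  using lin_ext_add[of b p "- q"] by simp

lemma lin_ext_mmonom [simp]: "lin_ext b (mmonom m) = b m"
  by (simp add: lin_ext_def mmonom_def)

lemma lin_ext_id: "lin_ext mmonom p = p"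
  unfolding lin_ext_def mconst_mmonom
  by (rule poly_mapping_eqI) (auto simp: lookup_sum lookup_single when_def in_keys_iff)

text \<open>The monomial case ranges only over monomials of the given \<open>p\<close>, so that
  facts about its support are available there.\<close>

lemma mpoly_induct [case_names zero add monom]:
  assumes "Q 0" "\<And>p q. Q p \<Longrightarrow> Q q \<Longrightarrow> Q (p + q)" "\<And>c m. m \<in> keys p \<Longrightarrow> Q (mconst c * mmonom m)"
  shows "Q p"
proof -
  have "finite A \<Longrightarrow> A \<subseteq> keys p \<Longrightarrow> Q (\<Sum>m\<in>A. mconst (lookup p m) * mmonom m)" for A
    by (induction A rule: finite_induct) (auto intro: assms)
  from this[of "keys p"] show ?thesis
    using lin_ext_id[of p] by (simp add: lin_ext_def)
qed

lemma lin_ext_mult: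
  assumes "\<And>m m'. b (m + m') = b m * b m'"
  shows "lin_ext b (p * q) = lin_ext b p * lin_ext b q"
proof (induction p rule: mpoly_induct)
  case (monom c m)
  show ?case
  proof (induction q rule: mpoly_induct)
    case (monom d m')
    have "mconst c * mmonom m * (mconst d * mmonom m') = mconst (c * d) * mmonom (m + m')"
      by (simp add: algebra_simps)
    then show ?case
      unfolding \<open>mconst c * mmonom m * (mconst d * mmonom m') = _\<close> lin_ext_mconst lin_ext_mmonom assms
      by (simp add: algebra_simps)
  qed (simp_all add: distrib_left)
qed (simp_all add: distrib_right)

definition eval_monom :: "('v \<Rightarrow> 'a::comm_monoid_mult) \<Rightarrow> ('v \<Rightarrow>\<^sub>0 nat) \<Rightarrow> 'a" where
  "eval_monom f m = (\<Prod>v\<in>keys m. f v ^ lookup m v)"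

lemma eval_monom_superset:
  "finite A \<Longrightarrow> keys m \<subseteq> A \<Longrightarrow> eval_monom f m = (\<Prod>v\<in>A. f v ^ lookup m v)"
  unfolding eval_monom_def by (rule prod.mono_neutral_left) (auto simp: in_keys_iff)

lemma eval_monom_zero [simp]: "eval_monom f 0 = 1"
  by (simp add: eval_monom_def)

lemma eval_monom_add: "eval_monom f (m + m') = eval_monom f m * eval_monom f m'"
  using keys_add[of m m']
  by (simp add: eval_monom_superset[of "keys m \<union> keys m'"] lookup_add power_add prod.distrib)

lemma eval_monom_single [simp]: "eval_monom f (Poly_Mapping.single v k) = f v ^ k"
  by (cases "k = 0") (simp_all add: eval_monom_def)

lemma single_sum_nat: "m = (\<Sum>v\<in>keys m. Poly_Mapping.single v (lookup m v :: nat))"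
  by (rule poly_mapping_eqI) (auto simp: lookup_sum lookup_single when_def in_keys_iff)

lemma mmonom_sum: "mmonom (\<Sum>i\<in>I. f i) = (\<Prod>i\<in>I. mmonom (f i))"
  by (induction I rule: infinite_finite_induct) auto

lemma mmonom_single: "mmonom (Poly_Mapping.single v k) = mvar v ^ k"
proof (induction k)
  case (Suc k)
  have "Poly_Mapping.single v (Suc k) = Poly_Mapping.single v 1 + Poly_Mapping.single v k"
    by (simp flip: single_add)
  then show ?case using Suc by (simp add: mvar_eq_mmonom)
qed simp

lemma eval_monom_mvar [simp]: "eval_monom mvar m = mmonom m"
  by (subst (2) single_sum_nat) (simp add: eval_monom_def mmonom_sum mmonom_single)

definition subst ::
  "('v \<Rightarrow> ('v, 'k::comm_ring_1) mpoly) \<Rightarrow> ('v, 'k) mpoly \<Rightarrow> ('v, 'k) mpoly" where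
  "subst f = lin_ext (eval_monom f)"

lemma subst_simps [simp]:
  "subst f 0 = 0" "subst f 1 = 1" "subst f (p + q) = subst f p + subst f q"
  "subst f (p - q) = subst f p - subst f q" "subst f (- p) = - subst f p"
  "subst f (mconst c * p) = mconst c * subst f p" "subst f (mmonom m) = eval_monom f m"
  using lin_ext_mmonom[of "eval_monom f" 0]
  by (simp_all add: subst_def del: lin_ext_mmonom) (simp add: subst_def)

lemma subst_mult [simp]: "subst f (p * q) = subst f p * subst f q"
  unfolding subst_def by (rule lin_ext_mult) (rule eval_monom_add)

lemma subst_mvar [simp]: "subst f (mvar v) = f v"
  by (simp add: mvar_eq_mmonom)

lemma subst_mconst [simp]: "subst f (mconst c) = mconst c"
  using subst_simps(6)[of f c 1] by simp

lemma subst_power [simp]: "subst f (p ^ k) = subst f p ^ k"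
  by (induction k) auto

lemma subst_prod [simp]: "subst f (\<Prod>i\<in>I. p i) = (\<Prod>i\<in>I. subst f (p i))"
  by (induction I rule: infinite_finite_induct) auto

lemma subst_subst: "subst f (subst g p) = subst (\<lambda>v. subst f (g v)) p"
proof (induction p rule: mpoly_induct)
  case (monom c m)
  then show ?case by (simp add: eval_monom_def)
qed simp_all

text \<open>Products of congruent factors are congruent. Applied with a prime containing the
  variables outside a set, it allows these variables to be set to \<open>0\<close>.\<close>

lemma subst_ideal_cong:
  assumes J: "is_ideal J" and "\<And>m v. m \<in> keys p \<Longrightarrow> v \<in> keys m \<Longrightarrow> f v - g v \<in> J"
  shows "subst f p - subst g p \<in> J"
proof (induction p rule: mpoly_induct)
  case zero
  then show ?case using is_ideal_zero[OF J] by simp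
next
  case (add p q)
  then show ?case using is_ideal_add[OF J add] by (simp add: algebra_simps)
next
  case (monom c m)
  have mult: "a * b - a' * b' \<in> J" if "a - a' \<in> J" "b - b' \<in> J" for a a' b b'
    using is_ideal_add[OF J is_ideal_mult[OF J that(1), of b] is_ideal_mult[OF J that(2), of a']]
    by (simp add: algebra_simps)
  have pow: "a ^ k - b ^ k \<in> J" if "a - b \<in> J" for a b k
    by (induction k) (auto intro: mult that is_ideal_zero[OF J])
  have "(\<Prod>v\<in>A. f v ^ lookup m v) - (\<Prod>v\<in>A. g v ^ lookup m v) \<in> J" if "A \<subseteq> keys m" for A
    using finite_subset[OF that finite_keys] that
    by (induction A rule: finite_induct)
      (auto simp: is_ideal_zero[OF J] intro!: mult pow assms(2)[OF monom])
  from this[of "keys m"] show ?case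
    using is_ideal_mult[OF J] unfolding eval_monom_def[symmetric] subst_simps right_diff_distrib[symmetric]
    by blast
qed

lemma subst_cong:
  assumes "\<And>m v. m \<in> keys p \<Longrightarrow> v \<in> keys m \<Longrightarrow> f v = g v"
  shows "subst f p = subst g p"
  using subst_ideal_cong[of "{0}" p f g] assms by (auto simp: is_ideal_def)

lemma subst_id [simp]: "subst mvar p = p"
proof -
  have "eval_monom mvar = (mmonom :: _ \<Rightarrow> ('a, 'b) mpoly)" by (rule ext) simp
  then show ?thesis using lin_ext_id[of p] by (simp add: subst_def)
qed

lemma set_vars_eq_subst:
  "set_vars Z U = subst (\<lambda>v. if v \<in> Z then 0 else if v \<in> U then 1 else mvar v)"
  by (rule ext) (simp add: set_vars_def subst_def lin_ext_def eval_monom_def)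

definition polys_in :: "'v set \<Rightarrow> ('v, 'k::comm_ring_1) mpoly set" where
  "polys_in V = {p. \<forall>m\<in>keys p. keys m \<subseteq> V}"

section \<open>Polynomial rings in a prescribed set of variables\<close>

lemma poly_ring_simps [simp]:
  "carrier (poly_ring V) = polys_in V" "\<one>\<^bsub>poly_ring V\<^esub> = 1" "\<zero>\<^bsub>poly_ring V\<^esub> = 0"
  "p \<oplus>\<^bsub>poly_ring V\<^esub> q = p + q" "p \<otimes>\<^bsub>poly_ring V\<^esub> q = p * q"
  by (simp_all add: poly_ring_def polys_in_def)

lemma is_subring_polys_in: "is_subring (polys_in V)"
  unfolding is_subring_def
proof (intro conjI ballI)
  show "1 \<in> polys_in V" by (simp add: polys_in_def)
next
  fix p q :: "('a, 'b) mpoly" assume pq: "p \<in> polys_in V" "q \<in> polys_in V"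
  show "p - q \<in> polys_in V"
    using pq Poly_Mapping.keys_diff[of p q] by (auto simp: polys_in_def)
  show "p * q \<in> polys_in V"
    unfolding polys_in_def
  proof (intro CollectI ballI)
    fix m assume "m \<in> keys (p * q)"
    then obtain a b where "m = a + b" "a \<in> keys p" "b \<in> keys q"
      using keys_mult[of p q] by blast
    then show "keys m \<subseteq> V" using pq keys_add[of a b] unfolding polys_in_def by blast
  qed
qed

lemma mconst_in_polys_in: "mconst c \<in> polys_in V"
  by (auto simp: polys_in_def mconst_def)

lemma mvar_in_polys_in: "v \<in> V \<Longrightarrow> mvar v \<in> polys_in V"
  by (auto simp: polys_in_def mvar_def)

lemma mmonom_in_polys_in_iff: "mmonom m \<in> polys_in V \<longleftrightarrow> keys m \<subseteq> V"
  by (auto simp: polys_in_def mmonom_def)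

lemma polys_in_minimal:
  assumes A: "is_subring A" and "\<And>c. mconst c \<in> A" "\<And>v. v \<in> V \<Longrightarrow> mvar v \<in> A"
  shows "polys_in V \<subseteq> A"
proof
  fix p :: "('a, 'b) mpoly" assume "p \<in> polys_in V"
  then have V: "\<And>m. m \<in> keys p \<Longrightarrow> keys m \<subseteq> V" by (auto simp: polys_in_def)
  show "p \<in> A"
  proof (induction p rule: mpoly_induct)
    case (monom c m)
    then have "eval_monom mvar m \<in> A"
      unfolding eval_monom_def using V assms(3)
      by (intro is_subring_prod is_subring_power A) blast
    then show ?case using is_subring_mult[OF A assms(2)] by simp
  qed (auto intro: is_subring_zero is_subring_add A)
qed

lemma subst_in_polys_in:
  assumes "\<And>v. v \<in> W \<Longrightarrow> f v \<in> polys_in V" "p \<in> polys_in W"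
  shows "subst f p \<in> polys_in V"
proof -
  have "is_subring {p. subst f p \<in> polys_in V}"
    using is_subring_polys_in[of V] by (auto simp: is_subring_def)
  then have "polys_in W \<subseteq> {p. subst f p \<in> polys_in V}"
    using assms(1) by (intro polys_in_minimal) (auto simp: mconst_in_polys_in)
  then show ?thesis using assms(2) by blast
qed

lemma polys_in_empty: "polys_in {} = range mconst"
proof
  show "polys_in {} \<subseteq> (range mconst :: ('a, 'b) mpoly set)"
  proof (rule polys_in_minimal)
    show "is_subring (range mconst :: ('a, 'b) mpoly set)"
      by (auto simp: is_subring_def simp flip: mconst_simps(4,5) intro: image_eqI[of _ _ 1])
  qed auto
qed (auto intro: mconst_in_polys_in)

lemma polys_in_mono: "V \<subseteq> W \<Longrightarrow> polys_in V \<subseteq> polys_in W"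
  by (auto simp: polys_in_def)

text \<open>The bridge to the one-variable results on \<open>adjoin\<close>: variables are added or
  removed one at a time.\<close>

lemma polys_in_insert: "polys_in (insert v W) = adjoin (polys_in W) (mvar v)"
proof
  show "polys_in (insert v W) \<subseteq> adjoin (polys_in W) (mvar v)"
    by (rule polys_in_minimal)
      (auto intro: is_subring_adjoin is_subring_polys_in adjoin_self adjoin_base mconst_in_polys_in
        mvar_in_polys_in)
  show "adjoin (polys_in W) (mvar v) \<subseteq> polys_in (insert v W)"
    by (rule adjoin_minimal)
      (auto intro: is_subring_polys_in mvar_in_polys_in polys_in_mono[THEN subsetD, rotated])
qed

lemma mconst_eq_0_iff [simp]: "mconst c = 0 \<longleftrightarrow> c = 0"
  by (metis mconst_def lookup_single_eq lookup_zero mconst_simps(1))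

lemma noetherian_polys_in:
  assumes "finite V"
  shows "noetherian_subring (polys_in V :: ('v, 'k::field) mpoly set)"
  using assms
proof (induction V rule: finite_induct)
  case empty
  show ?case
    unfolding noetherian_subring_def
  proof (intro allI impI)
    fix J :: "('v, 'k) mpoly set" assume J: "ideal_of (polys_in {}) J"
    show "\<exists>F. finite F \<and> F \<subseteq> J \<and> (\<forall>K. ideal_of (polys_in {}) K \<and> F \<subseteq> K \<longrightarrow> J \<subseteq> K)"
    proof (cases "J \<subseteq> {0}")
      case True
      then show ?thesis by (intro exI[of _ "{}"]) (auto simp: ideal_of_def)
    next
      case False
      then obtain p where "p \<in> J" "p \<noteq> 0" by blast
      then obtain c where c: "mconst c \<in> J" "c \<noteq> 0"
        using J by (auto simp: ideal_of_def polys_in_empty)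
      have "J \<subseteq> K" if "ideal_of (polys_in {}) K" "mconst c \<in> K" for K
      proof
        fix p assume "p \<in> J"
        then obtain b where "p = mconst b" using J by (auto simp: ideal_of_def polys_in_empty)
        then have "p = mconst (b / c) * mconst c" using c by (simp flip: mconst_simps(5))
        then show "p \<in> K" using that mconst_in_polys_in unfolding ideal_of_def by blast
      qed
      then show ?thesis using c by (intro exI[of _ "{mconst c}"]) auto
    qed
  qed
next
  case (insert v V)
  then show ?case
    unfolding polys_in_insert using noetherian_subring_adjoin[OF is_subring_polys_in] by blast
qed

text \<open>Modulo \<open>M\<close> the ring \<open>K[V]\<close> is a field, so
  \<open>goldman\<close> holds with \<open>r = 1\<close>. \<open>goldman_descent\<close> removes all
  variables but \<open>v\<close>, and then \<open>mvar v\<close> is algebraic over the constants.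
  Dividing by the leading constant makes its equation monic.\<close>

lemma maximal_univariate:
  fixes M :: "('v, 'k::field) mpoly set"
  assumes "prime_set M" and V: "finite V" "\<And>u. u \<notin> V \<Longrightarrow> mvar u \<in> M"
    and max: "\<And>b. b \<notin> M \<Longrightarrow> \<exists>r. 1 - b * r \<in> M"
    and v: "v \<in> V"
  shows "\<exists>D c. D > 0 \<and> mvar v ^ D - (\<Sum>j<D. mconst (c j) * mvar v ^ j) \<in> M"
proof -
  interpret prime_set M by fact
  have unit: "c = 0" if "mconst c \<in> M" for c
  proof (rule ccontr)
    assume "c \<noteq> 0"
    then have "mconst (1 / c) * mconst c = (1 :: ('v, 'k) mpoly)" by (simp flip: mconst_simps(5))
    then show False using mult_in[OF that, of "mconst (1 / c)"] one_notin by simp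
  qed
  have "goldman (polys_in V)"
    unfolding goldman_def
  proof (rule bexI[of _ 1], intro conjI ballI impI)
    show "1 \<notin> M" by (rule one_notin)
    show "1 \<in> polys_in V" by (rule is_subring_one[OF is_subring_polys_in])
    fix b assume "b \<notin> M"
    then obtain r where r: "1 - b * r \<in> M" using max by blast
    \<comment> \<open>The inverse \<open>r\<close> may involve variables outside \<open>V\<close>;
      these lie in \<open>M\<close>, so setting them to \<open>0\<close> keeps it an inverse modulo
      \<open>M\<close>.\<close>
    let ?r = "subst (\<lambda>u. if u \<in> V then mvar u else 0) r"
    have "subst mvar r - ?r \<in> M"
      using V(2) zero_in by (intro subst_ideal_cong is_ideal) auto
    then have "(1 - b * r) + b * (r - ?r) \<in> M" using add_in[OF r mult_in] by simp
    then have "1 ^ 1 - b * ?r \<in> M" by (simp add: algebra_simps)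
    moreover have "?r \<in> polys_in V"
      by (rule subst_in_polys_in[of UNIV])
        (auto simp: polys_in_def[of UNIV] intro: mvar_in_polys_in is_subring_zero is_subring_polys_in)
    ultimately show "\<exists>r\<in>polys_in V. \<exists>k. 1 ^ k - b * r \<in> M" by blast
  qed
  moreover have "finite W \<Longrightarrow> goldman (polys_in (W \<union> {v})) \<Longrightarrow> goldman (polys_in {v})" for W
  proof (induction W rule: finite_induct)
    case (insert x W)
    then have "goldman (adjoin (polys_in (W \<union> {v})) (mvar x))"
      by (simp add: insert_commute flip: polys_in_insert)
    then show ?case using insert.IH goldman_descent[OF is_subring_polys_in] by blast
  qed simp
  moreover have "V \<union> {v} = V" using v by blast
  ultimately have "goldman (polys_in {v})" using V(1) by metis
  then have "algebraic (polys_in {}) (mvar v)"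
    unfolding polys_in_insert by (intro goldman_adjoin_algebraic is_subring_polys_in)
  then obtain p where p: "\<And>i. coeff p i \<in> range mconst" "p \<notin> polys_over M" "poly p (mvar v) \<in> M"
    by (auto simp: algebraic_def polys_over_def polys_in_empty)
  obtain D where D: "coeff p D \<notin> M" "\<And>i. i > D \<Longrightarrow> coeff p i \<in> M"
    using top_coeff[OF p(2)] by blast
  \<comment> \<open>A constant in the proper ideal \<open>M\<close> is zero, so here the degree
    modulo \<open>M\<close> is the ordinary degree.\<close>
  have "coeff p i = 0" if "i > D" for i
    using D(2)[OF that] p(1)[of i] unit by auto
  moreover have "coeff p D \<noteq> 0" using D(1) zero_in by metis
  ultimately have deg: "degree p = D" using degree_le[of D p] le_degree[of p D] by fastforce
  have "\<forall>i. \<exists>c. coeff p i = mconst c" using p(1) by blast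
  then obtain a where a: "\<And>i. coeff p i = mconst (a i)" by metis
  have "a D \<noteq> 0" using \<open>coeff p D \<noteq> 0\<close> by (auto simp: a)
  have "mconst (1 / a D) * poly p (mvar v) \<in> M" by (intro mult_in p)
  moreover have "poly p (mvar v) = mconst (a D) * mvar v ^ D + (\<Sum>j<D. mconst (a j) * mvar v ^ j)"
    unfolding poly_altdef deg a lessThan_Suc_atMost[symmetric] sum.lessThan_Suc by (rule add.commute)
  then have "mconst (1 / a D) * poly p (mvar v) =
      mconst (1 / a D * a D) * mvar v ^ D + (\<Sum>j<D. mconst (1 / a D * a j) * mvar v ^ j)"
    by (simp only: distrib_left sum_distrib_left mconst_simps mult.assoc)
  ultimately have "mvar v ^ D - (\<Sum>j<D. mconst (- (a j / a D)) * mvar v ^ j) \<in> M"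
    using \<open>a D \<noteq> 0\<close> by (simp add: sum_negf)
  moreover have "D > 0"
  proof (rule ccontr)
    assume "\<not> D > 0"
    then have "poly p (mvar v) = coeff p D" by (simp add: poly_altdef deg)
    then show False using p(3) D(1) by simp
  qed
  ultimately show ?thesis by (intro exI[of _ D] exI[of _ "\<lambda>j. - (a j / a D)"] conjI)
qed

section \<open>Chains of primes\<close>

text \<open>Each single exponent is bounded rather than the total degree: the monomials in
  \<open>W\<close> allowed by the bound then form a box and are easy to count.\<close>

definition exponents_le :: "nat \<Rightarrow> ('v, 'k::comm_ring_1) mpoly \<Rightarrow> bool" where
  "exponents_le D p \<longleftrightarrow> (\<forall>m\<in>keys p. \<forall>v. lookup m v \<le> D)"

lemma exponents_le_mult:
  assumes "exponents_le D p" "exponents_le D' q"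
  shows "exponents_le (D + D') (p * q)"
  unfolding exponents_le_def
proof (intro ballI allI)
  fix m v assume "m \<in> keys (p * q)"
  then obtain a b where "m = a + b" "a \<in> keys p" "b \<in> keys q"
    using keys_mult[of p q] by blast
  then show "lookup m v \<le> D + D'"
    using assms by (auto simp: lookup_add exponents_le_def intro: add_mono)
qed

lemma exponents_le_power: "exponents_le D p \<Longrightarrow> exponents_le (k * D) (p ^ k)"
  by (induction k) (auto simp: exponents_le_def[of _ 1] intro: exponents_le_mult)

lemma exponents_le_prod:
  "finite I \<Longrightarrow> (\<And>i. i \<in> I \<Longrightarrow> exponents_le D (f i)) \<Longrightarrow> exponents_le (card I * D) (\<Prod>i\<in>I. f i)"
  by (induction I rule: finite_induct) (auto simp: exponents_le_def[of _ 1] intro: exponents_le_mult)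

lemma exponents_le_mono: "exponents_le D p \<Longrightarrow> D \<le> D' \<Longrightarrow> exponents_le D' p"
  unfolding exponents_le_def by (meson order_trans)

lemma exponents_le_exists: "\<exists>D. exponents_le D p"
proof -
  have "finite (\<Union>m\<in>keys p. lookup m ` keys m)" by simp
  then obtain D where D: "\<forall>k \<in> (\<Union>m\<in>keys p. lookup m ` keys m). k \<le> D"
    unfolding finite_nat_set_iff_bounded_le ..
  have "lookup m v \<le> D" if "m \<in> keys p" for m v
    using D that by (cases "v \<in> keys m") (auto simp: in_keys_iff)
  then show ?thesis by (auto simp: exponents_le_def)
qed

lemma bounded_monomials:
  assumes "finite W"
  shows "finite {m. keys m \<subseteq> W \<and> (\<forall>v. lookup m v \<le> t)}"
    and "card {m. keys m \<subseteq> W \<and> (\<forall>v. lookup m v \<le> (t::nat))} \<le> Suc t ^ card W"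
proof -
  let ?I = "{m. keys m \<subseteq> W \<and> (\<forall>v. lookup m v \<le> t)}"
  let ?f = "\<lambda>m. restrict (lookup m) W"
  have inj: "inj_on ?f ?I"
  proof (rule inj_onI)
    fix m m' assume mm: "m \<in> ?I" "m' \<in> ?I" "?f m = ?f m'"
    show "m = m'"
    proof (rule poly_mapping_eqI)
      fix v
      have "v \<notin> W \<Longrightarrow> lookup m v = 0 \<and> lookup m' v = 0"
        using mm(1,2) by (auto simp: in_keys_iff subset_iff)
      then show "lookup m v = lookup m' v"
        using fun_cong[OF mm(3), of v] by (cases "v \<in> W") simp_all
    qed
  qed
  have sub: "?f ` ?I \<subseteq> PiE W (\<lambda>_. {..t})" by auto
  have fin: "finite (PiE W (\<lambda>_. {..t}))" by (rule finite_PiE[OF assms]) simp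
  show "finite ?I" by (rule finite_imageD[OF finite_subset[OF sub fin] inj])
  have "card (PiE W (\<lambda>_. {..t})) = Suc t ^ card W" using assms by (simp add: card_PiE)
  then show "card ?I \<le> Suc t ^ card W" using card_inj_on_le[OF inj sub fin] by simp
qed

text \<open>Modulo \<open>Q\<close> the products \<open>\<Prod>i<k. x i ^ e i\<close> with all exponents below \<open>N\<close> live in a space whose dimension is of order
  \<open>N ^ card W\<close>, and there are \<open>N ^ k\<close> of them.\<close>

lemma algebraic_dependence:
  fixes x :: "nat \<Rightarrow> ('v, 'k::field) mpoly"
  assumes Q: "prime_set Q" and W: "finite W" "\<And>v. v \<notin> W \<Longrightarrow> mvar v \<in> Q" and k: "card W < k"
  shows "\<exists>F c. finite F \<and> F \<noteq> {} \<and> F \<subseteq> PiE {..<k} (\<lambda>_. UNIV) \<and> (\<forall>e\<in>F. c e \<noteq> 0) \<and>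
    (\<Sum>e\<in>F. mconst (c e) * (\<Prod>i<k. x i ^ e i)) \<in> Q"
proof -
  interpret Q: prime_set Q by fact
  \<comment> \<open>Makes \<open>linear_dependence\<close> available for the coefficient
    field.\<close>
  interpret K: prime_set "{0 :: 'k}" by unfold_locales (auto simp: is_ideal_def)
  define r where "r i = subst (\<lambda>v. if v \<in> W then mvar v else 0) (x i)" for i
  have r_W: "r i \<in> polys_in W" for i
    unfolding r_def
    by (rule subst_in_polys_in[of UNIV])
      (auto simp: polys_in_def[of UNIV] intro: mvar_in_polys_in is_subring_zero is_subring_polys_in)
  have "subst mvar (x i) - r i \<in> Q" for i
    unfolding r_def using W(2) Q.zero_in by (intro subst_ideal_cong Q.is_ideal) auto
  then have x_r: "x i - r i \<in> Q" for i by simp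
  have prod_x_r: "finite S \<Longrightarrow> (\<Prod>i\<in>S. x i ^ e i) - (\<Prod>i\<in>S. r i ^ e i) \<in> Q" for S and e :: "nat \<Rightarrow> nat"
    by (induction S rule: finite_induct) (auto simp: Q.zero_in intro!: Q.diff_mult Q.diff_power x_r)
  have "\<forall>i. \<exists>D. exponents_le D (r i)" using exponents_le_exists by blast
  then obtain D' where D': "\<And>i. exponents_le (D' i) (r i)" by metis
  define D where "D = Max (insert 0 (D' ` {..<k}))"
  have D: "exponents_le D (r i)" if "i < k" for i
    using that by (intro exponents_le_mono[OF D']) (auto simp: D_def intro: Max_ge)
  \<comment> \<open>There are at most \<open>(N * (k * D + 1)) ^ card W\<close> monomials. This is
    less than \<open>N ^ (card W + 1)\<close>, hence than \<open>N ^ k\<close>, once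
    \<open>N\<close> exceeds \<open>(k * D + 1) ^ card W\<close>.\<close>
  define N where "N = Suc (Suc (k * D) ^ card W)"
  define t where "t = k * (N * D)"
  define I where "I = {m. keys m \<subseteq> W \<and> (\<forall>v. lookup m v \<le> t)}"
  define J where "J = PiE {..<k} (\<lambda>_. {..<N})"
  have J: "finite J" "card J = N ^ k" unfolding J_def by (rule finite_PiE, simp, simp) (simp add: card_PiE)
  have "card I \<le> Suc t ^ card W" unfolding I_def by (rule bounded_monomials[OF W(1)])
  also have "Suc t \<le> N * Suc (k * D)" by (simp add: t_def N_def algebra_simps)
  then have "Suc t ^ card W \<le> N ^ card W * Suc (k * D) ^ card W"
    by (metis power_mono power_mult_distrib zero_le)
  also have "\<dots> < N ^ card W * N" by (simp add: N_def)
  also have "\<dots> = N ^ Suc (card W)" by simp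
  also have "\<dots> \<le> N ^ k" using k by (intro power_increasing) (auto simp: N_def)
  finally have IJ: "card I < card J" by (simp add: J)
  define z where "z e = (\<Prod>i<k. r i ^ e i)" for e
  have z: "keys (z e) \<subseteq> I" if "e \<in> J" for e
  proof -
    have "exponents_le (N * D) (r i ^ e i)" if "i < k" for i
      using \<open>e \<in> J\<close> that
      by (intro exponents_le_mono[OF exponents_le_power[OF D]] mult_right_mono)
        (auto simp: J_def PiE_iff less_imp_le)
    then have "exponents_le t (z e)"
      using exponents_le_prod[of "{..<k}" "N * D" "\<lambda>i. r i ^ e i"] by (simp add: z_def t_def)
    moreover have "z e \<in> polys_in W"
      unfolding z_def by (intro is_subring_prod is_subring_power is_subring_polys_in r_W)
    ultimately show ?thesis by (auto simp: I_def exponents_le_def polys_in_def)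
  qed
  have "\<exists>l. (\<forall>e\<in>J. l e \<in> UNIV) \<and> (\<exists>e\<in>J. l e \<notin> {0 :: 'k}) \<and>
      (\<forall>m\<in>I. (\<Sum>e\<in>J. l e * lookup (z e) m) \<in> {0})"
  proof (rule K.linear_dependence)
    show "is_subring (UNIV :: 'k set)" by (simp add: is_subring_def)
    show "finite I" unfolding I_def by (rule bounded_monomials[OF W(1)])
  qed (use J(1) IJ in simp_all)
  then obtain l where "(\<forall>e\<in>J. l e \<in> UNIV) \<and> (\<exists>e\<in>J. l e \<notin> {0 :: 'k}) \<and>
      (\<forall>m\<in>I. (\<Sum>e\<in>J. l e * lookup (z e) m) \<in> {0})" ..
  then have l: "\<exists>e\<in>J. l e \<noteq> 0" "\<And>m. m \<in> I \<Longrightarrow> (\<Sum>e\<in>J. l e * lookup (z e) m) = 0"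
    by simp_all
  define F where "F = {e \<in> J. l e \<noteq> 0}"
  have "J \<subseteq> PiE {..<k} (\<lambda>_. UNIV)" unfolding J_def by (intro PiE_mono) simp
  then have F: "finite F" "F \<noteq> {}" "F \<subseteq> PiE {..<k} (\<lambda>_. UNIV)" "\<forall>e\<in>F. l e \<noteq> 0"
    using J(1) l(1) unfolding F_def by simp_all blast+
  have "(\<Sum>e\<in>J. mconst (l e) * z e) = 0"
  proof (rule poly_mapping_eqI)
    fix m
    show "lookup (\<Sum>e\<in>J. mconst (l e) * z e) m = lookup 0 m"
    proof (cases "m \<in> I")
      case True
      then show ?thesis using l(2) by (simp add: lookup_sum)
    next
      case False
      then have "lookup (z e) m = 0" if "e \<in> J" for e using z[OF that] by (auto simp: in_keys_iff)
      then show ?thesis by (simp add: lookup_sum)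
    qed
  qed
  moreover have "(\<Sum>e\<in>J. mconst (l e) * z e) = (\<Sum>e\<in>F. mconst (l e) * z e)"
    unfolding F_def using J by (intro sum.mono_neutral_right) auto
  ultimately have "(\<Sum>e\<in>F. mconst (l e) * (\<Prod>i<k. x i ^ e i)) =
      (\<Sum>e\<in>F. mconst (l e) * ((\<Prod>i<k. x i ^ e i) - z e))"
    by (simp add: right_diff_distrib sum_subtractf)
  also have "\<dots> \<in> Q" unfolding z_def by (intro Q.sum_in Q.mult_in prod_x_r) simp
  finally have "(\<Sum>e\<in>F. mconst (l e) * (\<Prod>i<k. x i ^ e i)) \<in> Q" .
  show ?thesis by (rule exI[of _ F], rule exI[of _ l], intro conjI F) fact
qed

text \<open>Divide by the lowest occurring power of \<open>x s\<close>, which does not lie in \<open>Q s\<close>, and pass to \<open>Q (Suc s)\<close>,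
  which contains \<open>x s\<close>: only the terms with the lowest exponent survive.\<close>

lemma chain_independence:
  fixes x :: "nat \<Rightarrow> ('v, 'k::field) mpoly"
  assumes Q: "\<And>i. i \<le> k \<Longrightarrow> prime_set (Q i)" and sub: "\<And>i. i < k \<Longrightarrow> Q i \<subseteq> Q (Suc i)"
    and x: "\<And>i. i < k \<Longrightarrow> x i \<in> Q (Suc i)" "\<And>i. i < k \<Longrightarrow> x i \<notin> Q i"
  shows "s \<le> k \<Longrightarrow> finite F \<Longrightarrow> F \<noteq> {} \<Longrightarrow> (\<And>e. e \<in> F \<Longrightarrow> c e \<noteq> 0) \<Longrightarrow>
    inj_on (\<lambda>e. restrict e {s..<k}) F \<Longrightarrow>
    (\<Sum>e\<in>F. mconst (c e) * (\<Prod>i\<in>{s..<k}. x i ^ e i)) \<notin> Q s"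
proof (induction s arbitrary: F rule: inc_induct)
  case base
  interpret prime_set "Q k" using Q by simp
  obtain e where e: "e \<in> F" using base by blast
  \<comment> \<open>For \<open>s = k\<close> nothing is left to restrict to, so injectivity leaves
    one exponent vector; the sum is a nonzero constant and cannot lie in a prime.\<close>
  have "F = {e}"
    using base(4) e by (auto simp: inj_on_def)
  then have "(\<Sum>e\<in>F. mconst (c e) * (\<Prod>i\<in>{k..<k}. x i ^ e i)) = mconst (c e)" by simp
  moreover have "mconst (c e) \<notin> Q k"
  proof
    assume "mconst (c e) \<in> Q k"
    then have "mconst (1 / c e) * mconst (c e) \<in> Q k" by (rule mult_in)
    then show False using one_notin base(3)[OF e] by (simp flip: mconst_simps(5))
  qed
  ultimately show ?case by simp
next
  case (step s)
  interpret prime_set "Q s" using Q step by simp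
  interpret S: prime_set "Q (Suc s)" using Q step by simp
  define m where "m = Min ((\<lambda>e. e s) ` F)"
  have m: "m \<le> e s" if "e \<in> F" for e using step that by (simp add: m_def)
  have "m \<in> (\<lambda>e. e s) ` F" unfolding m_def using step by (intro Min_in) auto
  define F0 where "F0 = {e \<in> F. e s = m}"
  let ?p = "\<lambda>e. \<Prod>i\<in>{Suc s..<k}. x i ^ e i"
  have F0: "finite F0" "F0 \<noteq> {}" "F0 \<subseteq> F" using \<open>m \<in> _\<close> step by (auto simp: F0_def)
  have split: "{s..<k} = insert s {Suc s..<k}" using step by auto
  \<comment> \<open>Members of \<open>F0\<close> share the exponent \<open>m\<close> at
    \<open>s\<close>, so they are still told apart by the exponents above \<open>s\<close>.\<close>
  have "inj_on (\<lambda>e. restrict e {Suc s..<k}) F0"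
  proof (rule inj_onI)
    fix e e' assume ee: "e \<in> F0" "e' \<in> F0" "restrict e {Suc s..<k} = restrict e' {Suc s..<k}"
    have "restrict e {s..<k} i = restrict e' {s..<k} i" for i
      using fun_cong[OF ee(3), of i] ee(1,2) by (cases "i = s") (auto simp: F0_def restrict_def split: if_splits)
    then have "restrict e {s..<k} = restrict e' {s..<k}" by (rule ext)
    then show "e = e'" using ee F0(3) step.prems(4) by (meson inj_onD subsetD)
  qed
  then have notin: "(\<Sum>e\<in>F0. mconst (c e) * ?p e) \<notin> Q (Suc s)"
    using step.IH[of F0] F0 step.prems(3) by blast
  show ?case
  proof
    assume "(\<Sum>e\<in>F. mconst (c e) * (\<Prod>i\<in>{s..<k}. x i ^ e i)) \<in> Q s"
    moreover have "(\<Sum>e\<in>F. mconst (c e) * (\<Prod>i\<in>{s..<k}. x i ^ e i)) =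
        x s ^ m * (\<Sum>e\<in>F. mconst (c e) * x s ^ (e s - m) * ?p e)"
      unfolding sum_distrib_left split
    proof (rule sum.cong[OF refl])
      fix e assume "e \<in> F"
      then have "x s ^ e s = x s ^ m * x s ^ (e s - m)" using m by (simp flip: power_add)
      then show "mconst (c e) * (\<Prod>i\<in>insert s {Suc s..<k}. x i ^ e i) =
          x s ^ m * (mconst (c e) * x s ^ (e s - m) * ?p e)"
        by (simp add: algebra_simps)
    qed
    ultimately have "(\<Sum>e\<in>F. mconst (c e) * x s ^ (e s - m) * ?p e) \<in> Q s"
      using x(2)[of s] step(2) power_in[of "x s" m] by (auto simp: mult_in_iff)
    then have "(\<Sum>e\<in>F. mconst (c e) * x s ^ (e s - m) * ?p e) \<in> Q (Suc s)" using sub step by blast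
    moreover have "(\<Sum>e\<in>F - F0. mconst (c e) * x s ^ (e s - m) * ?p e) \<in> Q (Suc s)"
    proof (rule S.sum_in)
      fix e assume "e \<in> F - F0"
      then have "e s - m = Suc (e s - m - 1)" using m[of e] by (auto simp: F0_def)
      then have "x s ^ (e s - m) = x s ^ (e s - m - 1) * x s" by (metis power_Suc2)
      then have "x s ^ (e s - m) \<in> Q (Suc s)" using x(1)[of s] step(2) S.mult_in by auto
      then show "mconst (c e) * x s ^ (e s - m) * ?p e \<in> Q (Suc s)"
        by (rule S.mult_right_in[OF S.mult_in])
    qed
    moreover have "(\<Sum>e\<in>F. mconst (c e) * x s ^ (e s - m) * ?p e) =
        (\<Sum>e\<in>F - F0. mconst (c e) * x s ^ (e s - m) * ?p e) + (\<Sum>e\<in>F0. mconst (c e) * ?p e)"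
      by (subst sum.subset_diff[OF F0(3) step.prems(1)]) (simp add: F0_def)
    ultimately have "(\<Sum>e\<in>F0. mconst (c e) * ?p e) \<in> Q (Suc s)"
      using S.diff_in[of "_ + _"] by (metis (no_types, lifting) add_diff_cancel_left')
    then show False using notin by blast
  qed
qed

text \<open>Elements \<open>x i\<close> of \<open>Q (Suc i)\<close> outside \<open>Q i\<close> are
  algebraically independent modulo \<open>Q 0\<close>, but more than \<open>card W\<close> elements
  are dependent there. This replaces transcendence degrees.\<close>

lemma prime_chain_bound:
  fixes Q :: "nat \<Rightarrow> ('v, 'k::field) mpoly set"
  assumes Q: "\<And>i. i \<le> k \<Longrightarrow> prime_set (Q i)" and sub: "\<And>i. i < k \<Longrightarrow> Q i \<subset> Q (Suc i)"
    and W: "finite W" "\<And>v. v \<notin> W \<Longrightarrow> mvar v \<in> Q 0"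
  shows "k \<le> card W"
proof (rule ccontr)
  assume "\<not> k \<le> card W"
  then have "card W < k" by simp
  have "\<forall>i. \<exists>p. i < k \<longrightarrow> p \<in> Q (Suc i) \<and> p \<notin> Q i" using sub by blast
  then obtain x where x: "\<And>i. i < k \<Longrightarrow> x i \<in> Q (Suc i) \<and> x i \<notin> Q i" by metis
  obtain F where "\<exists>c. finite F \<and> F \<noteq> {} \<and> F \<subseteq> PiE {..<k} (\<lambda>_. UNIV) \<and> (\<forall>e\<in>F. c e \<noteq> 0) \<and>
      (\<Sum>e\<in>F. mconst (c e) * (\<Prod>i<k. x i ^ e i)) \<in> Q 0"
    using algebraic_dependence[OF Q[OF le0] W \<open>card W < k\<close>, of x] ..
  then obtain c where "finite F \<and> F \<noteq> {} \<and> F \<subseteq> PiE {..<k} (\<lambda>_. UNIV) \<and> (\<forall>e\<in>F. c e \<noteq> 0) \<and>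
      (\<Sum>e\<in>F. mconst (c e) * (\<Prod>i<k. x i ^ e i)) \<in> Q 0" ..
  then have F: "finite F" "F \<noteq> {}" "F \<subseteq> PiE {..<k} (\<lambda>_. UNIV)" "\<forall>e\<in>F. c e \<noteq> 0"
    "(\<Sum>e\<in>F. mconst (c e) * (\<Prod>i<k. x i ^ e i)) \<in> Q 0" by simp_all
  \<comment> \<open>The exponent functions are extensional on \<open>{..<k}\<close>, so distinct
    ones differ below \<open>k\<close>.\<close>
  have "inj_on (\<lambda>e. restrict e {0..<k}) F"
    using F(3) unfolding atLeast0LessThan by (intro inj_onI) (metis PiE_restrict subsetD)
  then have "(\<Sum>e\<in>F. mconst (c e) * (\<Prod>i\<in>{0..<k}. x i ^ e i)) \<notin> Q 0"
  proof (intro chain_independence[of k Q x 0 F c])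
    show "\<And>i. i < k \<Longrightarrow> Q i \<subseteq> Q (Suc i)" using sub by blast
  qed (use Q x F(1,2,4) in auto)
  then show False using F(5) by (simp add: atLeast0LessThan)
qed

section \<open>Bases adapted to a family of monic polynomials\<close>

lemma lookup_mmonom_mult: "lookup (mmonom a * p) (a + m) = lookup p m"
proof -
  have "mmonom a * p = (\<Sum>m\<in>keys p. mconst (lookup p m) * mmonom (a + m))"
    by (subst lin_ext_id[of p, symmetric], unfold lin_ext_def)
      (simp add: sum_distrib_left algebra_simps)
  then have "lookup (mmonom a * p) (a + m) = (\<Sum>k\<in>keys p. if k = m then lookup p k else 0)"
    by (auto simp: lookup_sum mconst_mmonom lookup_single when_def simp del: mmonom_simps intro!: sum.cong)
  then show ?thesis by (simp add: in_keys_iff)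
qed

text \<open>Weighted degrees serve as the termination order. The weights are chosen later so that
  each polynomial \<open>f v\<close> is led by a pure power of \<open>v\<close>.\<close>

locale weighted =
  fixes w :: "'v \<Rightarrow> nat"
begin

definition weight :: "('v \<Rightarrow>\<^sub>0 nat) \<Rightarrow> nat" where
  "weight m = (\<Sum>v\<in>keys m. w v * lookup m v)"

lemma weight_superset: "finite A \<Longrightarrow> keys m \<subseteq> A \<Longrightarrow> weight m = (\<Sum>v\<in>A. w v * lookup m v)"
  unfolding weight_def by (rule sum.mono_neutral_left) (auto simp: in_keys_iff)

lemma weight_add: "weight (m + m') = weight m + weight m'"
  using keys_add[of m m']
  by (simp add: weight_superset[of "keys m \<union> keys m'"] lookup_add algebra_simps sum.distrib)

lemma weight_single: "weight (Poly_Mapping.single v k) = w v * k"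
  by (cases "k = 0") (simp_all add: weight_def)

definition lower :: "nat \<Rightarrow> ('v, 'k::comm_ring_1) mpoly set" where
  "lower n = {p. \<forall>m\<in>keys p. weight m < n}"

lemma lower_zero: "0 \<in> lower n"
  by (simp add: lower_def)

lemma lower_add: "p \<in> lower n \<Longrightarrow> q \<in> lower n \<Longrightarrow> p + q \<in> lower n"
  using keys_add[of p q] unfolding lower_def by blast

lemma lower_uminus: "p \<in> lower n \<Longrightarrow> - p \<in> lower n"
  by (simp add: lower_def in_keys_iff)

lemma lower_sum: "(\<And>i. i \<in> I \<Longrightarrow> f i \<in> lower n) \<Longrightarrow> (\<Sum>i\<in>I. f i) \<in> lower n"
  by (induction I rule: infinite_finite_induct) (auto simp: lower_zero lower_add)

lemma lower_mono: "n \<le> n' \<Longrightarrow> lower n \<subseteq> lower n'"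
  unfolding lower_def by fastforce

lemma lower_mult:
  assumes "p \<in> lower a" "q \<in> lower (Suc b)"
  shows "p * q \<in> lower (a + b)"
  unfolding lower_def
proof (intro CollectI ballI)
  fix m assume "m \<in> keys (p * q)"
  then obtain u v where "m = u + v" "u \<in> keys p" "v \<in> keys q" using keys_mult[of p q] by blast
  then have "weight m = weight u + weight v" "weight u < a" "weight v < Suc b"
    using assms by (auto simp: lower_def weight_add)
  then show "weight m < a + b" by simp
qed

lemma lower_mconst_mmonom: "weight m < n \<Longrightarrow> mconst c * mmonom m \<in> lower n"
  by (simp add: lower_def mconst_mmonom)

text \<open>Stronger than having top weight \<open>weight m\<close>: \<open>mmonom m\<close> is the
  only monomial of that weight and has coefficient \<open>1\<close>. Hence a family indexed by its
  leading monomials is unitriangular.\<close>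

definition leads :: "('v \<Rightarrow>\<^sub>0 nat) \<Rightarrow> ('v, 'k::comm_ring_1) mpoly \<Rightarrow> bool" where
  "leads m p \<longleftrightarrow> p - mmonom m \<in> lower (weight m)"

lemma leads_mmonom: "leads m (mmonom m)"
  by (simp add: leads_def lower_zero)

lemma leads_lower: "leads m p \<Longrightarrow> p \<in> lower (Suc (weight m))"
proof -
  assume "leads m p"
  then have "p - mmonom m \<in> lower (Suc (weight m))"
    unfolding leads_def using lower_mono[of "weight m" "Suc (weight m)"] by auto
  moreover have "mmonom m \<in> lower (Suc (weight m))"
    using lower_mconst_mmonom[of m "Suc (weight m)" 1] by simp
  ultimately show ?thesis using lower_add by fastforce
qed

lemma leads_mult:
  assumes "leads m p" "leads m' q" shows "leads (m + m') (p * q)"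
proof -
  have "(p - mmonom m) * q \<in> lower (weight m + weight m')"
    using assms leads_lower by (intro lower_mult) (auto simp: leads_def)
  moreover have "(q - mmonom m') * mmonom m \<in> lower (weight m' + weight m)"
    using assms leads_lower[OF leads_mmonom] by (intro lower_mult) (auto simp: leads_def)
  ultimately have "(p - mmonom m) * q + (q - mmonom m') * mmonom m \<in> lower (weight m + weight m')"
    by (intro lower_add) (auto simp: add.commute)
  moreover have "(p - mmonom m) * q + (q - mmonom m') * mmonom m = p * q - mmonom (m + m')"
    by (simp add: algebra_simps)
  ultimately show ?thesis by (simp add: leads_def weight_add)
qed

lemma leads_one: "leads 0 1"
  using leads_mmonom[of 0] by simp

lemma leads_prod: "finite I \<Longrightarrow> (\<And>i. i \<in> I \<Longrightarrow> leads (g i) (f i)) \<Longrightarrow> leads (\<Sum>i\<in>I. g i) (\<Prod>i\<in>I. f i)"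
  by (induction I rule: finite_induct) (auto simp: leads_one intro: leads_mult)

lemma leads_power: "leads (Poly_Mapping.single v D) p \<Longrightarrow> leads (Poly_Mapping.single v (D * q)) (p ^ q)"
proof (induction q)
  case (Suc q)
  then show ?case
    using leads_mult[of "Poly_Mapping.single v D" p "Poly_Mapping.single v (D * q)" "p ^ q"]
    by (simp flip: single_add)
qed (simp add: leads_one)

end

text \<open>Each variable gets a polynomial \<open>f v\<close>, monic of degree \<open>D v\<close>
  in \<open>v\<close>, whose other powers of \<open>v\<close> start at \<open>l v\<close>;
  \<open>l v = 1\<close> records that \<open>mvar v\<close> divides \<open>f v\<close>. The
  coefficients form two layers: constants for variables in \<open>T\<close>, polynomials in the
  variables of \<open>T\<close> for the others.\<close>

locale adapted_basis = weighted w
  for w :: "'v \<Rightarrow> nat" +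
  fixes D l :: "'v \<Rightarrow> nat" and f :: "'v \<Rightarrow> ('v, 'k::comm_ring_1) mpoly"
    and s :: "'v \<Rightarrow> nat \<Rightarrow> ('v, 'k) mpoly" and T :: "'v set"
  assumes D_pos: "D v > 0"
    and f_eq: "f v = mvar v ^ D v - (\<Sum>j\<in>{l v..<D v}. s v j * mvar v ^ j)"
    and f_leads: "leads (Poly_Mapping.single v (D v)) (f v)"
    and s_T: "v \<in> T \<Longrightarrow> s v j \<in> range mconst"
    and s_not_T: "v \<notin> T \<Longrightarrow> s v j \<in> polys_in T"
begin

text \<open>The substitute for \<open>mvar v ^ k\<close> in the \<open>f v\<close>-adic expansion.
  Multiplication by \<open>f v\<close> becomes a shift of \<open>k\<close> by
  \<open>D v\<close>.\<close>

definition pw :: "'v \<Rightarrow> nat \<Rightarrow> ('v, 'k) mpoly" where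
  "pw v k = f v ^ (k div D v) * mvar v ^ (k mod D v)"

lemma pw_zero: "pw v 0 = 1"
  by (simp add: pw_def)

lemma pw_add: "f v * pw v k = pw v (k + D v)"
  using D_pos[of v] by (simp add: pw_def mult.assoc)

text \<open>Only the remainder \<open>D v - 1\<close> causes a carry; there
  \<open>mvar v ^ D v\<close> is rewritten by \<open>f_eq\<close>. The correction terms keep the
  quotient \<open>q\<close>, and their remainders are at least \<open>l v\<close>.\<close>

lemma pw_mult_mvar:
  "mvar v * pw v k = pw v (Suc k) \<or>
   (\<exists>q. k = q * D v + (D v - 1) \<and>
     mvar v * pw v k = pw v (Suc k) + (\<Sum>j\<in>{l v..<D v}. s v j * pw v (q * D v + j)))"
proof (cases "Suc (k mod D v) = D v")
  case False
  then have "Suc k div D v = k div D v" "Suc k mod D v = Suc (k mod D v)"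
    by (simp_all add: div_Suc mod_Suc)
  then show ?thesis by (simp add: pw_def algebra_simps)
next
  case True
  define q where "q = k div D v"
  have k: "k = q * D v + (D v - 1)"
    unfolding q_def using True div_mult_mod_eq[of k "D v"] D_pos[of v] by linarith
  have "Suc k = Suc q * D v" using k D_pos[of v] by simp
  then have 1: "pw v (Suc k) = f v * f v ^ q" using D_pos[of v] by (simp add: pw_def)
  have "k mod D v = D v - 1" using True by simp
  then have "mvar v * pw v k = f v ^ q * mvar v ^ D v"
    using D_pos[of v] by (simp add: pw_def q_def power_eq_if[of "mvar v" "D v"] algebra_simps)
  also have "mvar v ^ D v = f v + (\<Sum>j\<in>{l v..<D v}. s v j * mvar v ^ j)"
    by (subst f_eq) simp
  also have "f v ^ q * \<dots> = pw v (Suc k) + (\<Sum>j\<in>{l v..<D v}. s v j * (f v ^ q * mvar v ^ j))"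
    by (simp add: 1 sum_distrib_left algebra_simps)
  also have "(\<Sum>j\<in>{l v..<D v}. s v j * (f v ^ q * mvar v ^ j)) =
      (\<Sum>j\<in>{l v..<D v}. s v j * pw v (q * D v + j))"
    using D_pos[of v] by (intro sum.cong refl) (simp add: pw_def)
  finally show ?thesis using k by blast
qed

definition basis :: "('v \<Rightarrow>\<^sub>0 nat) \<Rightarrow> ('v, 'k) mpoly" where
  "basis m = (\<Prod>v\<in>keys m. pw v (lookup m v))"

lemma basis_superset: "finite A \<Longrightarrow> keys m \<subseteq> A \<Longrightarrow> basis m = (\<Prod>v\<in>A. pw v (lookup m v))"
  unfolding basis_def by (rule prod.mono_neutral_left) (auto simp: in_keys_iff pw_zero)

lemma basis_split:
  assumes "v \<notin> keys m" shows "basis (Poly_Mapping.single v k + m) = pw v k * basis m"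
proof -
  have "keys (Poly_Mapping.single v k + m) \<subseteq> insert v (keys m)"
    using keys_add[of "Poly_Mapping.single v k" m] by (auto split: if_splits)
  then have "basis (Poly_Mapping.single v k + m) =
      (\<Prod>u\<in>insert v (keys m). pw u (lookup (Poly_Mapping.single v k + m) u))"
    by (intro basis_superset) auto
  also have "\<dots> = pw v k * (\<Prod>u\<in>keys m. pw u (lookup (Poly_Mapping.single v k + m) u))"
    using assms by (simp add: lookup_add in_keys_iff)
  also have "(\<Prod>u\<in>keys m. pw u (lookup (Poly_Mapping.single v k + m) u)) = basis m"
    unfolding basis_def using assms by (intro prod.cong refl) (auto simp: lookup_add lookup_single when_def)
  finally show ?thesis .
qed

lemma split_monom:
  fixes m :: "'v \<Rightarrow>\<^sub>0 nat"
  obtains m0 where "v \<notin> keys m0" "m = Poly_Mapping.single v (lookup m v) + m0"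
proof
  let ?m0 = "m - Poly_Mapping.single v (lookup m v)"
  show "v \<notin> keys ?m0" by (simp add: in_keys_iff lookup_minus)
  show "m = Poly_Mapping.single v (lookup m v) + ?m0"
    by (rule poly_mapping_eqI) (simp add: lookup_add lookup_minus lookup_single when_def)
qed

lemma f_mult_basis: "f v * basis m = basis (Poly_Mapping.single v (D v) + m)"
proof -
  obtain m0 where m0: "v \<notin> keys m0" "m = Poly_Mapping.single v (lookup m v) + m0"
    by (rule split_monom)
  have "Poly_Mapping.single v (D v) + m = Poly_Mapping.single v (lookup m v + D v) + m0"
    by (subst m0(2)) (simp add: single_add ac_simps)
  then show ?thesis
    using m0(1) by (subst m0(2)) (simp add: basis_split mult.assoc[symmetric] pw_add)
qed

lemma basis_leads: "leads m (basis m)"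
proof -
  have "leads (Poly_Mapping.single v k) (pw v k)" for v k
  proof -
    have "leads (Poly_Mapping.single v (D v * (k div D v)) + Poly_Mapping.single v (k mod D v)) (pw v k)"
      unfolding pw_def using leads_mmonom[of "Poly_Mapping.single v (k mod D v)"]
      by (intro leads_mult leads_power f_leads) (simp add: mmonom_single)
    then show ?thesis by (simp flip: single_add)
  qed
  then have "leads (\<Sum>v\<in>keys m. Poly_Mapping.single v (lookup m v)) (basis m)"
    unfolding basis_def by (intro leads_prod) auto
  then show ?thesis by (simp flip: single_sum_nat)
qed

text \<open>At a monomial of \<open>p\<close> of maximal weight, no other basis element involved
  contributes, by \<open>basis_leads\<close>; so the coefficient of \<open>p\<close> there would
  have to vanish.\<close>

lemma lin_ext_basis_eq_0:
  assumes "lin_ext basis p = 0" shows "p = 0"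
proof (rule ccontr)
  assume "p \<noteq> 0"
  then have "keys p \<noteq> {}" by simp
  define W where "W = Max (weight ` keys p)"
  have "W \<in> weight ` keys p" unfolding W_def using \<open>keys p \<noteq> {}\<close> by (intro Max_in) auto
  then obtain m0 where m0: "m0 \<in> keys p" "weight m0 = W" by blast
  have "lookup (basis m) m0 = (if m = m0 then 1 else 0)" if "m \<in> keys p" for m
  proof -
    have "weight m \<le> weight m0" unfolding m0 W_def using that by (intro Max_ge) auto
    then have "lookup (basis m - mmonom m) m0 = 0"
      using basis_leads[of m] unfolding leads_def lower_def
      by (metis (mono_tags, lifting) in_keys_iff leD mem_Collect_eq)
    then show ?thesis by (simp add: lookup_minus mmonom_def lookup_single when_def)
  qed
  then have "lookup (lin_ext basis p) m0 = (\<Sum>m\<in>keys p. if m = m0 then lookup p m else 0)"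
    unfolding lin_ext_def lookup_sum lookup_mconst_mult by (intro sum.cong refl) simp
  also have "\<dots> = lookup p m0" using m0(1) by simp
  finally show False using assms m0(1) by (simp add: in_keys_iff)
qed

lemma lin_ext_basis_inject: "lin_ext basis p = lin_ext basis q \<Longrightarrow> p = q"
  using lin_ext_basis_eq_0[of "p - q"] by simp

text \<open>Induction on the weight bound: \<open>mmonom m\<close> differs from
  \<open>basis m\<close> only by terms of smaller weight.\<close>

lemma lin_ext_basis_surj: "\<exists>q. p = lin_ext basis q"
proof -
  have "\<exists>q. p = lin_ext basis q" if "p \<in> lower n" for n p
    using that
  proof (induction n arbitrary: p)
    case 0
    then have "keys p = {}" by (auto simp: lower_def)
    then show ?case by (intro exI[of _ 0]) simp
  next
    case (Suc n)
    then have p: "\<And>m. m \<in> keys p \<Longrightarrow> weight m \<le> n" by (auto simp: lower_def)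
    show ?case
    proof (induction p rule: mpoly_induct)
      case zero
      then show ?case by (intro exI[of _ 0]) simp
    next
      case (add p q)
      then show ?case by (metis lin_ext_add)
    next
      case (monom c m)
      have "basis m - mmonom m \<in> lower n"
        using basis_leads[of m] lower_mono[OF p[OF monom]] by (auto simp: leads_def)
      then obtain q where "basis m - mmonom m = lin_ext basis q" using Suc.IH by blast
      then have "mmonom m = lin_ext basis (mmonom m - q)" by (simp add: algebra_simps)
      then show ?case by (metis lin_ext_mconst)
    qed
  qed
  moreover have "p \<in> lower (Suc (Max (weight ` keys p)))"
    by (auto simp: lower_def less_Suc_eq_le)
  ultimately show ?thesis by blast
qed

text \<open>The analogue of a monomial ideal in the adapted basis, a priori only a
  \<open>K\<close>-subspace. By uniqueness of expansions, membership can be tested on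
  indices.\<close>

definition basis_span :: "('v \<Rightarrow>\<^sub>0 nat) set \<Rightarrow> ('v, 'k) mpoly set" where
  "basis_span S = lin_ext basis ` {p. keys p \<subseteq> S}"

lemma basis_span_add: "a \<in> basis_span S \<Longrightarrow> b \<in> basis_span S \<Longrightarrow> a + b \<in> basis_span S"
proof -
  assume "a \<in> basis_span S" "b \<in> basis_span S"
  then obtain p q where "a = lin_ext basis p" "b = lin_ext basis q" "keys p \<subseteq> S" "keys q \<subseteq> S"
    by (auto simp: basis_span_def)
  then show ?thesis
    unfolding basis_span_def using keys_add[of p q] by (intro image_eqI[of _ _ "p + q"]) auto
qed

lemma basis_span_mconst: "a \<in> basis_span S \<Longrightarrow> mconst c * a \<in> basis_span S"
proof -
  assume "a \<in> basis_span S"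
  then obtain p where "a = lin_ext basis p" "keys p \<subseteq> S" by (auto simp: basis_span_def)
  moreover have "keys (mconst c * p) \<subseteq> keys p" by (auto simp: in_keys_iff)
  ultimately show ?thesis
    unfolding basis_span_def by (intro image_eqI[of _ _ "mconst c * p"]) auto
qed

lemma basis_span_zero: "0 \<in> basis_span S"
  unfolding basis_span_def by (rule image_eqI[of _ _ 0]) auto

lemma basis_span_sum: "(\<And>i. i \<in> I \<Longrightarrow> g i \<in> basis_span S) \<Longrightarrow> (\<Sum>i\<in>I. g i) \<in> basis_span S"
  by (induction I rule: infinite_finite_induct) (auto simp: basis_span_zero basis_span_add)

lemma basis_in_basis_span: "m \<in> S \<Longrightarrow> basis m \<in> basis_span S"
  unfolding basis_span_def by (rule image_eqI[of _ _ "mmonom m"]) (simp, simp add: mmonom_def)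

lemma basis_span_subset:
  assumes "is_ideal J" "\<And>m. m \<in> S \<Longrightarrow> basis m \<in> J" shows "basis_span S \<subseteq> J"
  unfolding basis_span_def lin_ext_def using assms by (auto intro!: is_ideal_sum is_ideal_mult)

text \<open>Reducing \<open>mvar v ^ (D v)\<close> by \<open>f v\<close> keeps the quotient of the exponent by \<open>D v\<close>; \<open>S\<close> has to be stable
  under this rewriting.\<close>

definition stable :: "('v \<Rightarrow>\<^sub>0 nat) set \<Rightarrow> bool" where
  "stable S \<longleftrightarrow> (\<forall>m\<in>S. \<forall>v. m + Poly_Mapping.single v 1 \<in> S) \<and>
    (\<forall>v q j m0. v \<notin> keys m0 \<longrightarrow> Poly_Mapping.single v (q * D v + (D v - 1)) + m0 \<in> S \<longrightarrow>
      l v \<le> j \<longrightarrow> j < D v \<longrightarrow> Poly_Mapping.single v (q * D v + j) + m0 \<in> S)"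

text \<open>The multipliers that preserve the span form a ring \<open>A\<close>. It contains the
  constants, then the variables in \<open>T\<close>, whose rewriting has constant coefficients, and
  then all other variables, whose rewriting coefficients lie in \<open>polys_in T\<close>.\<close>

lemma is_ideal_basis_span:
  assumes S: "stable S"
  shows "is_ideal (basis_span S)"
proof -
  define A where "A = {r. \<forall>a\<in>basis_span S. r * a \<in> basis_span S}"
  have A: "is_subring A"
    unfolding is_subring_def A_def
  proof (intro conjI ballI CollectI)
    fix a b c assume "a \<in> {r. \<forall>a\<in>basis_span S. r * a \<in> basis_span S}"
      "b \<in> {r. \<forall>a\<in>basis_span S. r * a \<in> basis_span S}" "c \<in> basis_span S"
    then have "a * c \<in> basis_span S" "b * c \<in> basis_span S" "a * (b * c) \<in> basis_span S"
      by auto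
    then have "a * c + mconst (-1) * (b * c) \<in> basis_span S" "a * (b * c) \<in> basis_span S"
      by (auto intro!: basis_span_add basis_span_mconst simp del: mconst_simps)
    then show "(a - b) * c \<in> basis_span S" "a * b * c \<in> basis_span S"
      by (simp_all add: algebra_simps)
  qed simp
  have mconst_A: "mconst c \<in> A" for c by (auto simp: A_def basis_span_mconst)
  have mvar_A: "mvar v \<in> A" if s: "\<And>j. s v j \<in> A" for v
  proof -
    have "mvar v * basis m \<in> basis_span S" if m: "m \<in> S" for m
    proof -
      obtain m0 where m0: "v \<notin> keys m0" "m = Poly_Mapping.single v (lookup m v) + m0"
        by (rule split_monom)
      define k where "k = lookup m v"
      have b: "basis m = pw v k * basis m0" using m0 basis_split k_def by metis
      have "Poly_Mapping.single v (Suc k) + m0 = m + Poly_Mapping.single v 1"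
        by (subst m0(2)) (simp add: k_def ac_simps flip: single_add)
      then have "Poly_Mapping.single v (Suc k) + m0 \<in> S"
        using S m unfolding stable_def by auto
      then have 1: "pw v (Suc k) * basis m0 \<in> basis_span S"
        using basis_in_basis_span basis_split[OF m0(1)] by metis
      from pw_mult_mvar[of v k] show ?thesis
      proof (elim disjE exE conjE)
        assume "mvar v * pw v k = pw v (Suc k)"
        then show ?thesis using 1 by (simp add: b flip: mult.assoc)
      next
        fix q assume q: "k = q * D v + (D v - 1)"
          "mvar v * pw v k = pw v (Suc k) + (\<Sum>j\<in>{l v..<D v}. s v j * pw v (q * D v + j))"
        have "s v j * (pw v (q * D v + j) * basis m0) \<in> basis_span S" if "j \<in> {l v..<D v}" for j
        proof -
          have "Poly_Mapping.single v (q * D v + j) + m0 \<in> S"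
            using S m m0 q(1) that unfolding stable_def k_def by (metis atLeastLessThan_iff)
          then have "pw v (q * D v + j) * basis m0 \<in> basis_span S"
            using basis_in_basis_span basis_split[OF m0(1)] by metis
          then show ?thesis using s unfolding A_def by blast
        qed
        then have "pw v (Suc k) * basis m0 +
            (\<Sum>j\<in>{l v..<D v}. s v j * (pw v (q * D v + j) * basis m0)) \<in> basis_span S"
          using 1 by (intro basis_span_add basis_span_sum)
        moreover have "mvar v * basis m = pw v (Suc k) * basis m0 +
            (\<Sum>j\<in>{l v..<D v}. s v j * (pw v (q * D v + j) * basis m0))"
          by (simp add: b q(2) distrib_right sum_distrib_right flip: mult.assoc)
        ultimately show ?thesis by simp
      qed
    qed
    then have "mconst (lookup p m) * (mvar v * basis m) \<in> basis_span S" if "keys p \<subseteq> S" "m \<in> keys p" for p m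
      using that by (intro basis_span_mconst) blast
    then have "(\<Sum>m\<in>keys p. mconst (lookup p m) * (mvar v * basis m)) \<in> basis_span S"
      if "keys p \<subseteq> S" for p using that by (intro basis_span_sum) auto
    moreover have "(\<Sum>m\<in>keys p. mconst (lookup p m) * (mvar v * basis m)) = mvar v * lin_ext basis p" for p
      by (simp add: lin_ext_def sum_distrib_left algebra_simps)
    ultimately show ?thesis by (auto simp: A_def basis_span_def)
  qed
  have "polys_in T \<subseteq> A"
    using mconst_A mvar_A s_T by (intro polys_in_minimal A) (metis imageE)+
  then have "polys_in UNIV \<subseteq> A"
    using mconst_A mvar_A s_T s_not_T by (intro polys_in_minimal A) (metis imageE subsetD)+
  moreover have "r \<in> polys_in UNIV" for r :: "('v, 'k) mpoly" by (simp add: polys_in_def)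
  ultimately show ?thesis
    using basis_span_zero basis_span_add by (auto simp: is_ideal_def A_def)
qed

text \<open>Multiplication by \<open>f v\<close> shifts every index by \<open>D v\<close>, so
  \<open>f v\<close> is a nonzerodivisor modulo the span as soon as \<open>S\<close> can be shifted
  back.\<close>

lemma basis_span_regular:
  assumes "\<And>m. Poly_Mapping.single v (D v) + m \<in> S \<Longrightarrow> m \<in> S" and "f v * r \<in> basis_span S"
  shows "r \<in> basis_span S"
proof -
  obtain p where p: "r = lin_ext basis p" using lin_ext_basis_surj by blast
  let ?a = "Poly_Mapping.single v (D v)"
  have "f v * r = (\<Sum>m\<in>keys p. mconst (lookup p m) * basis (?a + m))"
    unfolding p lin_ext_def sum_distrib_left
    by (intro sum.cong refl) (metis f_mult_basis mult.left_commute)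
  also have "\<dots> = lin_ext basis (\<Sum>m\<in>keys p. mconst (lookup p m) * mmonom (?a + m))"
    by (simp del: mmonom_simps)
  also have "(\<Sum>m\<in>keys p. mconst (lookup p m) * mmonom (?a + m)) = mmonom ?a * lin_ext mmonom p"
    unfolding lin_ext_def sum_distrib_left by (intro sum.cong refl) (simp add: algebra_simps)
  finally have "f v * r = lin_ext basis (mmonom ?a * p)" by (simp add: lin_ext_id)
  then have "keys (mmonom ?a * p) \<subseteq> S"
    using assms(2) lin_ext_basis_inject by (auto simp: basis_span_def)
  moreover have "?a + m \<in> keys (mmonom ?a * p)" if "m \<in> keys p" for m
    using that by (simp add: in_keys_iff lookup_mmonom_mult)
  ultimately have "keys p \<subseteq> S" using assms(1) by blast
  then show ?thesis unfolding p basis_span_def by blast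
qed

end

section \<open>Quotient rings\<close>

text \<open>Presents a ring with explicit carrier as the image of a type class ring, so that the
  results on \<open>is_ideal\<close> and \<open>prime_set\<close> apply to its ideals through
  preimages.\<close>

locale surj_hom = cring R for R (structure) +
  fixes h :: "'c::comm_ring_1 \<Rightarrow> 'a"
  assumes h_closed: "h a \<in> carrier R"
    and h_surj: "r \<in> carrier R \<Longrightarrow> \<exists>a. h a = r"
    and h_add: "h (a + b) = h a \<oplus> h b"
    and h_mult: "h (a * b) = h a \<otimes> h b"
    and h_one: "h 1 = \<one>"
begin

definition kernel :: "'c set" where
  "kernel = {a. h a = \<zero>}"

lemma h_zero: "h 0 = \<zero>"
  using h_add[of 0 0] h_closed[of 0] by (metis add.l_cancel_one' add_0)

lemma h_uminus: "h (- a) = \<ominus> h a"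
  using h_add[of "- a" a] h_closed by (simp add: h_zero minus_equality)

lemma h_eq_iff: "h a = h b \<longleftrightarrow> a - b \<in> kernel"
proof -
  have "h (a - b) = h a \<ominus> h b"
    using h_add[of a "- b"] by (simp add: h_uminus a_minus_def)
  then show ?thesis using h_closed by (simp add: kernel_def r_right_minus_eq)
qed

lemma vimage_ideal:
  assumes "ideal Q R"
  shows "is_ideal (h -` Q)" "kernel \<subseteq> h -` Q"
proof -
  interpret Q: ideal Q R by fact
  show "is_ideal (h -` Q)"
    unfolding is_ideal_def using h_closed
    by (auto simp: h_zero h_add h_mult intro: Q.zero_closed Q.a_closed Q.I_l_closed)
  show "kernel \<subseteq> h -` Q" by (auto simp: kernel_def intro: Q.zero_closed)
qed

lemma image_vimage: "Q \<subseteq> carrier R \<Longrightarrow> h ` (h -` Q) = Q"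
  unfolding image_vimage_eq by (metis Int_absorb2 h_surj rangeI subsetD subsetI)

lemma vimage_image:
  assumes "is_ideal J" "kernel \<subseteq> J" shows "h -` (h ` J) = J"
proof
  show "h -` (h ` J) \<subseteq> J"
  proof
    fix a assume "a \<in> h -` (h ` J)"
    then obtain b where "b \<in> J" "h a = h b" by auto
    then have "(a - b) + b \<in> J" using assms is_ideal_add by (metis h_eq_iff subsetD)
    then show "a \<in> J" by simp
  qed
qed blast

lemma image_ideal:
  assumes J: "is_ideal J"
  shows "ideal (h ` J) R"
proof (rule idealI)
  show "ring R" by (rule ring_axioms)
  show "subgroup (h ` J) (add_monoid R)"
  proof (rule add.subgroupI)
    show "h ` J \<subseteq> carrier R" using h_closed by blast
    show "h ` J \<noteq> {}" using is_ideal_zero[OF J] by blast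
    show "\<ominus> a \<in> h ` J" if "a \<in> h ` J" for a
      using that is_ideal_uminus[OF J] by (force simp flip: h_uminus)
    show "a \<oplus> b \<in> h ` J" if "a \<in> h ` J" "b \<in> h ` J" for a b
      using that is_ideal_add[OF J] by (force simp flip: h_add)
  qed
next
  fix a r assume ar: "a \<in> h ` J" "r \<in> carrier R"
  then obtain b c where "r = h b" "a = h c" "c \<in> J" using h_surj by (metis imageE)
  then show "r \<otimes> a \<in> h ` J" "a \<otimes> r \<in> h ` J"
    using is_ideal_mult[OF J] is_ideal_mult_right[OF J] by (auto simp flip: h_mult)
qed

lemma vimage_prime:
  assumes "primeideal Q R" shows "prime_set (h -` Q)"
proof -
  interpret Q: primeideal Q R by fact
  show ?thesis
  proof
    show "is_ideal (h -` Q)" by (rule vimage_ideal) (rule Q.is_ideal)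
    show "1 \<notin> h -` Q" using Q.one_imp_carrier Q.I_notcarr by (auto simp: h_one)
    show "a \<in> h -` Q \<or> b \<in> h -` Q" if "a * b \<in> h -` Q" for a b
      using that Q.I_prime[OF h_closed h_closed] by (auto simp: h_mult)
  qed
qed

lemma image_prime:
  assumes "prime_set J" "kernel \<subseteq> J" shows "primeideal (h ` J) R"
proof -
  interpret prime_set J by fact
  have vi: "h a \<in> h ` J \<longleftrightarrow> a \<in> J" for a using vimage_image[OF is_ideal assms(2)] by blast
  show ?thesis
  proof (rule primeidealI)
    show "ideal (h ` J) R" by (rule image_ideal) (rule is_ideal)
    show "cring R" by (rule is_cring)
    show "carrier R \<noteq> h ` J" using vi[of 1] one_notin h_closed by metis
    fix a b assume "a \<in> carrier R" "b \<in> carrier R" "a \<otimes> b \<in> h ` J"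
    then obtain u v where "a = h u" "b = h v" "h (u * v) \<in> h ` J" using h_surj h_mult by metis
    then show "a \<in> h ` J \<or> b \<in> h ` J" unfolding vi using prime by (metis vi)
  qed
qed

lemma genideal_image_iff: "h r \<in> Idl (h ` F) \<longleftrightarrow> r \<in> is_ideal hull (kernel \<union> F)"
proof
  let ?J = "is_ideal hull (kernel \<union> F)"
  have J: "is_ideal ?J" "kernel \<union> F \<subseteq> ?J" by (auto intro: is_ideal_hull hull_inc)
  have F: "h ` F \<subseteq> carrier R" using h_closed by blast
  {
    assume "h r \<in> Idl (h ` F)"
    moreover have "Idl (h ` F) \<subseteq> h ` ?J"
      using J by (intro genideal_minimal image_ideal) auto
    ultimately show "r \<in> ?J" using vimage_image[OF J(1)] J(2) by blast
  next
    assume "r \<in> ?J"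
    moreover have "?J \<subseteq> h -` (Idl (h ` F))"
      using vimage_ideal[OF genideal_ideal[OF F]] genideal_self[OF F]
      by (intro hull_minimal) auto
    ultimately show "h r \<in> Idl (h ` F)" by blast
  }
qed

text \<open>Since \<open>B\<close> already maps onto \<open>R\<close>, an ideal of \<open>R\<close>
  is recovered from the part of its preimage in \<open>B\<close>, and generators of that part map to
  generators.\<close>

lemma noetherian:
  assumes B: "is_subring B" "noetherian_subring B" and surj: "\<And>a. \<exists>b\<in>B. a - b \<in> kernel"
  shows "noetherian_ring R"
proof (rule noetherian_ringI)
  fix Q assume Q: "ideal Q R"
  interpret Q: ideal Q R by fact
  have restrict: "ideal_of B (B \<inter> h -` K)" if "ideal K R" for K
    using vimage_ideal(1)[OF that] is_subring_zero[OF B(1)] is_subring_add[OF B(1)] is_subring_mult[OF B(1)]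
    by (auto simp: ideal_of_def is_ideal_def)
  obtain F where F: "finite F" "F \<subseteq> B \<inter> h -` Q"
    "\<And>K. ideal_of B K \<Longrightarrow> F \<subseteq> K \<Longrightarrow> B \<inter> h -` Q \<subseteq> K"
    using B(2) restrict[OF Q] unfolding noetherian_subring_def by meson
  have hF: "h ` F \<subseteq> carrier R" using h_closed by blast
  have "B \<inter> h -` Q \<subseteq> B \<inter> h -` (Idl (h ` F))"
    using F(2) genideal_self[OF hF] by (intro F(3) restrict genideal_ideal hF) auto
  moreover have "\<exists>b\<in>B. q = h b" if "q \<in> Q" for q
    using h_surj surj h_eq_iff Q.Icarr[OF that] by metis
  ultimately have "Q \<subseteq> Idl (h ` F)" by fastforce
  moreover have "Idl (h ` F) \<subseteq> Q" using F(2) by (intro genideal_minimal Q) auto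
  ultimately show "\<exists>A\<subseteq>carrier R. finite A \<and> Q = Idl A" using F(1) hF by blast
qed

text \<open>The chain is built downwards from \<open>P\<close>, using up the sequence from its end:
  if the lowest prime contains the first \<open>i + 1\<close> elements, \<open>smaller_prime\<close>
  modulo the first \<open>i\<close> of them gives a strictly smaller prime still containing those
  \<open>i\<close>.\<close>

lemma length_regular_sequence_le:
  assumes as: "regular_sequence R as" "set as \<subseteq> P" and P: "primeideal P R"
  shows "enat (length as) \<le> prime_height R P"
proof -
  let ?n = "length as"
  have asR: "set as \<subseteq> carrier R"
    and reg: "\<And>i r. i < ?n \<Longrightarrow> r \<in> carrier R \<Longrightarrow> as ! i \<otimes> r \<in> Idl (set (take i as)) \<Longrightarrow>
      r \<in> Idl (set (take i as))"
    using as(1) by (auto simp: regular_sequence_def)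
  have "\<exists>Qs. length Qs = k \<and> (\<forall>Q\<in>set Qs. primeideal Q R) \<and> sorted_wrt (\<subset>) (Qs @ [P]) \<and>
      set (take (?n - k) as) \<subseteq> hd (Qs @ [P])" if "k \<le> ?n" for k
    using that
  proof (induction k)
    case 0
    then show ?case using as(2) by (intro exI[of _ "[]"]) auto
  next
    case (Suc k)
    then obtain Qs where Qs: "length Qs = k" "\<forall>Q\<in>set Qs. primeideal Q R"
      "sorted_wrt (\<subset>) (Qs @ [P])" "set (take (?n - k) as) \<subseteq> hd (Qs @ [P])" by auto
    define i where "i = ?n - Suc k"
    have i: "?n - k = Suc i" "i < ?n" using Suc.prems by (auto simp: i_def)
    define Q1 where "Q1 = hd (Qs @ [P])"
    have Q1: "primeideal Q1 R" using Qs(2) P by (cases Qs) (auto simp: Q1_def)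
    interpret Q1: primeideal Q1 R by fact
    have "set (take (Suc i) as) = insert (as ! i) (set (take i as))"
      using i(2) by (simp add: take_Suc_conv_app_nth)
    then have Q1_as: "as ! i \<in> Q1" "set (take i as) \<subseteq> Q1" using Qs(4) i(1) by (auto simp: Q1_def)
    have take_R: "set (take i as) \<subseteq> carrier R" using asR set_take_subset by fastforce
    define J where "J = h -` (Idl (set (take i as)))"
    have J: "is_ideal J" "kernel \<subseteq> J" unfolding J_def by (intro vimage_ideal genideal_ideal take_R)+
    obtain a where a: "h a = as ! i" using h_surj asR i(2) by (metis nth_mem subsetD)
    have "\<exists>Q. prime_set Q \<and> J \<subseteq> Q \<and> Q \<subset> h -` Q1"
    proof (rule smaller_prime)
      show "is_ideal J" "prime_set (h -` Q1)" by (rule J) (rule vimage_prime[OF Q1])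
      have "Idl (set (take i as)) \<subseteq> Q1" using Q1_as by (intro genideal_minimal Q1.is_ideal)
      then show "J \<subseteq> h -` Q1" by (auto simp: J_def)
      show "a \<in> h -` Q1" using a Q1_as by simp
      show "r \<in> J" if "a * r \<in> J" for r
        using that reg[OF i(2), of "h r"] h_closed by (simp add: J_def h_mult a)
    qed
    then obtain Q where Q: "prime_set Q" "J \<subseteq> Q" "Q \<subset> h -` Q1" by blast
    have hQ: "primeideal (h ` Q) R" using Q J by (intro image_prime) auto
    have "h -` (h ` Q) = Q" using Q J by (intro vimage_image) (auto simp: prime_set_def)
    then have sub: "h ` Q \<subset> Q1" using Q(3) by blast
    have "Q1 \<subseteq> K" if "K \<in> set (Qs @ [P])" for K
      using Qs(3) that by (cases Qs) (auto simp: Q1_def)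
    then have "sorted_wrt (\<subset>) ((h ` Q # Qs) @ [P])" using Qs(3) sub by auto
    moreover have "set (take i as) \<subseteq> h ` Q"
    proof -
      have "set (take i as) \<subseteq> Idl (set (take i as))" by (rule genideal_self[OF take_R])
      also have "\<dots> = h ` J"
        unfolding J_def using genideal_ideal[OF take_R]
        by (intro image_vimage[symmetric]) (auto simp: ideal.Icarr)
      finally show ?thesis using Q(2) by blast
    qed
    ultimately show ?case
      using Qs(1,2) hQ by (intro exI[of _ "h ` Q # Qs"]) (auto simp: i_def)
  qed
  then obtain Qs where "length Qs = ?n" "\<forall>Q\<in>set Qs. primeideal Q R" "sorted_wrt (\<subset>) (Qs @ [P])"
    by blast
  then show ?thesis unfolding prime_height_def by (intro Sup_upper CollectI exI[of _ Qs]) auto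
qed

lemma ideal_depth_le_prime_height:
  "primeideal P R \<Longrightarrow> ideal_depth R P \<le> prime_height R P"
  unfolding ideal_depth_def by (rule Sup_least) (auto intro: length_regular_sequence_le)

end

section \<open>Quotients of polynomial rings presented by substitutions\<close>

lemma cring_poly_ring: "cring (poly_ring V)"
proof (rule cringI)
  note S = is_subring_polys_in[of V]
  show "abelian_group (poly_ring V)"
    by (rule abelian_groupI)
      (auto simp: add.assoc add.commute is_subring_add[OF S] is_subring_zero[OF S]
        intro!: exI[of _ "- _"] bexI[of _ "- _"] is_subring_uminus[OF S])
  show "comm_monoid (poly_ring V)"
    by (rule comm_monoidI) (auto simp: mult.assoc mult.commute is_subring_mult[OF S] is_subring_one[OF S])
qed (auto simp: algebra_simps)

lemma ideal_poly_ring_iff: "ideal I (poly_ring V) \<longleftrightarrow> ideal_of (polys_in V) I"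
proof
  interpret cring "poly_ring V :: ('a, 'b) mpoly ring" by (rule cring_poly_ring)
  note S = is_subring_polys_in[of V]
  {
    assume "ideal I (poly_ring V)"
    then interpret ideal I "poly_ring V" .
    show "ideal_of (polys_in V) I"
      unfolding ideal_of_def
      using Icarr zero_closed a_closed I_l_closed by auto
  next
    assume I: "ideal_of (polys_in V) I"
    show "ideal I (poly_ring V)"
    proof (rule idealI)
      show "ring (poly_ring V :: ('a, 'b) mpoly ring)" by (rule ring_axioms)
      have um: "a \<in> I \<Longrightarrow> - a \<in> I" for a
      proof -
        assume "a \<in> I"
        then have "- 1 * a \<in> I"
          using I is_subring_uminus[OF S is_subring_one[OF S]] unfolding ideal_of_def by blast
        then show ?thesis by simp
      qed
      have inv: "\<ominus>\<^bsub>poly_ring V\<^esub> a = - a" if "a \<in> polys_in V" for a :: "('a, 'b) mpoly"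
        using that is_subring_uminus[OF S that] by (intro minus_equality) auto
      show "subgroup I (add_monoid (poly_ring V))"
        by (rule add.subgroupI) (use I um inv in \<open>auto simp: ideal_of_def subset_iff\<close>)
    next
      fix a p :: "('a, 'b) mpoly" assume "a \<in> I" "p \<in> carrier (poly_ring V)"
      then have "p * a \<in> I" using I by (simp add: ideal_of_def)
      then show "p \<otimes>\<^bsub>poly_ring V\<^esub> a \<in> I" "a \<otimes>\<^bsub>poly_ring V\<^esub> p \<in> I"
        by (simp_all add: mult.commute)
    qed
  }
qed

text \<open>Any substitution onto \<open>K[V]\<close> presents the quotient, each with its own
  kernel. \<open>restrict_var\<close> serves the upper bound on heights, \<open>shift_var\<close>
  the lower bound on depths.\<close>

lemma poly_quotient:
  fixes I :: "('v, 'k::comm_ring_1) mpoly set"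
  assumes I: "ideal I (poly_ring V)" and f: "\<And>v. f v \<in> polys_in V"
    and surj: "\<And>p. p \<in> polys_in V \<Longrightarrow> \<exists>q. subst f q = p"
  defines "h \<equiv> \<lambda>p. I +>\<^bsub>poly_ring V\<^esub> subst f p"
  shows "surj_hom (poly_ring V Quot I) h"
    and "surj_hom.kernel (poly_ring V Quot I) h = {p. subst f p \<in> I}"
proof -
  interpret S: cring "poly_ring V :: ('v, 'k) mpoly ring" by (rule cring_poly_ring)
  interpret I: ideal I "poly_ring V" by fact
  interpret Q: cring "poly_ring V Quot I" by (rule I.quotient_is_cring) (rule S.is_cring)
  interpret H: ring_hom_ring "poly_ring V" "poly_ring V Quot I" "(+>\<^bsub>poly_ring V\<^esub>) I"
    by (rule I.rcos_ring_hom_ring)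
  have car: "subst f p \<in> carrier (poly_ring V)" for p
    using subst_in_polys_in[of UNIV f V p] f by (simp add: polys_in_def[of UNIV])
  show sh: "surj_hom (poly_ring V Quot I) h"
  proof
    show "h p \<in> carrier (poly_ring V Quot I)" for p
      unfolding h_def using car by (rule H.hom_closed)
    show "h (p + q) = h p \<oplus>\<^bsub>poly_ring V Quot I\<^esub> h q" for p q
      unfolding h_def using H.hom_add[OF car car, of p q] by simp
    show "h (p * q) = h p \<otimes>\<^bsub>poly_ring V Quot I\<^esub> h q" for p q
      unfolding h_def using H.hom_mult[OF car car, of p q] by simp
    show "h 1 = \<one>\<^bsub>poly_ring V Quot I\<^esub>"
      unfolding h_def using H.hom_one by simp
    show "\<exists>p. h p = r" if r: "r \<in> carrier (poly_ring V Quot I)" for r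
    proof -
      obtain p where "p \<in> polys_in V" "r = I +>\<^bsub>poly_ring V\<^esub> p"
        using r by (auto simp: FactRing_def A_RCOSETS_defs a_r_coset_def)
      then show ?thesis using surj unfolding h_def by metis
    qed
  qed
  have "I +>\<^bsub>poly_ring V\<^esub> p = I \<longleftrightarrow> p \<in> I" if "p \<in> carrier (poly_ring V)" for p
    using that I.rcos_const_imp_mem S.a_rcos_zero[OF I] by blast
  moreover have "\<zero>\<^bsub>poly_ring V Quot I\<^esub> = I" by (simp add: FactRing_def)
  ultimately show "surj_hom.kernel (poly_ring V Quot I) h = {p. subst f p \<in> I}"
    unfolding surj_hom.kernel_def[OF sh] using car by (simp add: h_def)
qed

section \<open>Cohen-Macaulayness\<close>

context surj_hom
begin

lemma vimage_maximal:
  assumes "maximalideal P R" "b \<notin> h -` P" shows "\<exists>r. 1 - b * r \<in> h -` P"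
proof -
  interpret P: maximalideal P R by fact
  have I: "is_ideal (h -` P)" "kernel \<subseteq> h -` P" by (intro vimage_ideal P.is_ideal)+
  define J where "J = {p + r * b |p r. p \<in> h -` P}"
  have J: "is_ideal J" and sub: "h -` P \<subseteq> J" and "b \<in> J"
    unfolding J_def by (rule is_ideal_add_principal[OF I(1)])+
  have "P \<subseteq> h ` J"
  proof
    fix q assume "q \<in> P"
    then obtain p where "q = h p" using h_surj P.Icarr by metis
    then show "q \<in> h ` J" using \<open>q \<in> P\<close> sub by blast
  qed
  moreover have "h ` J \<noteq> P" using \<open>b \<in> J\<close> assms(2) by blast
  ultimately have "h ` J = carrier R"
    using P.I_maximal[OF image_ideal[OF J]] h_closed by blast
  moreover have "h -` (h ` J) = J" using J sub I(2) by (intro vimage_image) auto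
  ultimately have "1 \<in> J" using h_closed by blast
  then obtain p r where "1 = p + r * b" "p \<in> h -` P" unfolding J_def by blast
  then have "1 - b * r \<in> h -` P" by (metis add_diff_cancel_right' mult.commute)
  then show ?thesis by blast
qed

end

text \<open>The coefficients are the elementary symmetric polynomials in \<open>B\<close>; it
  matters that they are free of \<open>v\<close> when \<open>v\<close> is outside
  \<open>B\<close>.\<close>

lemma prod_mvar_add:
  assumes "finite B"
  shows "\<exists>s. (\<forall>j. s j \<in> polys_in B) \<and>
    (\<Prod>u\<in>B. mvar v + mvar u) = mvar v ^ card B + (\<Sum>j<card B. s j * (mvar v :: ('v, 'k::comm_ring_1) mpoly) ^ j)"
  using assms
proof (induction B rule: finite_induct)
  case empty
  show ?case by (intro exI[of _ "\<lambda>_. 0"]) (auto intro: is_subring_zero is_subring_polys_in)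
next
  case (insert u B)
  then obtain s :: "nat \<Rightarrow> ('v, 'k) mpoly" where s: "\<And>j. s j \<in> polys_in B"
    "(\<Prod>u\<in>B. mvar v + mvar u) = mvar v ^ card B + (\<Sum>j<card B. s j * mvar v ^ j)" by blast
  let ?n = "card B"
  \<comment> \<open>Coefficient \<open>j\<close> of \<open>(mvar v + mvar u)\<close> times the old
    product, for \<open>j\<close> up to \<open>?n\<close>; the old leading coefficient
    \<open>1\<close> at \<open>?n\<close> is not stored in \<open>s\<close>.\<close>
  define t where "t j = (if j = 0 then 0 else s (j - 1)) + mvar u * (if j = ?n then 1 else s j)" for j
  note sub = is_subring_polys_in[of "insert u B"]
  have "s j \<in> polys_in (insert u B)" for j using s(1) polys_in_mono[of B "insert u B"] by blast
  then have "t j \<in> polys_in (insert u B)" for j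
    unfolding t_def
    by (intro is_subring_add[OF sub] is_subring_mult[OF sub] mvar_in_polys_in)
      (auto simp: is_subring_zero[OF sub] is_subring_one[OF sub])
  moreover have "(\<Sum>j<Suc ?n. t j * mvar v ^ j) =
      (\<Sum>j<?n. s j * mvar v ^ Suc j) + (mvar u * mvar v ^ ?n + mvar u * (\<Sum>j<?n. s j * mvar v ^ j))"
  proof -
    have "(\<Sum>j<Suc ?n. t j * mvar v ^ j) =
        (\<Sum>j<Suc ?n. (if j = 0 then 0 else s (j - 1)) * mvar v ^ j) +
        mvar u * (\<Sum>j<Suc ?n. (if j = ?n then 1 else s j) * mvar v ^ j)"
      unfolding t_def by (simp only: distrib_right sum.distrib sum_distrib_left mult.assoc)
    moreover have "(\<Sum>j<Suc ?n. (if j = 0 then 0 else s (j - 1)) * mvar v ^ j) =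
        (\<Sum>j<?n. s j * mvar v ^ Suc j)"
      by (subst sum.lessThan_Suc_shift) simp
    moreover have "(\<Sum>j<Suc ?n. (if j = ?n then 1 else s j) * mvar v ^ j) =
        mvar v ^ ?n + (\<Sum>j<?n. s j * mvar v ^ j)"
      by (simp add: add.commute)
    ultimately show ?thesis by (simp add: distrib_left)
  qed
  moreover have "(\<Prod>u\<in>insert u B. mvar v + mvar u) =
      mvar v ^ Suc ?n + ((\<Sum>j<?n. s j * mvar v ^ Suc j) +
        (mvar u * mvar v ^ ?n + mvar u * (\<Sum>j<?n. s j * mvar v ^ j)))"
    unfolding prod.insert[OF insert.hyps] s(2) by (simp add: sum_distrib_left algebra_simps sum.distrib)
  ultimately have "(\<forall>j. t j \<in> polys_in (insert u B)) \<and>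
      (\<Prod>u\<in>insert u B. mvar v + mvar u) =
      mvar v ^ card (insert u B) + (\<Sum>j<card (insert u B). t j * mvar v ^ j)"
    using insert.hyps by (simp only: card_insert_disjoint) simp
  then show ?case by blast
qed

section \<open>Edge ideals and clutters with whiskers\<close>

abbreviation gen :: "'v set \<Rightarrow> ('v, 'k::comm_ring_1) mpoly" where
  "gen e \<equiv> \<Prod>v\<in>e. mvar v"

lemma gen_in_polys_in: "e \<subseteq> W \<Longrightarrow> gen e \<in> polys_in W"
  by (intro is_subring_prod is_subring_polys_in mvar_in_polys_in) auto

context
  fixes V :: "'v set" and E :: "'v set set"
  assumes E: "E \<subseteq> Pow V"
begin

interpretation cring "poly_ring V :: ('v, 'k::comm_ring_1) mpoly ring" by (rule cring_poly_ring)

lemma gens_in_poly_ring: "gen ` E \<subseteq> carrier (poly_ring V :: ('v, 'k::comm_ring_1) mpoly ring)"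
  using E by (auto intro: gen_in_polys_in)

lemma ideal_edge_ideal: "ideal (edge_ideal V E :: ('v, 'k::comm_ring_1) mpoly set) (poly_ring V)"
  unfolding edge_ideal_def by (intro genideal_ideal gens_in_poly_ring)

lemma edge_ideal_generator: "e \<in> E \<Longrightarrow> gen e \<in> (edge_ideal V E :: ('v, 'k::comm_ring_1) mpoly set)"
  unfolding edge_ideal_def using genideal_self[OF gens_in_poly_ring] by blast

lemma edge_ideal_minimal:
  fixes J :: "('v, 'k::comm_ring_1) mpoly set"
  assumes "ideal_of (polys_in V) J" "\<And>e. e \<in> E \<Longrightarrow> gen e \<in> J"
  shows "edge_ideal V E \<subseteq> J"
  unfolding edge_ideal_def using assms by (intro genideal_minimal) (auto simp: ideal_poly_ring_iff)

lemma edge_ideal_zero: "0 \<in> (edge_ideal V E :: ('v, 'k::comm_ring_1) mpoly set)"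
  using ideal_edge_ideal[unfolded ideal_poly_ring_iff ideal_of_def] by blast

end

locale whiskering =
  fixes X :: "'v set" and E :: "'v set set" and N :: "'v \<Rightarrow> 'v set"
  assumes finite_X: "finite X" and E_subset: "\<And>e. e \<in> E \<Longrightarrow> e \<subseteq> X"
    and finite_N: "\<And>v. v \<in> X \<Longrightarrow> finite (N v)" and N_new: "\<And>v. v \<in> X \<Longrightarrow> N v \<inter> X = {}"
    and N_disjoint: "\<And>u v. u \<in> X \<Longrightarrow> v \<in> X \<Longrightarrow> u \<noteq> v \<Longrightarrow> N u \<inter> N v = {}"
begin

definition leaves :: "'v set" where "leaves = (\<Union>v\<in>X. N v)"
definition V :: "'v set" where "V = X \<union> leaves"
definition whisker :: "'v \<Rightarrow> 'v set" where "whisker v = insert v (N v)"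
definition E' :: "'v set set" where "E' = E \<union> whisker ` X"

lemma finite_leaves: "finite leaves"
  using finite_X finite_N by (simp add: leaves_def)

lemma finite_V: "finite V"
  using finite_X finite_leaves by (simp add: V_def)

lemma X_leaves: "X \<inter> leaves = {}"
  using N_new by (auto simp: leaves_def)

lemma E'_subset: "e \<in> E' \<Longrightarrow> e \<subseteq> V"
  using E_subset by (auto simp: E'_def V_def whisker_def leaves_def)

lemma whisker_disjoint: "u \<in> X \<Longrightarrow> v \<in> X \<Longrightarrow> u \<noteq> v \<Longrightarrow> whisker u \<inter> whisker v = {}"
  using N_disjoint[of u v] N_new[of u] N_new[of v] by (auto simp: whisker_def)

definition root :: "'v \<Rightarrow> 'v" where "root u = (SOME v. v \<in> X \<and> u \<in> N v)"

lemma root_eq: "v \<in> X \<Longrightarrow> u \<in> N v \<Longrightarrow> root u = v"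
  unfolding root_def using N_disjoint by (intro some_equality) blast+

lemma root_in: "u \<in> leaves \<Longrightarrow> root u \<in> X"
  using root_eq by (auto simp: leaves_def)

lemma E'_Pow: "E' \<subseteq> Pow V"
  using E'_subset by blast

lemmas edge_ideal_ideal = ideal_edge_ideal[OF E'_Pow]
lemmas gen_in_edge_ideal = edge_ideal_generator[OF E'_Pow]

text \<open>Induces the retraction of the polynomial ring in all variables of the type onto
  \<open>K[V]\<close>.\<close>

definition restrict_var :: "'v \<Rightarrow> ('v, 'k::comm_ring_1) mpoly" where
  "restrict_var v = (if v \<in> V then mvar v else 0)"

lemma restrict_var_in: "restrict_var v \<in> polys_in V"
  by (simp add: restrict_var_def mvar_in_polys_in is_subring_zero is_subring_polys_in)

lemma subst_restrict_var: "p \<in> polys_in V \<Longrightarrow> subst restrict_var p = p"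
  using subst_cong[of p restrict_var mvar] by (auto simp: restrict_var_def polys_in_def subset_iff)

lemma noetherian_quotient:
  "noetherian_ring (poly_ring V Quot (edge_ideal V E' :: ('v, 'k::field) mpoly set))"
  (is "noetherian_ring ?R")
proof -
  let ?h = "\<lambda>p. edge_ideal V E' +>\<^bsub>poly_ring V\<^esub> subst restrict_var p"
  interpret surj_hom ?R ?h
    using subst_restrict_var by (intro poly_quotient edge_ideal_ideal restrict_var_in) blast
  have ker: "kernel = {p. subst restrict_var p \<in> edge_ideal V E'}"
    using subst_restrict_var by (intro poly_quotient edge_ideal_ideal restrict_var_in) blast
  show ?thesis
  proof (rule noetherian)
    show "is_subring (polys_in V)" by (rule is_subring_polys_in)
    show "noetherian_subring (polys_in V :: ('v, 'k) mpoly set)"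
      by (rule noetherian_polys_in) (rule finite_V)
    fix p :: "('v, 'k) mpoly"
    have "subst restrict_var p \<in> polys_in V"
      by (rule subst_in_polys_in[of UNIV]) (auto simp: restrict_var_in polys_in_def[of UNIV])
    moreover from this have "subst restrict_var (p - subst restrict_var p) = 0"
      by (simp add: subst_restrict_var)
    then have "p - subst restrict_var p \<in> kernel" by (simp only: ker mem_Collect_eq edge_ideal_zero[OF E'_Pow])
    ultimately show "\<exists>b\<in>polys_in V. p - b \<in> kernel" by blast
  qed
qed

lemma prime_height_le:
  assumes "primeideal P (poly_ring V Quot (edge_ideal V E' :: ('v, 'k::field) mpoly set))"
  shows "prime_height (poly_ring V Quot (edge_ideal V E' :: ('v, 'k::field) mpoly set)) P \<le> enat (card leaves)"
proof -
  let ?R = "poly_ring V Quot (edge_ideal V E' :: ('v, 'k) mpoly set)"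
  let ?h = "\<lambda>p. edge_ideal V E' +>\<^bsub>poly_ring V\<^esub> subst restrict_var p"
  interpret surj_hom ?R ?h
    using subst_restrict_var by (intro poly_quotient edge_ideal_ideal restrict_var_in) blast
  have ker: "kernel = {p. subst restrict_var p \<in> edge_ideal V E'}"
    using subst_restrict_var by (intro poly_quotient edge_ideal_ideal restrict_var_in) blast
  have "length Qs \<le> card leaves"
    if Qs: "\<forall>Q\<in>set Qs. primeideal Q ?R" "sorted_wrt (\<subset>) (Qs @ [P])" for Qs
  proof -
    have prime: "primeideal ((Qs @ [P]) ! i) ?R" if "i \<le> length Qs" for i
      using Qs(1) assms that by (cases "i = length Qs") (auto simp: nth_append)
    \<comment> \<open>With \<open>P\<close> appended, \<open>Q 0\<close> also makes sense for an
      empty list, and the last index is \<open>length Qs\<close>, the length of the chain.\<close>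
    define Q where "Q i = ?h -` ((Qs @ [P]) ! i)" for i
    have Q: "prime_set (Q i)" if "i \<le> length Qs" for i
      unfolding Q_def using prime[OF that] by (rule vimage_prime)
    have Qsub: "Q i \<subset> Q (Suc i)" if "i < length Qs" for i
    proof -
      have sub: "(Qs @ [P]) ! i \<subset> (Qs @ [P]) ! Suc i"
        using that by (intro sorted_wrt_nth_less[OF Qs(2)]) auto
      have "ideal ((Qs @ [P]) ! j) ?R" if "j \<le> length Qs" for j
        using prime[OF that] by (rule primeideal.axioms)
      then have "?h ` Q j = (Qs @ [P]) ! j" if "j \<le> length Qs" for j
        unfolding Q_def using that by (intro image_vimage) (auto intro: ideal.Icarr)
      then have "?h ` Q i \<noteq> ?h ` Q (Suc i)" using that sub by auto
      then show ?thesis using sub unfolding Q_def by blast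
    qed
    interpret Q0: prime_set "Q 0" by (rule Q) simp
    have ker_Q0: "kernel \<subseteq> Q 0"
      unfolding Q_def using prime[of 0] by (intro vimage_ideal primeideal.axioms) simp
    have "\<exists>c\<in>whisker v. mvar c \<in> Q 0" if v: "v \<in> X" for v
    proof (rule ccontr)
      assume none: "\<not> ?thesis"
      have "whisker v \<in> E'" using v by (simp add: E'_def)
      then have "subst restrict_var (gen (whisker v)) = (gen (whisker v) :: ('v, 'k) mpoly)"
        using E'_subset by (intro subst_restrict_var gen_in_polys_in)
      then have "gen (whisker v) \<in> Q 0"
        using gen_in_edge_ideal[OF \<open>whisker v \<in> E'\<close>] ker ker_Q0 by auto
      moreover have "finite B \<Longrightarrow> B \<subseteq> whisker v \<Longrightarrow> gen B \<notin> Q 0" for B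
        by (induction B rule: finite_induct) (use none in \<open>auto simp: Q0.one_notin Q0.mult_in_iff\<close>)
      moreover have "finite (whisker v)" using finite_N[OF v] by (simp add: whisker_def)
      ultimately show False by blast
    qed
    then obtain c where c: "\<And>v. v \<in> X \<Longrightarrow> c v \<in> whisker v" "\<And>v. v \<in> X \<Longrightarrow> mvar (c v) \<in> Q 0"
      by metis
    have "inj_on c X" using c(1) whisker_disjoint by (fastforce simp: inj_on_def)
    have cV: "c ` X \<subseteq> V" using c(1) by (fastforce simp: whisker_def V_def leaves_def)
    have "length Qs \<le> card (V - c ` X)"
    proof (rule prime_chain_bound[of _ Q])
      fix v assume "v \<notin> V - c ` X"
      then show "mvar v \<in> Q 0"
        using c(2) ker ker_Q0 edge_ideal_zero[OF E'_Pow] by (auto simp: restrict_var_def subset_iff)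
    qed (use Q Qsub finite_V in auto)
    also have "card (V - c ` X) = card V - card X"
      using cV finite_X \<open>inj_on c X\<close> by (simp add: card_Diff_subset card_image)
    also have "card V = card X + card leaves"
      unfolding V_def using finite_X finite_leaves X_leaves by (rule card_Un_disjoint)
    finally show ?thesis by simp
  qed
  then show ?thesis unfolding prime_height_def by (intro Sup_least) auto
qed


text \<open>The minus sign is that of the inverse: the presentation applies \<open>shift_var\<close>
  before passing to the quotient, so its kernel contains the image of the edge ideal under
  \<open>unshift_var\<close>, in particular each \<open>whisker_poly v\<close>.\<close>

definition shift_var :: "'v \<Rightarrow> ('v, 'k::comm_ring_1) mpoly" where
  "shift_var v = (if v \<in> leaves then mvar v - mvar (root v) else restrict_var v)"

definition unshift_var :: "'v \<Rightarrow> ('v, 'k::comm_ring_1) mpoly" where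
  "unshift_var v = (if v \<in> leaves then mvar v + mvar (root v) else mvar v)"

definition whisker_poly :: "'v \<Rightarrow> ('v, 'k::comm_ring_1) mpoly" where
  "whisker_poly v = mvar v * (\<Prod>u\<in>N v. mvar v + mvar u)"

lemma shift_var_in: "shift_var v \<in> polys_in V"
  unfolding shift_var_def using root_in[of v] restrict_var_in
  by (auto simp: V_def intro!: is_subring_diff is_subring_polys_in mvar_in_polys_in)

lemma shift_root: "v \<in> leaves \<Longrightarrow> shift_var (root v) = mvar (root v)"
  "v \<in> leaves \<Longrightarrow> unshift_var (root v) = mvar (root v)"
  using root_in[of v] X_leaves by (auto simp: shift_var_def unshift_var_def restrict_var_def V_def)

lemma subst_shift_unshift:
  fixes p :: "('v, 'k::comm_ring_1) mpoly"
  assumes p: "p \<in> polys_in V" shows "subst shift_var (subst unshift_var p) = p"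
proof -
  have "subst shift_var (unshift_var v) = (mvar v :: ('v, 'k) mpoly)" if "v \<in> V" for v
  proof (cases "v \<in> leaves")
    case True
    then show ?thesis
      using shift_root(1)[OF True] by (simp add: unshift_var_def) (simp add: shift_var_def)
  next
    case False
    then show ?thesis using that by (simp add: unshift_var_def shift_var_def restrict_var_def)
  qed
  then have "subst (\<lambda>v. subst shift_var (unshift_var v)) p = subst mvar p"
    using p by (intro subst_cong) (auto simp: polys_in_def subset_iff)
  then show ?thesis by (simp add: subst_subst)
qed

lemma subst_shift_whisker_poly:
  assumes v: "v \<in> X"
  shows "subst shift_var (whisker_poly v) = (gen (whisker v) :: ('v, 'k::comm_ring_1) mpoly)"
proof -
  have "v \<notin> leaves" "v \<in> V" using v X_leaves by (auto simp: V_def)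
  then have 1: "shift_var v = (mvar v :: ('v, 'k) mpoly)" by (simp add: shift_var_def restrict_var_def)
  have "(\<Prod>u\<in>N v. shift_var v + shift_var u) = (gen (N v) :: ('v, 'k) mpoly)"
  proof (rule prod.cong[OF refl])
    fix u assume "u \<in> N v"
    then have "u \<in> leaves" "root u = v" using v root_eq by (auto simp: leaves_def)
    then show "shift_var v + shift_var u = (mvar u :: ('v, 'k) mpoly)" by (simp add: 1) (simp add: shift_var_def)
  qed
  moreover have "v \<notin> N v" using v N_new by blast
  ultimately show ?thesis
    using v finite_N by (simp add: whisker_poly_def whisker_def 1)
qed

lemma subst_unshift_gen_whisker:
  assumes v: "v \<in> X"
  shows "subst unshift_var (gen (whisker v)) = (whisker_poly v :: ('v, 'k::comm_ring_1) mpoly)"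
proof -
  have 1: "unshift_var v = (mvar v :: ('v, 'k) mpoly)" using v X_leaves by (auto simp: unshift_var_def)
  have "(\<Prod>u\<in>N v. unshift_var u) = (\<Prod>u\<in>N v. mvar v + mvar u :: ('v, 'k) mpoly)"
  proof (rule prod.cong[OF refl])
    fix u assume "u \<in> N v"
    then have "u \<in> leaves" "root u = v" using v root_eq by (auto simp: leaves_def)
    then show "unshift_var u = (mvar v + mvar u :: ('v, 'k) mpoly)" by (simp add: unshift_var_def add.commute)
  qed
  moreover have "v \<notin> N v" using v N_new by blast
  ultimately show ?thesis using v finite_N by (simp add: whisker_poly_def whisker_def 1)
qed

lemma subst_shift_gen:
  assumes "e \<in> E"
  shows "subst shift_var (gen e) = (gen e :: ('v, 'k::comm_ring_1) mpoly)"
    and "subst unshift_var (gen e) = (gen e :: ('v, 'k) mpoly)"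
proof -
  have "v \<in> V \<and> v \<notin> leaves" if "v \<in> e" for v
    using that E_subset[OF assms] X_leaves by (auto simp: V_def)
  then show "subst shift_var (gen e) = (gen e :: ('v, 'k) mpoly)"
    "subst unshift_var (gen e) = (gen e :: ('v, 'k) mpoly)"
    by (simp_all add: shift_var_def unshift_var_def restrict_var_def)
qed

text \<open>\<open>unshift_var\<close> carries the generators of the edge ideal into
  \<open>J\<close>. Applying it after \<open>shift_var\<close> gives back \<open>p\<close> up to the
  variables outside \<open>V\<close>, which also lie in \<open>J\<close>.\<close>

lemma shifted_ideal_minimal:
  fixes J :: "('v, 'k::comm_ring_1) mpoly set"
  assumes J: "is_ideal J" and gens: "\<And>v. v \<in> X \<Longrightarrow> whisker_poly v \<in> J" "\<And>e. e \<in> E \<Longrightarrow> gen e \<in> J"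
    "\<And>v. v \<notin> V \<Longrightarrow> mvar v \<in> J"
  shows "{p. subst shift_var p \<in> edge_ideal V E'} \<subseteq> J"
proof
  fix p :: "('v, 'k) mpoly" assume p: "p \<in> {p. subst shift_var p \<in> edge_ideal V E'}"
  have "edge_ideal V E' \<subseteq> polys_in V \<inter> {q. subst unshift_var q \<in> J}"
  proof (rule edge_ideal_minimal[OF E'_Pow])
    show "ideal_of (polys_in V) (polys_in V \<inter> {q. subst unshift_var q \<in> J})"
      using J is_subring_zero[OF is_subring_polys_in, of V] is_subring_add[OF is_subring_polys_in, of _ V]
        is_subring_mult[OF is_subring_polys_in, of _ V]
      by (auto simp: ideal_of_def is_ideal_def)
    fix e assume e: "e \<in> E'"
    then have "gen e \<in> polys_in V" using E'_subset gen_in_polys_in by blast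
    moreover have "subst unshift_var (gen e) \<in> J"
    proof (cases "e \<in> E")
      case True
      then show ?thesis using gens(2) by (simp only: subst_shift_gen(2))
    next
      case False
      then obtain v where "v \<in> X" "e = whisker v" using e by (auto simp: E'_def)
      then show ?thesis using gens(1) by (simp only: subst_unshift_gen_whisker)
    qed
    ultimately show "gen e \<in> polys_in V \<inter> {q. subst unshift_var q \<in> J}" by blast
  qed
  then have "subst unshift_var (subst shift_var p) \<in> J" using p by blast
  moreover have "subst mvar p - subst (\<lambda>v. subst unshift_var (shift_var v)) p \<in> J"
  proof (rule subst_ideal_cong[OF J])
    fix v
    show "mvar v - subst unshift_var (shift_var v) \<in> J"
    proof (cases "v \<in> V")
      case True
      have "subst unshift_var (shift_var v) = (mvar v :: ('v, 'k) mpoly)"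
      proof (cases "v \<in> leaves")
        case leaf: True
        then have "shift_var v = (mvar v - mvar (root v) :: ('v, 'k) mpoly)"
          "unshift_var v = (mvar v + mvar (root v) :: ('v, 'k) mpoly)"
          by (simp_all add: shift_var_def unshift_var_def)
        then show ?thesis by (simp add: shift_root(2)[OF leaf])
      next
        case False
        then show ?thesis using True by (simp add: unshift_var_def shift_var_def restrict_var_def)
      qed
      then show ?thesis using is_ideal_zero[OF J] by simp
    next
      case False
      then have "shift_var v = (0 :: ('v, 'k) mpoly)"
        by (auto simp: shift_var_def restrict_var_def V_def)
      then show ?thesis using gens(3)[OF False] by simp
    qed
  qed
  then have "p - subst unshift_var (subst shift_var p) \<in> J" by (simp add: subst_subst)
  ultimately have "subst unshift_var (subst shift_var p) + (p - subst unshift_var (subst shift_var p)) \<in> J"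
    by (rule is_ideal_add[OF J])
  then show "p \<in> J" by simp
qed

text \<open>In the coordinates given by \<open>shift_var\<close> each vertex \<open>v\<close> satisfies a monic equation \<open>whisker_poly v\<close> over the
  leaves, so the quotient is free over the polynomial ring in the leaves. Monic polynomials in the single
  leaves, which exist in each maximal ideal by Zariski's lemma, therefore form a regular sequence.\<close>

lemma ideal_depth_ge:
  assumes "maximalideal P (poly_ring V Quot (edge_ideal V E' :: ('v, 'k::field) mpoly set))"
  shows "enat (card leaves) \<le> ideal_depth (poly_ring V Quot (edge_ideal V E' :: ('v, 'k::field) mpoly set)) P"
proof -
  let ?I = "edge_ideal V E' :: ('v, 'k) mpoly set"
  let ?R = "poly_ring V Quot ?I"
  define h where "h p = ?I +>\<^bsub>poly_ring V\<^esub> subst shift_var p" for p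
  interpret surj_hom ?R h
    unfolding h_def using subst_shift_unshift by (intro poly_quotient edge_ideal_ideal shift_var_in) blast
  have ker: "kernel = {p. subst shift_var p \<in> ?I}"
    unfolding h_def using subst_shift_unshift by (intro poly_quotient edge_ideal_ideal shift_var_in) blast
  interpret P: maximalideal P ?R by fact
  have Pprime: "primeideal P ?R" by (rule maximalideal_prime) fact
  define M where "M = h -` P"
  interpret M: prime_set M unfolding M_def by (rule vimage_prime[OF Pprime])
  have ker_M: "kernel \<subseteq> M" unfolding M_def by (intro vimage_ideal P.is_ideal)
  have mvar_ker: "mvar v \<in> kernel" if "v \<notin> V" for v
  proof -
    have "shift_var v = (0 :: ('v, 'k) mpoly)"
      using that by (auto simp: shift_var_def restrict_var_def V_def)
    then show ?thesis by (simp add: ker edge_ideal_zero[OF E'_Pow])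
  qed
  have whisker_ker: "whisker_poly v \<in> kernel" if "v \<in> X" for v
  proof -
    have "whisker v \<in> E'" using that by (simp add: E'_def)
    then show ?thesis
      by (simp only: ker mem_Collect_eq subst_shift_whisker_poly[OF that] gen_in_edge_ideal)
  qed
  have gen_ker: "gen e \<in> kernel" if "e \<in> E" for e
  proof -
    have "e \<in> E'" using that by (simp add: E'_def)
    then show ?thesis by (simp only: ker mem_Collect_eq subst_shift_gen(1)[OF that] gen_in_edge_ideal)
  qed
  have univ: "\<forall>v\<in>leaves. \<exists>D c. D > 0 \<and> mvar v ^ D - (\<Sum>j<D. mconst (c j) * mvar v ^ j) \<in> M"
  proof
    fix v assume "v \<in> leaves"
    show "\<exists>D c. D > 0 \<and> mvar v ^ D - (\<Sum>j<D. mconst (c j) * mvar v ^ j) \<in> M"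
    proof (rule maximal_univariate)
      show "prime_set M" by (rule M.prime_set_axioms)
      show "mvar u \<in> M" if "u \<notin> V" for u using mvar_ker[OF that] ker_M by blast
      show "\<exists>r. 1 - b * r \<in> M" if "b \<notin> M" for b
        using vimage_maximal[OF assms] that unfolding M_def by blast
      show "v \<in> V" using \<open>v \<in> leaves\<close> by (simp add: V_def)
    qed (rule finite_V)
  qed
  obtain Dl where Dl: "\<forall>v\<in>leaves. \<exists>c. Dl v > 0 \<and>
      mvar v ^ Dl v - (\<Sum>j<Dl v. mconst (c j) * mvar v ^ j) \<in> M"
    using bchoice[OF univ] ..
  obtain c where c: "\<forall>v\<in>leaves. Dl v > 0 \<and>
      mvar v ^ Dl v - (\<Sum>j<Dl v. mconst (c v j) * mvar v ^ j) \<in> M"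
    using bchoice[OF Dl] ..
  have expand: "\<forall>v\<in>X. \<exists>s. (\<forall>j. s j \<in> polys_in (N v)) \<and> (\<Prod>u\<in>N v. mvar v + mvar u) =
      mvar v ^ card (N v) + (\<Sum>j<card (N v). s j * (mvar v :: ('v, 'k) mpoly) ^ j)"
    by (intro ballI prod_mvar_add finite_N)
  obtain t where "\<forall>v\<in>X. (\<forall>j. t v j \<in> polys_in (N v)) \<and> (\<Prod>u\<in>N v. mvar v + mvar u) =
      mvar v ^ card (N v) + (\<Sum>j<card (N v). t v j * (mvar v :: ('v, 'k) mpoly) ^ j)"
    using bchoice[OF expand] ..
  then have t: "\<And>v j. v \<in> X \<Longrightarrow> t v j \<in> polys_in (N v)"
    "\<And>v. v \<in> X \<Longrightarrow> (\<Prod>u\<in>N v. mvar v + mvar u) =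
      mvar v ^ card (N v) + (\<Sum>j<card (N v). t v j * (mvar v :: ('v, 'k) mpoly) ^ j)"
    by simp_all
  \<comment> \<open>Vertices of \<open>X\<close> outweigh leaves, so that
    \<open>mvar v + mvar u\<close> is led by \<open>mvar v\<close>.\<close>
  define w where "w v = (if v \<in> X then 2 else 1 :: nat)" for v
  define D where "D v = (if v \<in> X then Suc (card (N v)) else if v \<in> leaves then Dl v else 1)" for v
  \<comment> \<open>\<open>whisker_poly v\<close> is divisible by \<open>mvar v\<close>, so its
    lower terms start at exponent \<open>1\<close>; the equation of a leaf may have a constant term.
    Outside \<open>V\<close> the range from \<open>l v\<close> to \<open>D v\<close> is
    empty.\<close>
  define l where "l v = (if v \<in> leaves then 0 else 1 :: nat)" for v
  define f where "f v = (if v \<in> X then whisker_poly v else if v \<in> leaves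
    then mvar v ^ Dl v - (\<Sum>j<Dl v. mconst (c v j) * mvar v ^ j) else mvar v)" for v
  \<comment> \<open>The extra factor \<open>mvar v\<close> of \<open>whisker_poly v\<close> moves
    the index by one, and the sign is due to the subtraction in \<open>f_eq\<close>.\<close>
  define s where "s v j = (if v \<in> X then - t v (j - 1) else if v \<in> leaves then mconst (c v j) else mconst 0)" for v j
  interpret weighted w .
  interpret adapted_basis w D l f s "- X"
  proof
    fix v
    show "D v > 0" using c by (simp add: D_def)
    show "f v = mvar v ^ D v - (\<Sum>j\<in>{l v..<D v}. s v j * mvar v ^ j)"
    proof (cases "v \<in> X")
      case True
      then have "v \<notin> leaves" using X_leaves by blast
      then have "(\<Sum>j\<in>{l v..<D v}. s v j * mvar v ^ j) = (\<Sum>j\<in>{Suc 0..<Suc (card (N v))}. s v j * mvar v ^ j)"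
        using True by (simp add: l_def D_def)
      also have "\<dots> = (\<Sum>j<card (N v). s v (Suc j) * mvar v ^ Suc j)"
        unfolding sum.shift_bounds_Suc_ivl atLeast0LessThan ..
      also have "\<dots> = - (mvar v * (\<Sum>j<card (N v). t v j * mvar v ^ j))"
        using True by (simp add: s_def sum_distrib_left sum_negf algebra_simps)
      finally show ?thesis
        using True t(2)[OF True] by (simp add: f_def whisker_poly_def D_def algebra_simps)
    next
      case False
      then show ?thesis by (auto simp: f_def D_def l_def s_def atLeast0LessThan)
    qed
    show "leads (Poly_Mapping.single v (D v)) (f v)"
    proof (cases "v \<in> X")
      case True
      have "leads (Poly_Mapping.single v 1) (mvar v + mvar u)" if "u \<in> N v" for u
      proof -
        have "u \<notin> X" using that True N_new by blast
        then have "mconst 1 * mmonom (Poly_Mapping.single u 1) \<in> lower (weight (Poly_Mapping.single v 1))"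
          using True by (intro lower_mconst_mmonom) (simp add: weight_single w_def)
        then show ?thesis by (simp add: leads_def mvar_eq_mmonom)
      qed
      then have "leads (\<Sum>u\<in>N v. Poly_Mapping.single v 1) (\<Prod>u\<in>N v. mvar v + mvar u)"
        using finite_N[OF True] by (intro leads_prod)
      moreover have "leads (Poly_Mapping.single v 1) (mvar v)"
        using leads_mmonom[of "Poly_Mapping.single v 1"] by (simp add: mvar_eq_mmonom)
      ultimately have "leads (Poly_Mapping.single v 1 + (\<Sum>u\<in>N v. Poly_Mapping.single v 1)) (f v)"
        using True by (auto simp: f_def whisker_poly_def intro: leads_mult)
      moreover have "(\<Sum>u\<in>B. Poly_Mapping.single v (1::nat)) = Poly_Mapping.single v (card B)" for B :: "'v set"
        by (induction B rule: infinite_finite_induct) (auto simp flip: single_add)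
      ultimately show ?thesis using True by (simp add: D_def flip: single_add)
    next
      case False
      have "mconst (c v j) * mvar v ^ j \<in> lower (weight (Poly_Mapping.single v n))" if "j < n" for j n
        using that False lower_mconst_mmonom[of "Poly_Mapping.single v j" "weight (Poly_Mapping.single v n)" "c v j"]
        by (simp add: weight_single w_def mmonom_single)
      then have "- (\<Sum>j<n. mconst (c v j) * mvar v ^ j) \<in> lower (weight (Poly_Mapping.single v n))" for n
        by (intro lower_uminus lower_sum) auto
      then show ?thesis
        using False leads_mmonom[of "Poly_Mapping.single v 1"]
        by (auto simp: f_def D_def leads_def mmonom_single)
    qed
    show "s v j \<in> range mconst" if "v \<in> - X" for j
      using that by (auto simp: s_def)
    show "s v j \<in> polys_in (- X)" if "v \<notin> - X" for j
    proof -
      have "N v \<subseteq> - X" using that N_new by auto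
      then have "t v (j - 1) \<in> polys_in (- X)" using t(1) that polys_in_mono by blast
      then show ?thesis using that by (simp add: s_def is_subring_uminus is_subring_polys_in)
    qed
  qed
  obtain ys where ys: "set ys = leaves" "distinct ys"
    using finite_distinct_list[OF finite_leaves] by blast
  \<comment> \<open>The three alternatives mirror the generators of the kernel together with the
    first \<open>i\<close> leaf polynomials: variables outside \<open>V\<close>, edges of
    \<open>E\<close>, and the polynomials \<open>f v\<close> of vertices and of the leaves already
    used.\<close>
  define bad where "bad i = {m. \<not> keys m \<subseteq> V \<or> (\<exists>e\<in>E. e \<subseteq> keys m) \<or>
    (\<exists>v\<in>X \<union> set (take i ys). D v \<le> lookup m v)}" for i
  have stable_bad: "stable (bad i)" for i
    unfolding stable_def
  proof (intro conjI ballI allI impI)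
    fix m v assume m: "m \<in> bad i"
    have "lookup m u \<le> lookup (m + Poly_Mapping.single v 1) u" for u by (simp add: lookup_add)
    moreover have "keys m \<subseteq> keys (m + Poly_Mapping.single v 1)"
      by (auto simp: in_keys_iff lookup_add)
    ultimately show "m + Poly_Mapping.single v 1 \<in> bad i"
      using m unfolding bad_def mem_Collect_eq by (meson order_trans)
  next
    fix v q j m0
    let ?m = "Poly_Mapping.single v (q * D v + (D v - 1)) + m0"
    let ?m' = "Poly_Mapping.single v (q * D v + j) + m0"
    assume v: "v \<notin> keys m0" and m: "?m \<in> bad i" and j: "l v \<le> j" "j < D v"
    have other: "lookup ?m' u = lookup ?m u" if "u \<noteq> v" for u
      using that by (simp add: lookup_add lookup_single)
    have self: "lookup ?m v = q * D v + (D v - 1)" "lookup ?m' v = q * D v + j"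
      using v by (simp_all add: lookup_add in_keys_iff)
    \<comment> \<open>Rewriting preserves the quotient \<open>q\<close> of the exponent by
      \<open>D v\<close>, and reaching \<open>D v\<close> means exactly that \<open>q\<close> is
      positive.\<close>
    have ge: "D u \<le> lookup ?m' u" if "D u \<le> lookup ?m u" for u
    proof (cases "u = v")
      case True
      then have "q \<noteq> 0" using that self(1) D_pos[of v] by (cases q) auto
      then show ?thesis using True self(2) by (cases q) auto
    qed (use that other in simp)
    \<comment> \<open>Only leaves can disappear from the support, because \<open>l\<close> is
      \<open>1\<close> elsewhere; neither edges of \<open>E\<close> nor variables outside
      \<open>V\<close> involve leaves.\<close>
    have key: "u \<in> keys ?m'" if "u \<in> keys ?m" "u \<notin> leaves" for u
      using that other[of u] self j(1) by (cases "u = v") (auto simp: in_keys_iff l_def)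
    consider u where "u \<in> keys ?m" "u \<notin> V" | e where "e \<in> E" "e \<subseteq> keys ?m"
      | u where "u \<in> X \<union> set (take i ys)" "D u \<le> lookup ?m u"
      using m unfolding bad_def by blast
    then show "?m' \<in> bad i"
    proof cases
      case (1 u)
      then have "u \<in> keys ?m'" using key[of u] by (auto simp: V_def)
      then show ?thesis using 1(2) unfolding bad_def by blast
    next
      case (2 e)
      have "e \<subseteq> keys ?m'"
      proof
        fix u assume "u \<in> e"
        then have "u \<notin> leaves" using E_subset[OF 2(1)] X_leaves by blast
        then show "u \<in> keys ?m'" using key[of u] 2(2) \<open>u \<in> e\<close> by blast
      qed
      then show ?thesis using 2(1) unfolding bad_def by blast
    next
      case (3 u)
      then show ?thesis using ge[OF 3(2)] unfolding bad_def by blast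
    qed
  qed
  have fy: "f v \<in> M" if "v \<in> leaves" for v
    using c that X_leaves by (auto simp: f_def)
  have basis_single: "basis (Poly_Mapping.single v (D v)) = f v" for v
    using f_mult_basis[of v 0] by (simp add: basis_def)
  have f_X: "f v = whisker_poly v" if "v \<in> X" for v using that by (simp add: f_def)
  \<comment> \<open>For an empty whisker \<open>D v = 1\<close>, so \<open>pw v 1\<close> is
    \<open>f v\<close>, which then happens to be \<open>mvar v\<close>.\<close>
  have pw_one: "pw v 1 = mvar v" if "v \<in> X" for v
  proof (cases "N v = {}")
    case True
    then show ?thesis using that by (simp add: pw_def D_def f_def whisker_poly_def)
  next
    case False
    then have "D v > 1" using that finite_N[OF that] by (simp add: D_def card_gt_0_iff)
    then show ?thesis by (simp add: pw_def)
  qed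
  have dvd_pw: "mvar v dvd pw v k" if "v \<in> X" "k > 0" for v k
  proof (cases "k < D v")
    case True
    then show ?thesis using that by (simp add: pw_def dvd_power)
  next
    case False
    have "f v dvd pw v k"
      unfolding pw_def using False D_pos[of v] by (intro dvd_mult2 dvd_power) (simp add: div_greater_zero_iff)
    moreover have "mvar v dvd f v" using that by (simp add: f_X whisker_poly_def)
    ultimately show ?thesis by (rule dvd_trans[rotated])
  qed
  \<comment> \<open>Every bad basis element is a multiple of a generator; conversely each generator
    is itself a bad basis element, and the span is an ideal.\<close>
  have span_eq: "basis_span (bad i) = is_ideal hull (kernel \<union> f ` set (take i ys))" for i
  proof
    let ?J = "is_ideal hull (kernel \<union> f ` set (take i ys))"
    have J: "is_ideal ?J" by (rule is_ideal_hull)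
    have gens: "kernel \<subseteq> ?J" "f ` set (take i ys) \<subseteq> ?J" by (auto intro: hull_inc)
    have dvdJ: "b \<in> ?J" if "a \<in> ?J" "a dvd b" for a b
      using that is_ideal_mult_right[OF J] by (auto elim: dvdE)
    show "basis_span (bad i) \<subseteq> ?J"
    proof (rule basis_span_subset[OF J])
      fix m assume "m \<in> bad i"
      have D_dvd: "f v dvd basis m" if "D v \<le> lookup m v" for v
      proof -
        have "m = Poly_Mapping.single v (D v) + (m - Poly_Mapping.single v (D v))"
          using that by (intro poly_mapping_eqI) (auto simp: lookup_add lookup_minus lookup_single when_def)
        then show ?thesis by (metis f_mult_basis dvd_triv_left)
      qed
      consider v where "v \<in> keys m" "v \<notin> V" | e where "e \<in> E" "e \<subseteq> keys m"
        | v where "v \<in> X" "D v \<le> lookup m v" | v where "v \<in> set (take i ys)" "D v \<le> lookup m v"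
        using \<open>m \<in> bad i\<close> unfolding bad_def by blast
      then show "basis m \<in> ?J"
      proof cases
        case (1 v)
        then have f_v: "f v = mvar v" "D v = 1" by (auto simp: f_def D_def V_def)
        have "f v \<in> ?J" unfolding f_v using mvar_ker[OF 1(2)] gens(1) by blast
        moreover have "f v dvd basis m" using 1(1) by (intro D_dvd) (simp add: in_keys_iff f_v)
        ultimately show ?thesis by (rule dvdJ)
      next
        case (2 e)
        have "gen e dvd (\<Prod>v\<in>e. pw v (lookup m v))"
        proof (rule prod_dvd_prod)
          fix v assume "v \<in> e"
          then have "v \<in> X" "v \<in> keys m" using E_subset[OF 2(1)] 2(2) by blast+
          then show "mvar v dvd pw v (lookup m v)" by (intro dvd_pw) (simp_all add: in_keys_iff)
        qed
        also have "\<dots> dvd basis m"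
          unfolding basis_def by (rule prod_dvd_prod_subset[OF finite_keys 2(2)])
        finally have "gen e dvd basis m" .
        moreover have "gen e \<in> ?J" using gen_ker[OF 2(1)] gens(1) by blast
        ultimately show ?thesis by (rule dvdJ[rotated])
      next
        case (3 v)
        have "f v \<in> ?J" unfolding f_X[OF 3(1)] using whisker_ker[OF 3(1)] gens(1) by blast
        then show ?thesis using D_dvd[OF 3(2)] by (rule dvdJ)
      next
        case (4 v)
        have "f v \<in> ?J" using gens(2) 4(1) by blast
        then show ?thesis using D_dvd[OF 4(2)] by (rule dvdJ)
      qed
    qed
    have span: "is_ideal (basis_span (bad i))" by (rule is_ideal_basis_span[OF stable_bad])
    have f_span: "f v \<in> basis_span (bad i)" if "v \<in> X \<union> set (take i ys)" for v
    proof -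
      have "D v \<le> lookup (Poly_Mapping.single v (D v)) v" by simp
      then have "Poly_Mapping.single v (D v) \<in> bad i" using that unfolding bad_def by blast
      then have "basis (Poly_Mapping.single v (D v)) \<in> basis_span (bad i)"
        by (rule basis_in_basis_span)
      then show ?thesis by (simp only: basis_single)
    qed
    have "kernel \<subseteq> basis_span (bad i)"
      unfolding ker
    proof (rule shifted_ideal_minimal[OF span])
      show "whisker_poly v \<in> basis_span (bad i)" if "v \<in> X" for v
        using f_span[of v] that by (simp add: f_X)
      show "gen e \<in> basis_span (bad i)" if "e \<in> E" for e
      proof -
        have e: "finite e" "e \<subseteq> X" using E_subset[OF that] finite_X finite_subset by auto
        define m where "m = (\<Sum>v\<in>e. Poly_Mapping.single v (1::nat))"
        have lookup_m: "lookup m v = (if v \<in> e then 1 else 0)" for v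
          unfolding m_def using e(1) by (simp add: lookup_sum lookup_single when_def)
        then have "keys m = e" by (auto simp: in_keys_iff split: if_splits)
        then have "basis m = (\<Prod>v\<in>e. pw v 1)" by (simp add: basis_def lookup_m)
        also have "\<dots> = gen e" using e pw_one by (intro prod.cong) auto
        finally have "basis m = gen e" .
        moreover have "m \<in> bad i" using that \<open>keys m = e\<close> unfolding bad_def by blast
        ultimately show ?thesis using basis_in_basis_span by metis
      qed
      show "mvar v \<in> basis_span (bad i)" if "v \<notin> V" for v
      proof -
        have f_v: "f v = mvar v" "D v = 1" using that by (auto simp: f_def D_def V_def)
        have "v \<in> keys (Poly_Mapping.single v (D v))" by (simp add: f_v)
        then have "Poly_Mapping.single v (D v) \<in> bad i" using that unfolding bad_def by blast
        then have "basis (Poly_Mapping.single v (D v)) \<in> basis_span (bad i)"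
          by (rule basis_in_basis_span)
        then show ?thesis unfolding basis_single f_v(1) .
      qed
    qed
    then show "?J \<subseteq> basis_span (bad i)" using span f_span by (intro hull_minimal) auto
  qed
  define as where "as = map (\<lambda>v. h (f v)) ys"
  have take_as: "set (take i as) = h ` f ` set (take i ys)" for i
    by (simp add: as_def take_map image_image)
  have asP: "set as \<subseteq> P" using fy ys by (auto simp: as_def M_def)
  have "regular_sequence ?R as"
    unfolding regular_sequence_def
  proof (intro conjI allI impI ballI)
    show "set as \<subseteq> carrier ?R" using h_closed by (auto simp: as_def)
    have "Idl\<^bsub>?R\<^esub> (set as) \<subseteq> P" using asP by (intro genideal_minimal P.is_ideal)
    then show "Idl\<^bsub>?R\<^esub> (set as) \<noteq> carrier ?R"
      using P.I_notcarr P.a_subset by blast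
  next
    fix i r
    assume i: "i < length as" and r: "r \<in> carrier ?R"
      and mult: "as ! i \<otimes>\<^bsub>?R\<^esub> r \<in> Idl\<^bsub>?R\<^esub> (set (take i as))"
    obtain p where p: "r = h p" using h_surj[OF r] by blast
    have i': "i < length ys" using i by (simp add: as_def)
    let ?y = "ys ! i"
    have y: "?y \<in> leaves" using i' ys(1) nth_mem by blast
    have y_new: "?y \<notin> set (take i ys)"
      using i' ys(2) by (auto simp: in_set_conv_nth nth_eq_iff_index_eq)
    have "as ! i \<otimes>\<^bsub>?R\<^esub> r = h (f ?y * p)" using i' by (simp add: as_def p h_mult)
    then have "h (f ?y * p) \<in> Idl\<^bsub>?R\<^esub> (h ` f ` set (take i ys))"
      using mult by (simp only: take_as)
    then have "f ?y * p \<in> basis_span (bad i)" unfolding genideal_image_iff span_eq .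
    \<comment> \<open>The new leaf \<open>?y\<close> lies in \<open>V\<close>, in no edge of
      \<open>E\<close>, and not among the earlier leaves, so its exponent has no influence on
      badness at stage \<open>i\<close>.\<close>
    moreover have "m \<in> bad i" if m: "Poly_Mapping.single ?y (D ?y) + m \<in> bad i" for m
    proof -
      let ?m = "Poly_Mapping.single ?y (D ?y) + m"
      have other: "lookup ?m u = lookup m u" if "u \<noteq> ?y" for u
        using that by (simp add: lookup_add lookup_single)
      then have key: "u \<in> keys m" if "u \<in> keys ?m" "u \<noteq> ?y" for u
        using that by (simp add: in_keys_iff)
      have yX: "?y \<notin> X" "?y \<in> V" using y X_leaves by (auto simp: V_def)
      consider v where "v \<in> keys ?m" "v \<notin> V" | e where "e \<in> E" "e \<subseteq> keys ?m"
        | v where "v \<in> X \<union> set (take i ys)" "D v \<le> lookup ?m v"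
        using m unfolding bad_def by blast
      then show ?thesis
      proof cases
        case (1 v)
        then show ?thesis using key[of v] yX unfolding bad_def by blast
      next
        case (2 e)
        have "e \<subseteq> keys m"
        proof
          fix u assume "u \<in> e"
          then have "u \<noteq> ?y" using E_subset[OF 2(1)] yX(1) by blast
          then show "u \<in> keys m" using key[of u] 2(2) \<open>u \<in> e\<close> by blast
        qed
        then show ?thesis using 2 unfolding bad_def by blast
      next
        case (3 v)
        then have "v \<noteq> ?y" using yX y_new by blast
        then show ?thesis using 3 other[of v] unfolding bad_def by auto
      qed
    qed
    ultimately have "p \<in> basis_span (bad i)" by (rule basis_span_regular[rotated])
    then show "r \<in> Idl\<^bsub>?R\<^esub> (set (take i as))"
      unfolding take_as p genideal_image_iff span_eq .
  qed
  moreover have "length as = card leaves" using ys distinct_card by (fastforce simp: as_def)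
  ultimately show ?thesis
    unfolding ideal_depth_def using asP by (intro Sup_upper CollectI exI[of _ as]) auto
qed

theorem cohen_macaulay_whiskering:
  "cohen_macaulay_ring (poly_ring V Quot (edge_ideal V E' :: ('v, 'k::field) mpoly set))"
  (is "cohen_macaulay_ring ?R")
proof -
  let ?h = "\<lambda>p. edge_ideal V E' +>\<^bsub>poly_ring V\<^esub> subst restrict_var p"
  interpret surj_hom ?R ?h
    using subst_restrict_var by (intro poly_quotient edge_ideal_ideal restrict_var_in) blast
  show ?thesis
    unfolding cohen_macaulay_ring_def
  proof (intro conjI allI impI)
    show "cring ?R" by (rule is_cring)
    show "noetherian_ring ?R" by (rule noetherian_quotient)
    fix P assume P: "maximalideal P ?R"
    then have "primeideal P ?R" by (rule maximalideal_prime)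
    from ideal_depth_le_prime_height[OF this] ideal_depth_ge[OF P] prime_height_le[OF this]
    show "ideal_depth ?R P = prime_height ?R P" by simp
  qed
qed

end

section \<open>Minors and the packing property\<close>

definition indicator_monom :: "'v set \<Rightarrow> ('v \<Rightarrow>\<^sub>0 nat)" where
  "indicator_monom e = (\<Sum>v\<in>e. Poly_Mapping.single v 1)"

lemma lookup_indicator_monom: "finite e \<Longrightarrow> lookup (indicator_monom e) v = (if v \<in> e then 1 else 0)"
  unfolding indicator_monom_def by (simp add: lookup_sum lookup_single when_def)

lemma keys_indicator_monom: "finite e \<Longrightarrow> keys (indicator_monom e) = e"
  by (auto simp: in_keys_iff lookup_indicator_monom split: if_splits)

lemma mmonom_indicator_monom: "mmonom (indicator_monom e) = (\<Prod>v\<in>e. mvar v)"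
  by (simp add: indicator_monom_def mmonom_sum mvar_eq_mmonom)

lemma keys_mmonom: "keys (mmonom m :: ('v, 'k::comm_ring_1) mpoly) = {m}"
  by (simp add: mmonom_def)

text \<open>For \<open>F\<close> inside the finite set \<open>W\<close>, the square-free monomial
  ideal with generators indexed by \<open>F\<close>: divisibility by such a generator depends only
  on supports.\<close>

definition support_ideal :: "'v set \<Rightarrow> 'v set set \<Rightarrow> ('v, 'k::comm_ring_1) mpoly set" where
  "support_ideal W F = {p \<in> polys_in W. \<forall>m\<in>keys p. \<exists>a\<in>F. a \<subseteq> keys m}"

lemma mmonom_in_support_ideal:
  "mmonom m \<in> (support_ideal W F :: ('v, 'k::comm_ring_1) mpoly set) \<longleftrightarrow> keys m \<subseteq> W \<and> (\<exists>a\<in>F. a \<subseteq> keys m)"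
  by (simp add: support_ideal_def mmonom_in_polys_in_iff keys_mmonom)

lemma keys_nat_add: "keys (a + b) = keys a \<union> keys (b :: 'v \<Rightarrow>\<^sub>0 nat)"
  by (auto simp: in_keys_iff lookup_add)

lemma support_ideal_mult:
  assumes "p \<in> polys_in W" "q \<in> support_ideal W F" shows "p * q \<in> support_ideal W F"
  unfolding support_ideal_def
proof (intro CollectI conjI ballI)
  show "p * q \<in> polys_in W"
    using assms is_subring_mult[OF is_subring_polys_in] by (auto simp: support_ideal_def)
  fix m assume "m \<in> keys (p * q)"
  then obtain u v where "m = u + v" "v \<in> keys q" using keys_mult[of p q] by blast
  moreover from this obtain a where "a \<in> F" "a \<subseteq> keys v"
    using assms(2) unfolding support_ideal_def by blast
  ultimately show "\<exists>a\<in>F. a \<subseteq> keys m" by (auto simp: keys_nat_add)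
qed

lemma ideal_of_support_ideal: "ideal_of (polys_in W) (support_ideal W F)"
  unfolding ideal_of_def
proof (intro conjI ballI)
  show "support_ideal W F \<subseteq> polys_in W" "0 \<in> support_ideal W F"
    by (auto simp: support_ideal_def is_subring_zero is_subring_polys_in)
next
  fix p q :: "('a, 'b) mpoly" assume "p \<in> support_ideal W F" "q \<in> support_ideal W F"
  then show "p + q \<in> support_ideal W F"
    using keys_add[of p q] is_subring_add[OF is_subring_polys_in, of p W q]
    unfolding support_ideal_def by blast
qed (rule support_ideal_mult)

lemma support_ideal_induct [consumes 1, case_names zero add monom]:
  assumes "p \<in> support_ideal W F" "Q 0" "\<And>p q. Q p \<Longrightarrow> Q q \<Longrightarrow> Q (p + q)"
    "\<And>c m a. keys m \<subseteq> W \<Longrightarrow> a \<in> F \<Longrightarrow> a \<subseteq> keys m \<Longrightarrow> Q (mconst c * mmonom m)"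
  shows "Q p"
proof (induction p rule: mpoly_induct)
  case (monom c m)
  then obtain a where "a \<in> F" "a \<subseteq> keys m" "keys m \<subseteq> W"
    using assms(1) by (auto simp: support_ideal_def polys_in_def)
  then show ?case using assms(4) by blast
qed (use assms in auto)

lemma edge_ideal_eq_support_ideal:
  assumes V: "finite V" and EV: "E \<subseteq> Pow V"
  shows "edge_ideal V E = (support_ideal V E :: ('v, 'k::comm_ring_1) mpoly set)"
proof -
  have E: "e \<subseteq> V" if "e \<in> E" for e using EV that by blast
  let ?I = "edge_ideal V E :: ('v, 'k) mpoly set"
  have fin: "finite e" if "e \<in> E" for e using E[OF that] V finite_subset by blast
  have I: "ideal_of (polys_in V) ?I"
    using ideal_edge_ideal[OF EV] by (simp add: ideal_poly_ring_iff)
  show ?thesis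
  proof
    have "gen e \<in> (support_ideal V E :: ('v, 'k) mpoly set)" if "e \<in> E" for e
      unfolding mmonom_indicator_monom[symmetric] mmonom_in_support_ideal
      using that E[OF that] fin[OF that] by (auto simp: keys_indicator_monom)
    then show "?I \<subseteq> support_ideal V E"
      by (intro edge_ideal_minimal[OF EV] ideal_of_support_ideal)
  next
    show "support_ideal V E \<subseteq> ?I"
    proof
      fix p :: "('v, 'k) mpoly" assume "p \<in> support_ideal V E"
      then show "p \<in> ?I"
      proof (induction p rule: support_ideal_induct)
        case (monom c m e)
        have "m = (m - indicator_monom e) + indicator_monom e"
          using monom(3) fin[OF monom(2)]
          by (intro poly_mapping_eqI)
            (auto simp: lookup_add lookup_minus lookup_indicator_monom in_keys_iff subset_iff)
        then have "mconst c * mmonom m = (mconst c * mmonom (m - indicator_monom e)) * (\<Prod>v\<in>e. mvar v)"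
          by (metis mmonom_indicator_monom mmonom_simps(2) mult.assoc)
        moreover have "keys (m - indicator_monom e) \<subseteq> V"
          using monom(1) by (auto simp: in_keys_iff lookup_minus subset_iff)
        then have "mconst c * mmonom (m - indicator_monom e) \<in> polys_in V"
          by (intro is_subring_mult is_subring_polys_in mconst_in_polys_in) (simp add: mmonom_in_polys_in_iff)
        ultimately show ?case using I edge_ideal_generator[OF EV monom(2)] unfolding ideal_of_def by metis
      qed (use I in \<open>auto simp: ideal_of_def\<close>)
    qed
  qed
qed

text \<open>The generators after the substitution, in general no antichain: edges meeting
  \<open>Z\<close> vanish and the others lose \<open>U\<close>. The minor consists of the minimal
  members.\<close>

definition minor_family :: "'v set set \<Rightarrow> 'v set \<Rightarrow> 'v set \<Rightarrow> 'v set set" where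
  "minor_family E Z U = (\<lambda>e. e - U) ` {e \<in> E. e \<inter> Z = {}}"

text \<open>For surjectivity, \<open>p\<close> is multiplied by all variables of \<open>U\<close>:
  this restores the vertices removed from the edges, and the substitution sends the factor back to
  \<open>1\<close>.\<close>

lemma set_vars_image:
  assumes V: "finite V" and EV: "E \<subseteq> Pow V" and ZU: "Z \<subseteq> V" "U \<subseteq> V" "Z \<inter> U = {}"
  shows "set_vars Z U ` edge_ideal V E =
    (support_ideal (V - (Z \<union> U)) (minor_family E Z U) :: ('v, 'k::comm_ring_1) mpoly set)"
proof -
  have E: "e \<subseteq> V" if "e \<in> E" for e using EV that by blast
  let ?f = "\<lambda>v. if v \<in> Z then 0 else if v \<in> U then 1 else mvar v :: ('v, 'k) mpoly"
  let ?W = "support_ideal (V - (Z \<union> U)) (minor_family E Z U) :: ('v, 'k) mpoly set"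
  have W: "ideal_of (polys_in (V - (Z \<union> U))) ?W" by (rule ideal_of_support_ideal)
  then have W_mult: "r \<in> polys_in (V - (Z \<union> U)) \<Longrightarrow> p \<in> ?W \<Longrightarrow> r * p \<in> ?W" for r p
    unfolding ideal_of_def by blast
  show ?thesis
    unfolding set_vars_eq_subst edge_ideal_eq_support_ideal[OF V EV]
  proof
    show "subst ?f ` support_ideal V E \<subseteq> ?W"
    proof (rule image_subsetI)
      fix p :: "('v, 'k) mpoly" assume "p \<in> support_ideal V E"
      then show "subst ?f p \<in> ?W"
      proof (induction p rule: support_ideal_induct)
        case (monom c m e)
        have "eval_monom ?f m \<in> ?W"
        proof (cases "keys m \<inter> Z = {}")
          case False
          then obtain v where v: "v \<in> keys m" "v \<in> Z" by blast
          then have "?f v ^ lookup m v = 0" by (simp add: in_keys_iff zero_power)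
          then have "eval_monom ?f m = 0"
            unfolding eval_monom_def using v(1) by (intro prod_zero[OF finite_keys] bexI)
          then show ?thesis using W by (simp add: ideal_of_def)
        next
          case True
          define m' where "m' = (\<Sum>v\<in>keys m - U. Poly_Mapping.single v (lookup m v))"
          have "lookup m' v = (if v \<in> U then 0 else lookup m v)" for v
            unfolding m'_def by (auto simp: lookup_sum lookup_single when_def in_keys_iff)
          then have keys_m': "keys m' = keys m - U" by (auto simp: in_keys_iff split: if_splits)
          have "eval_monom ?f m = (\<Prod>v\<in>keys m - U. mvar v ^ lookup m v)"
            unfolding eval_monom_def using True
            by (intro prod.mono_neutral_cong_right) auto
          also have "\<dots> = mmonom m'" by (simp add: m'_def mmonom_sum mmonom_single)
          finally have eval: "eval_monom ?f m = mmonom m'" .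
          have "e \<inter> Z = {}" using monom(3) True by blast
          then have "e - U \<in> minor_family E Z U"
            using monom(2) unfolding minor_family_def by blast
          moreover have "e - U \<subseteq> keys m'" "keys m' \<subseteq> V - (Z \<union> U)"
            using monom(1,3) True unfolding keys_m' by blast+
          ultimately show ?thesis unfolding eval mmonom_in_support_ideal by blast
        qed
        then show ?case unfolding subst_simps by (rule W_mult[OF mconst_in_polys_in])
      qed (use W in \<open>auto simp: ideal_of_def\<close>)
    qed
    show "?W \<subseteq> subst ?f ` support_ideal V E"
    proof
      fix p assume p: "p \<in> ?W"
      have "subst ?f p = subst mvar p"
        using p by (intro subst_cong) (auto simp: support_ideal_def polys_in_def subset_iff)
      moreover have "subst ?f (\<Prod>v\<in>U. mvar v) = 1"
        using ZU(3) by (auto intro!: prod.neutral)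
      ultimately have "p = subst ?f (p * (\<Prod>v\<in>U. mvar v))" by (simp del: subst_prod)
      moreover have "p * (\<Prod>v\<in>U. mvar v) \<in> support_ideal V E"
        unfolding support_ideal_def
      proof (intro CollectI conjI ballI)
        have "p \<in> polys_in V"
          using p polys_in_mono[of "V - (Z \<union> U)" V] by (auto simp: support_ideal_def)
        then show "p * (\<Prod>v\<in>U. mvar v) \<in> polys_in V"
          using ZU(2) by (intro is_subring_mult is_subring_prod is_subring_polys_in mvar_in_polys_in) auto
        fix m assume "m \<in> keys (p * (\<Prod>v\<in>U. mvar v))"
        then obtain u where u: "u \<in> keys p" "m = u + indicator_monom U"
          using keys_mult[of p "mmonom (indicator_monom U)"]
          by (auto simp: keys_mmonom simp flip: mmonom_indicator_monom)
        then obtain e where "e \<in> E" "e - U \<subseteq> keys u"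
          using p by (auto simp: support_ideal_def minor_family_def)
        moreover have "finite U" using ZU(2) V finite_subset by blast
        ultimately show "\<exists>e\<in>E. e \<subseteq> keys m" using u by (auto simp: keys_nat_add keys_indicator_monom)
      qed
      ultimately show "p \<in> subst ?f ` support_ideal V E" by blast
    qed
  qed
qed

definition minimals :: "'v set set \<Rightarrow> 'v set set" where
  "minimals F = {a \<in> F. \<forall>b\<in>F. b \<subseteq> a \<longrightarrow> b = a}"

lemma minimal_monomials_support_ideal:
  assumes W: "finite W" and F: "\<And>a. a \<in> F \<Longrightarrow> a \<subseteq> W"
  shows "keys ` minimal_monomials (support_ideal W F :: ('v, 'k::comm_ring_1) mpoly set) = minimals F"
proof -
  let ?I = "support_ideal W F :: ('v, 'k) mpoly set"
  have fin: "finite a" if "a \<in> F" for a using F[OF that] W finite_subset by blast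
  have ind: "mmonom (indicator_monom a) \<in> ?I" if "a \<in> F" for a
    using that F[OF that] fin[OF that] by (auto simp: mmonom_in_support_ideal keys_indicator_monom)
  have ind_le: "lookup (indicator_monom a) v \<le> lookup m v" if "a \<in> F" "a \<subseteq> keys m" for a m v
    using that(2) fin[OF that(1)] by (auto simp: lookup_indicator_monom in_keys_iff subset_iff Suc_le_eq)
  show ?thesis
  proof
    show "keys ` minimal_monomials ?I \<subseteq> minimals F"
    proof (rule image_subsetI)
      fix m assume m: "m \<in> minimal_monomials ?I"
      have eq: "indicator_monom a = m" if "a \<in> F" "a \<subseteq> keys m" for a
        using m ind[OF that(1)] ind_le[OF that] unfolding minimal_monomials_def by blast
      obtain a where "a \<in> F" "a \<subseteq> keys m"
        using m by (auto simp: minimal_monomials_def mmonom_in_support_ideal)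
      moreover have "a = keys m" if "a \<in> F" "a \<subseteq> keys m" for a
        using eq[OF that] keys_indicator_monom[OF fin[OF that(1)]] by simp
      ultimately show "keys m \<in> minimals F" unfolding minimals_def by blast
    qed
    show "minimals F \<subseteq> keys ` minimal_monomials ?I"
    proof
      fix a assume "a \<in> minimals F"
      then have a: "a \<in> F" "\<And>b. b \<in> F \<Longrightarrow> b \<subseteq> a \<Longrightarrow> b = a" by (auto simp: minimals_def)
      have "m = indicator_monom a"
        if m: "mmonom m \<in> ?I" "\<forall>v. lookup m v \<le> lookup (indicator_monom a) v" for m
      proof -
        have sub: "keys m \<subseteq> a"
          using m(2) fin[OF a(1)] by (force simp: lookup_indicator_monom in_keys_iff split: if_splits)
        moreover obtain b where "b \<in> F" "b \<subseteq> keys m"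
          using m(1) by (auto simp: mmonom_in_support_ideal)
        ultimately have "keys m = a" using a(2)[of b] by blast
        then show ?thesis
          using ind_le[OF a(1), of m] m(2) by (intro poly_mapping_eqI antisym) auto
      qed
      then have "indicator_monom a \<in> minimal_monomials ?I"
        using ind[OF a(1)] unfolding minimal_monomials_def by blast
      then show "a \<in> keys ` minimal_monomials ?I"
        using keys_indicator_monom[OF fin[OF a(1)]] by (metis imageI)
    qed
  qed
qed

text \<open>The image ideal is nonzero exactly if some edge survives, and proper exactly if no
  surviving edge has shrunk to the empty set. The field drops out of the description.\<close>

lemma is_minor_iff:
  assumes V: "finite V" and EV: "E \<subseteq> Pow V"
  shows "is_minor TYPE('k::field) V E V1 E1 \<longleftrightarrow>
    (\<exists>Z U. Z \<subseteq> V \<and> U \<subseteq> V \<and> Z \<inter> U = {} \<and> V1 = V - (Z \<union> U) \<and> minor_family E Z U \<noteq> {} \<and>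
      {} \<notin> minor_family E Z U \<and> E1 = minimals (minor_family E Z U))"
proof -
  have E: "e \<subseteq> V" if "e \<in> E" for e using EV that by blast
  have *: "set_vars Z U ` edge_ideal V E \<noteq> {0 :: ('a, 'k) mpoly} \<longleftrightarrow> minor_family E Z U \<noteq> {}" (is ?A)
    "set_vars Z U ` edge_ideal V E \<noteq> carrier (poly_ring (V - (Z \<union> U)) :: ('a, 'k) mpoly ring) \<longleftrightarrow>
      {} \<notin> minor_family E Z U" (is ?B)
    "keys ` minimal_monomials (set_vars Z U ` (edge_ideal V E :: ('a, 'k) mpoly set)) =
      minimals (minor_family E Z U)" (is ?C)
    if ZU: "Z \<subseteq> V" "U \<subseteq> V" "Z \<inter> U = {}" for Z U
  proof -
    let ?W = "V - (Z \<union> U)" and ?F = "minor_family E Z U"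
    have F: "a \<subseteq> ?W" if "a \<in> ?F" for a
      using that E unfolding minor_family_def by blast
    have fin: "finite ?W" using V by simp
    have I: "set_vars Z U ` edge_ideal V E = (support_ideal ?W ?F :: ('a, 'k) mpoly set)"
      by (rule set_vars_image[OF V EV ZU])
    have ind: "mmonom (indicator_monom a) \<in> (support_ideal ?W ?F :: ('a, 'k) mpoly set)" if "a \<in> ?F" for a
      using that F[OF that] finite_subset[OF F[OF that] fin]
      by (auto simp: mmonom_in_support_ideal keys_indicator_monom)
    show ?A
      unfolding I
    proof
      assume "support_ideal ?W ?F \<noteq> {0 :: ('a, 'k) mpoly}"
      moreover have "0 \<in> (support_ideal ?W ?F :: ('a, 'k) mpoly set)"
        using ideal_of_support_ideal[unfolded ideal_of_def] by blast
      ultimately obtain p :: "('a, 'k) mpoly" where "p \<in> support_ideal ?W ?F" "p \<noteq> 0" by blast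
      then show "?F \<noteq> {}" by (auto simp: support_ideal_def)
    next
      assume "?F \<noteq> {}"
      then obtain a where "a \<in> ?F" by blast
      moreover have "mmonom (indicator_monom a) \<noteq> (0 :: ('a, 'k) mpoly)"
        by (metis keys_mmonom keys_zero insert_not_empty)
      ultimately show "support_ideal ?W ?F \<noteq> {0 :: ('a, 'k) mpoly}" using ind by blast
    qed
    show ?B
      unfolding I
    proof
      assume "support_ideal ?W ?F \<noteq> carrier (poly_ring ?W :: ('a, 'k) mpoly ring)"
      then show "{} \<notin> ?F" by (auto simp: support_ideal_def)
    next
      assume "{} \<notin> ?F"
      then have "mmonom 0 \<notin> (support_ideal ?W ?F :: ('a, 'k) mpoly set)"
        unfolding mmonom_in_support_ideal by auto
      moreover have "mmonom 0 \<in> (polys_in ?W :: ('a, 'k) mpoly set)"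
        by (simp only: mmonom_in_polys_in_iff) simp
      ultimately show "support_ideal ?W ?F \<noteq> carrier (poly_ring ?W :: ('a, 'k) mpoly ring)"
        by (simp only: poly_ring_simps) blast
    qed
    show ?C unfolding I using fin F by (rule minimal_monomials_support_ideal)
  qed
  show ?thesis
    unfolding is_minor_def using * by (intro iffI; elim exE conjE; intro exI conjI) (assumption | simp)+
qed

text \<open>The Koenig property through witnesses: a packing is never larger than a cover, so one
  inequality between a cover and a packing certifies that both are optimal.\<close>

definition cover_packing :: "'v set \<Rightarrow> 'v set set \<Rightarrow> bool" where
  "cover_packing V F \<longleftrightarrow> (\<exists>S M. vertex_cover V F S \<and> M \<subseteq> F \<and> pairwise disjnt M \<and> card S \<le> card M)"

lemma card_matching_le_card_cover:
  assumes "vertex_cover V F S" "M \<subseteq> F" "pairwise disjnt M" "finite S"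
  shows "card M \<le> card S"
proof -
  have "\<forall>e\<in>M. \<exists>v. v \<in> S \<inter> e" using assms(1,2) unfolding vertex_cover_def by blast
  then obtain f where f: "\<And>e. e \<in> M \<Longrightarrow> f e \<in> S \<inter> e" by metis
  have "inj_on f M"
  proof (rule inj_onI, rule ccontr)
    fix e e' assume e: "e \<in> M" "e' \<in> M" "f e = f e'" "e \<noteq> e'"
    then have "disjnt e e'" using assms(3) by (auto simp: pairwise_def)
    then show False using f[OF e(1)] f[OF e(2)] e(3) by (auto simp: disjnt_def)
  qed
  then show ?thesis using f assms(4) by (intro card_inj_on_le[of f]) auto
qed

lemma konig_property_iff:
  assumes V: "finite V" and F: "\<And>e. e \<in> F \<Longrightarrow> e \<subseteq> V" and ne: "{} \<notin> F"
  shows "konig_property V F \<longleftrightarrow> cover_packing V F"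
proof -
  let ?C = "{card S |S. vertex_cover V F S}"
  let ?M = "{card M |M. M \<subseteq> F \<and> pairwise disjnt M}"
  have "?C \<subseteq> card ` Pow V" by (auto simp: vertex_cover_def)
  then have finC: "finite ?C" by (rule finite_subset) (simp add: V)
  have "F \<subseteq> Pow V" using F by blast
  then have finF: "finite F" using V finite_subset by blast
  have "?M \<subseteq> card ` Pow F" by auto
  then have finM: "finite ?M" by (rule finite_subset) (simp add: finF)
  have "V \<inter> e \<noteq> {}" if "e \<in> F" for e
    using F[OF that] that ne by (metis inf.absorb2)
  then have "vertex_cover V F V" by (simp add: vertex_cover_def)
  then have "?C \<noteq> {}" by blast
  then have C: "covering_number V F \<in> ?C" unfolding covering_number_def using finC by (rule Min_in[rotated])
  have "0 \<in> ?M" by (intro CollectI exI[of _ "{}"]) simp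
  then have "?M \<noteq> {}" by blast
  then have M: "matching_number F \<in> ?M" unfolding matching_number_def using finM by (rule Max_in[rotated])
  have le: "card M \<le> card S" if "vertex_cover V F S" "M \<subseteq> F" "pairwise disjnt M" for S M
    using that V by (intro card_matching_le_card_cover) (auto simp: vertex_cover_def intro: finite_subset)
  obtain S M where SM: "vertex_cover V F S" "M \<subseteq> F" "pairwise disjnt M"
    "covering_number V F = card S" "matching_number F = card M"
    using C M by blast
  show ?thesis
  proof
    assume "konig_property V F"
    then have "card S \<le> card M" by (simp add: konig_property_def SM(4,5))
    then show "cover_packing V F" unfolding cover_packing_def using SM(1-3) by blast
  next
    assume "cover_packing V F"
    then obtain S' M' where SM': "vertex_cover V F S'" "M' \<subseteq> F" "pairwise disjnt M'" "card S' \<le> card M'"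
      unfolding cover_packing_def by blast
    have "card S \<le> card S'"
      unfolding SM(4)[symmetric] covering_number_def using finC SM'(1) by (intro Min_le) auto
    moreover have "card M' \<le> card M"
      unfolding SM(5)[symmetric] matching_number_def using finM SM' by (intro Max_ge) auto
    moreover have "card M \<le> card S" using le SM by blast
    ultimately show "konig_property V F"
      unfolding konig_property_def SM(4,5) using SM'(4) by linarith
  qed
qed

lemma exists_minimal:
  assumes "finite F" "e \<in> F" shows "\<exists>a\<in>minimals F. a \<subseteq> e"
proof -
  have "finite {a \<in> F. a \<subseteq> e}" "{a \<in> F. a \<subseteq> e} \<noteq> {}" using assms by auto
  then obtain a where a: "a \<in> F" "a \<subseteq> e" "\<And>b. b \<in> F \<Longrightarrow> b \<subseteq> e \<Longrightarrow> b \<subseteq> a \<Longrightarrow> a = b"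
    using finite_has_minimal[of "{a \<in> F. a \<subseteq> e}"] by auto
  then have "a \<in> minimals F" unfolding minimals_def by blast
  then show ?thesis using a(2) by blast
qed

text \<open>A cover of the minimal members covers every member, and a packing can be shrunk to
  minimal members, which stay disjoint and, being nonempty, distinct.\<close>

lemma cover_packing_minimals:
  assumes F: "finite F" and ne: "{} \<notin> F"
  shows "cover_packing V (minimals F) \<longleftrightarrow> cover_packing V F"
proof
  assume "cover_packing V (minimals F)"
  then obtain S M where SM: "vertex_cover V (minimals F) S" "M \<subseteq> minimals F" "pairwise disjnt M" "card S \<le> card M"
    unfolding cover_packing_def by blast
  have "vertex_cover V F S"
    unfolding vertex_cover_def
  proof (intro conjI ballI)
    show "S \<subseteq> V" using SM(1) by (simp add: vertex_cover_def)
    fix e assume "e \<in> F"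
    then obtain a where "a \<in> minimals F" "a \<subseteq> e" using exists_minimal[OF F] by blast
    then show "S \<inter> e \<noteq> {}" using SM(1) unfolding vertex_cover_def by blast
  qed
  moreover have "M \<subseteq> F" using SM(2) by (auto simp: minimals_def)
  ultimately show "cover_packing V F" unfolding cover_packing_def using SM by blast
next
  assume "cover_packing V F"
  then obtain S M where SM: "vertex_cover V F S" "M \<subseteq> F" "pairwise disjnt M" "card S \<le> card M"
    unfolding cover_packing_def by blast
  have "\<forall>e\<in>M. \<exists>a. a \<in> minimals F \<and> a \<subseteq> e" using exists_minimal[OF F] SM(2) by blast
  then obtain g where g: "\<And>e. e \<in> M \<Longrightarrow> g e \<in> minimals F \<and> g e \<subseteq> e" by metis
  have g_ne: "g e \<noteq> {}" if "e \<in> M" for e using g[OF that] ne unfolding minimals_def by auto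
  have disj: "disjnt (g e) (g e')" if "e \<in> M" "e' \<in> M" "e \<noteq> e'" for e e'
  proof -
    have "disjnt e e'" using SM(3) that by (auto simp: pairwise_def)
    then show ?thesis using g[OF that(1)] g[OF that(2)] unfolding disjnt_def by blast
  qed
  have "inj_on g M"
    using disj g_ne by (intro inj_onI) (metis disjnt_self_iff_empty)
  then have "card (g ` M) = card M" by (rule card_image)
  moreover have "pairwise disjnt (g ` M)" using disj by (auto simp: pairwise_def)
  moreover have "g ` M \<subseteq> minimals F" using g by blast
  moreover have "vertex_cover V (minimals F) S"
    using SM(1) by (auto simp: vertex_cover_def minimals_def)
  ultimately show "cover_packing V (minimals F)" unfolding cover_packing_def using SM(4) by metis
qed

lemma packing_property_iff:
  assumes V: "finite V" and EV: "E \<subseteq> Pow V"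
  shows "packing_property TYPE('k::field) V E \<longleftrightarrow>
    (\<forall>Z U. Z \<subseteq> V \<longrightarrow> U \<subseteq> V \<longrightarrow> Z \<inter> U = {} \<longrightarrow> minor_family E Z U \<noteq> {} \<longrightarrow> {} \<notin> minor_family E Z U \<longrightarrow>
      cover_packing (V - (Z \<union> U)) (minor_family E Z U))"
proof -
  have E: "e \<subseteq> V" if "e \<in> E" for e using EV that by blast
  have *: "konig_property (V - (Z \<union> U)) (minimals (minor_family E Z U)) \<longleftrightarrow>
      cover_packing (V - (Z \<union> U)) (minor_family E Z U)"
    if "{} \<notin> minor_family E Z U" for Z U
  proof -
    have sub: "a \<subseteq> V - (Z \<union> U)" if "a \<in> minor_family E Z U" for a
      using that E unfolding minor_family_def by blast
    have "minor_family E Z U \<subseteq> Pow V" using sub by blast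
    then have "finite (minor_family E Z U)" using V finite_subset by blast
    then have "cover_packing (V - (Z \<union> U)) (minimals (minor_family E Z U)) \<longleftrightarrow>
        cover_packing (V - (Z \<union> U)) (minor_family E Z U)"
      using that by (rule cover_packing_minimals)
    moreover have "konig_property (V - (Z \<union> U)) (minimals (minor_family E Z U)) \<longleftrightarrow>
        cover_packing (V - (Z \<union> U)) (minimals (minor_family E Z U))"
      using V sub that by (intro konig_property_iff) (auto simp: minimals_def)
    ultimately show ?thesis by simp
  qed
  show ?thesis
    unfolding packing_property_def is_minor_iff[OF V EV] using * by blast
qed

context whiskering
begin

lemma E_Pow: "E \<subseteq> Pow X"
  using E_subset by blast

text \<open>Let \<open>W\<close> collect the vertices that survive together with their whisker. Deleting \<open>W\<close> from the minor of \<open>E\<close>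
  gives a minor with the Koenig property; its optimal cover and packing are completed by \<open>W\<close> and all
  surviving whiskers.\<close>

theorem packing_property_whiskering:
  assumes "packing_property TYPE('k::field) X E"
  shows "packing_property TYPE('k) V E'"
  unfolding packing_property_iff[OF finite_V E'_Pow]
proof (intro allI impI)
  fix Z U assume Z: "Z \<subseteq> V" and U: "U \<subseteq> V" and ZU: "Z \<inter> U = {}" and ne: "{} \<notin> minor_family E' Z U"
  let ?F = "minor_family E' Z U"
  \<comment> \<open>\<open>A\<close> indexes all whiskers that survive, including those whose root
    is set to \<open>1\<close>; \<open>W\<close> keeps only roots that are still vertices of the
    minor.\<close>
  define A where "A = {v \<in> X. whisker v \<inter> Z = {}}"
  define W where "W = A - U"
  let ?H = "minor_family E ((Z \<inter> X) \<union> W) (U \<inter> X)"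
  let ?VH = "X - (((Z \<inter> X) \<union> W) \<union> (U \<inter> X))"
  have finA: "finite A" using finite_X by (simp add: A_def)
  have H_F: "?H \<subseteq> ?F"
  proof
    fix a assume "a \<in> ?H"
    then obtain e where e: "e \<in> E" "e \<inter> ((Z \<inter> X) \<union> W) = {}" "a = e - (U \<inter> X)"
      by (auto simp: minor_family_def)
    moreover from this have "e - (U \<inter> X) = e - U" "e \<inter> Z = {}" using E_subset[OF e(1)] by blast+
    ultimately show "a \<in> ?F" by (auto simp: minor_family_def E'_def)
  qed
  have "cover_packing ?VH ?H"
  \<comment> \<open>The zero ideal is no minor, so the assumption says nothing here; the empty cover
    and the empty packing do.\<close>
  proof (cases "?H = {}")
    case True
    then show ?thesis
      unfolding cover_packing_def vertex_cover_def by (intro exI[of _ "{}"]) auto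
  next
    case False
    have "Z \<inter> X \<union> W \<subseteq> X" "U \<inter> X \<subseteq> X" "(Z \<inter> X \<union> W) \<inter> (U \<inter> X) = {}"
      using ZU by (auto simp: W_def A_def)
    moreover have "{} \<notin> ?H" using ne H_F by (meson subsetD)
    ultimately show ?thesis
      using False by (intro assms[unfolded packing_property_iff[OF finite_X E_Pow], rule_format])
  qed
  then obtain S0 M0 where "vertex_cover ?VH ?H S0" and M0: "M0 \<subseteq> ?H" "pairwise disjnt M0"
    and card0: "card S0 \<le> card M0"
    unfolding cover_packing_def by (elim exE conjE)
  then have S0: "S0 \<subseteq> ?VH" "\<And>a. a \<in> ?H \<Longrightarrow> S0 \<inter> a \<noteq> {}"
    unfolding vertex_cover_def by simp_all
  have wF: "whisker v - U \<in> ?F" if "v \<in> A" for v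
    using that by (auto simp: minor_family_def E'_def A_def)
  have "\<forall>v\<in>A. \<exists>u. u \<in> whisker v - U" using wF ne by (metis ex_in_conv)
  then obtain c where c: "\<And>v. v \<in> A \<Longrightarrow> c v \<in> whisker v - U" by metis
  \<comment> \<open>The root itself is taken whenever it is left, so that edges of \<open>E\<close>
    through \<open>W\<close> are covered too; otherwise any remaining vertex of the whisker will
    do.\<close>
  define b where "b v = (if v \<in> U then c v else v)" for v
  have b: "b v \<in> whisker v - U" if "v \<in> A" for v
    using c[OF that] by (auto simp: b_def whisker_def)
  define S where "S = S0 \<union> b ` A"
  define M where "M = M0 \<union> (\<lambda>v. whisker v - U) ` A"
  have "b ` A \<subseteq> V - (Z \<union> U)"
  proof
    fix u assume "u \<in> b ` A"
    then obtain v where v: "v \<in> A" "u = b v" by blast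
    then have "u \<in> whisker v" "whisker v \<inter> Z = {}" "whisker v \<subseteq> V" "u \<notin> U"
      using b[OF v(1)] E'_subset[of "whisker v"] by (auto simp: A_def E'_def)
    then show "u \<in> V - (Z \<union> U)" by blast
  qed
  moreover have "S0 \<subseteq> V - (Z \<union> U)" using S0(1) by (auto simp: V_def)
  ultimately have "S \<subseteq> V - (Z \<union> U)" by (simp add: S_def)
  moreover have "S \<inter> a \<noteq> {}" if a: "a \<in> ?F" for a
  proof -
    obtain e where e: "e \<in> E'" "e \<inter> Z = {}" "a = e - U" using a by (auto simp: minor_family_def)
    show ?thesis
    proof (cases "e \<in> E")
      case True
      show ?thesis
      proof (cases "e \<inter> W = {}")
        case True
        then have "e - (U \<inter> X) \<in> ?H" using \<open>e \<in> E\<close> e(2) by (auto simp: minor_family_def)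
        moreover have "e - (U \<inter> X) = a" using E_subset[OF \<open>e \<in> E\<close>] e(3) by blast
        ultimately show ?thesis using S0(2) unfolding S_def by blast
      next
        case False
        then obtain v where "v \<in> e" "v \<in> A" "v \<notin> U" by (auto simp: W_def)
        then have "v \<in> S \<inter> a" using e(3) by (auto simp: S_def b_def)
        then show ?thesis by blast
      qed
    next
      case False
      then obtain v where v: "v \<in> X" "e = whisker v" using e(1) by (auto simp: E'_def)
      then have "v \<in> A" using e(2) by (simp add: A_def)
      then have "b v \<in> S \<inter> a" using b[of v] e(3) v(2) by (auto simp: S_def)
      then show ?thesis by blast
    qed
  qed
  ultimately have "vertex_cover (V - (Z \<union> U)) ?F S" unfolding vertex_cover_def by blast
  moreover have "M \<subseteq> ?F" using M0(1) H_F wF by (auto simp: M_def)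
  moreover
  have ww: "disjnt (whisker u - U) (whisker v - U)" if "u \<in> A" "v \<in> A" "u \<noteq> v" for u v
    using whisker_disjoint[of u v] that by (auto simp: disjnt_def A_def)
  \<comment> \<open>An edge inside \<open>X\<close> can meet a whisker only in its root, which lies
    either in \<open>W\<close>, avoided by \<open>M0\<close>, or in \<open>U\<close>, already
    removed.\<close>
  have M0w: "disjnt a (whisker v - U)" if a: "a \<in> M0" and v: "v \<in> A" for a v
  proof -
    obtain e where e: "e \<in> E" "e \<inter> (Z \<inter> X \<union> W) = {}" "a = e - (U \<inter> X)"
      using M0(1) a by (auto simp: minor_family_def)
    have "e \<inter> N v = {}" using E_subset[OF e(1)] N_new[of v] v by (auto simp: A_def)
    moreover have "v \<notin> e - U" using e(2) v by (auto simp: W_def)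
    ultimately show ?thesis
      using e(3) v by (auto simp: disjnt_def whisker_def A_def)
  qed
  have "pairwise disjnt M"
    unfolding M_def pairwise_def using M0(2) ww M0w
    by (auto simp: pairwise_def disjnt_sym)
  moreover have "card S \<le> card M"
  proof -
    have w_ne: "whisker v - U \<noteq> {}" if "v \<in> A" for v using wF[OF that] ne by metis
    have inj: "inj_on (\<lambda>v. whisker v - U) A"
      using ww w_ne by (intro inj_onI) (metis disjnt_self_iff_empty)
    have "M0 \<inter> (\<lambda>v. whisker v - U) ` A = {}"
      using M0w w_ne by (metis (no_types, lifting) disjnt_self_iff_empty disjoint_iff image_iff)
    moreover have "M0 \<subseteq> Pow X" using M0(1) E_subset by (auto simp: minor_family_def)
    then have "finite M0" using finite_X finite_subset by blast
    ultimately have "card M = card M0 + card A"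
      unfolding M_def using finA inj by (subst card_Un_disjoint) (auto simp: card_image)
    moreover have "card S \<le> card S0 + card A"
      unfolding S_def using card_Un_le[of S0 "b ` A"] card_image_le[OF finA, of b] by linarith
    ultimately show ?thesis using card0 by linarith
  qed
  ultimately show "cover_packing (V - (Z \<union> U)) ?F" unfolding cover_packing_def by blast
qed

end

section \<open>The max-flow min-cut property\<close>

lemma weak_duality:
  assumes V: "finite V" and x: "primal_feasible V E x" and y: "dual_feasible V E w y"
  shows "dual_value E y \<le> primal_value V w x"
proof -
  have "dual_value E y \<le> (\<Sum>e\<in>E. (\<Sum>v\<in>V. x v * incidence v e) * y e)"
    unfolding dual_value_def
  proof (rule sum_mono)
    fix e assume "e \<in> E"
    then show "y e \<le> (\<Sum>v\<in>V. x v * incidence v e) * y e"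
      using x y mult_right_mono[of 1 "\<Sum>v\<in>V. x v * incidence v e" "y e"]
      by (simp add: primal_feasible_def dual_feasible_def)
  qed
  also have "\<dots> = (\<Sum>e\<in>E. \<Sum>v\<in>V. x v * (incidence v e * y e))"
    by (simp add: sum_distrib_right mult.assoc)
  also have "\<dots> = (\<Sum>v\<in>V. \<Sum>e\<in>E. x v * (incidence v e * y e))"
    by (rule sum.swap)
  also have "\<dots> = (\<Sum>v\<in>V. x v * (\<Sum>e\<in>E. incidence v e * y e))"
    by (simp add: sum_distrib_left)
  also have "\<dots> \<le> (\<Sum>v\<in>V. x v * real (w v))"
    using x y by (intro sum_mono mult_left_mono) (auto simp: primal_feasible_def dual_feasible_def)
  finally show ?thesis by (simp add: primal_value_def mult.commute)
qed

lemma optimalI: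
  assumes V: "finite V" and x: "primal_feasible V E x" and y: "dual_feasible V E w y"
    and le: "primal_value V w x \<le> dual_value E y"
  shows "primal_optimal V E w x" "dual_optimal V E w y" "primal_value V w x = dual_value E y"
  using weak_duality[OF V x y] weak_duality[OF V _ y] weak_duality[OF V x] x y le
  by (force simp: primal_optimal_def dual_optimal_def)+

context whiskering
begin

lemma finite_E: "finite E"
  using finite_X E_subset by (metis Pow_iff finite_Pow_iff finite_subset subsetI)

text \<open>Each whisker is packed as often as possible, \<open>t v\<close> times, and the rest of the weight is left to \<open>E\<close>.
  To the cover of \<open>E\<close> one adds for each \<open>v\<close> not yet covered a vertex of least weight \<open>t v\<close> in its whisker.\<close>

theorem max_flow_min_cut_whiskering:
  assumes "max_flow_min_cut X E"
  shows "max_flow_min_cut V E'"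
  unfolding max_flow_min_cut_def
proof
  fix w :: "'v \<Rightarrow> nat"
  have finite_whisker: "finite (whisker v)" if "v \<in> X" for v
    using finite_N[OF that] by (simp add: whisker_def)
  define t where "t v = Min (w ` whisker v)" for v
  have t_le: "t v \<le> w u" if "v \<in> X" "u \<in> whisker v" for u v
    unfolding t_def using finite_whisker[OF that(1)] that(2) by (intro Min_le) auto
  have "\<exists>u\<in>whisker v. w u = t v" if "v \<in> X" for v
  proof -
    have "t v \<in> w ` whisker v"
      unfolding t_def using finite_whisker[OF that] by (intro Min_in) (auto simp: whisker_def)
    then show ?thesis by auto
  qed
  then obtain c where c: "\<And>v. v \<in> X \<Longrightarrow> c v \<in> whisker v" "\<And>v. v \<in> X \<Longrightarrow> w (c v) = t v" by metis
  \<comment> \<open>No truncation happens on \<open>X\<close>, because \<open>v\<close> belongs to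
    its own whisker and so \<open>t v\<close> is at most \<open>w v\<close>.\<close>
  define w' where "w' v = w v - t v" for v
  obtain x y where x: "primal_feasible X E x" "\<And>v. v \<in> X \<Longrightarrow> x v \<in> \<int>"
    and y: "dual_feasible X E w' y" "\<And>e. e \<in> E \<Longrightarrow> y e \<in> \<int>"
    and xy: "primal_value X w' x = dual_value E y"
    using assms unfolding max_flow_min_cut_def primal_optimal_def dual_optimal_def by blast
  \<comment> \<open>Rounding the integral optimum down to values \<open>0\<close> and
    \<open>1\<close> keeps it a cover and does not raise its cost.\<close>
  define S where "S = {v \<in> X. x v \<ge> 1}"
  have x_int: "x v = 0 \<or> x v \<ge> 1" if v: "v \<in> X" for v
  proof -
    obtain k where "x v = of_int k" using x(2)[OF v] by (auto elim: Ints_cases)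
    then show ?thesis using x(1) v by (auto simp: primal_feasible_def)
  qed
  have S_cover: "S \<inter> e \<noteq> {}" if "e \<in> E" for e
  proof
    assume "S \<inter> e = {}"
    then have "(\<Sum>v\<in>X. x v * incidence v e) = 0"
      using x_int by (intro sum.neutral) (auto simp: S_def incidence_def)
    then show False using x(1) that by (auto simp: primal_feasible_def)
  qed
  have S_weight: "(\<Sum>v\<in>S. real (w' v)) \<le> dual_value E y"
  proof -
    have "(\<Sum>v\<in>S. real (w' v)) \<le> (\<Sum>v\<in>S. real (w' v) * x v)"
      by (intro sum_mono) (auto simp: S_def mult_le_cancel_left1)
    also have "\<dots> \<le> (\<Sum>v\<in>X. real (w' v) * x v)"
      using finite_X x(1) by (intro sum_mono2) (auto simp: S_def primal_feasible_def)
    finally show ?thesis using xy by (simp add: primal_value_def)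
  qed
  \<comment> \<open>Each whisker contributes exactly one vertex: a root in \<open>S\<close> costs
    \<open>w' v + t v\<close>, any other whisker costs \<open>t v\<close>. The total is the cost of
    \<open>S\<close> plus the number of packed whiskers.\<close>
  define b where "b v = (if v \<in> S then v else c v)" for v
  have b: "b v \<in> whisker v" if "v \<in> X" for v using c(1)[OF that] by (simp add: b_def whisker_def)
  have wb: "w (b v) = (if v \<in> S then w' v + t v else t v)" if "v \<in> X" for v
    using c(2)[OF that] t_le[OF that, of v] by (simp add: b_def w'_def whisker_def)
  define T where "T = b ` X"
  have T_V: "T \<subseteq> V"
  proof
    fix u assume "u \<in> T"
    then obtain v where v: "v \<in> X" "u = b v" by (auto simp: T_def)
    then have "whisker v \<in> E'" by (simp add: E'_def)
    then show "u \<in> V" using b[OF v(1)] v(2) E'_subset by blast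
  qed
  have inj_b: "inj_on b X"
    using b whisker_disjoint by (intro inj_onI) (metis disjoint_iff)
  define x' where "x' v = (if v \<in> T then 1 else 0 :: real)" for v
  \<comment> \<open>The contributions are added because a whisker without leaves may coincide with a
    one-element edge of \<open>E\<close>.\<close>
  define y' where "y' e = (if e \<in> E then y e else 0) + (\<Sum>v\<in>X. if whisker v = e then real (t v) else 0)" for e
  have finE': "finite E'" using finite_E finite_X by (simp add: E'_def)
  have split: "(\<Sum>e\<in>E'. g e * y' e) = (\<Sum>e\<in>E. g e * y e) + (\<Sum>v\<in>X. g (whisker v) * real (t v))" for g :: "'v set \<Rightarrow> real"
  proof -
    have "(\<Sum>e\<in>E'. g e * (if e \<in> E then y e else 0)) = (\<Sum>e\<in>E. g e * y e)"
      using finE' by (intro sum.mono_neutral_cong_right) (auto simp: E'_def)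
    moreover have "(\<Sum>e\<in>E'. g e * (\<Sum>v\<in>X. if whisker v = e then real (t v) else 0)) =
        (\<Sum>v\<in>X. \<Sum>e\<in>E'. if whisker v = e then g e * real (t v) else 0)"
      by (subst sum.swap) (auto simp: sum_distrib_left intro!: sum.cong)
    moreover have "(\<Sum>e\<in>E'. if whisker v = e then g e * real (t v) else 0) = g (whisker v) * real (t v)"
      if "v \<in> X" for v
      using finE' that by (simp add: E'_def)
    ultimately show ?thesis by (simp add: y'_def distrib_left sum.distrib)
  qed
  have dual: "dual_feasible V E' w y'"
    unfolding dual_feasible_def
  proof (intro conjI ballI)
    fix e
    show "0 \<le> y' e" using y(1) by (auto simp: y'_def dual_feasible_def intro!: add_nonneg_nonneg sum_nonneg)
  next
    fix u assume u: "u \<in> V"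
    show "(\<Sum>e\<in>E'. incidence u e * y' e) \<le> real (w u)"
    proof (cases "u \<in> X")
      case True
      have "(\<Sum>v\<in>X. incidence u (whisker v) * real (t v)) = (\<Sum>v\<in>X. if v = u then real (t v) else 0)"
        using True N_new by (intro sum.cong) (auto simp: incidence_def whisker_def)
      also have "\<dots> = real (t u)" using True finite_X by simp
      finally have "(\<Sum>e\<in>E'. incidence u e * y' e) \<le> real (w' u) + real (t u)"
        using y(1) True unfolding split by (auto simp: dual_feasible_def)
      then show ?thesis using t_le[OF True, of u] by (simp add: w'_def whisker_def)
    next
      case False
      then obtain v0 where v0: "v0 \<in> X" "u \<in> N v0" using u by (auto simp: V_def leaves_def)
      have "incidence u e = 0" if "e \<in> E" for e
        using E_subset[OF that] False by (auto simp: incidence_def)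
      then have "(\<Sum>e\<in>E. incidence u e * y e) = 0" by simp
      moreover have "(\<Sum>v\<in>X. incidence u (whisker v) * real (t v)) = (\<Sum>v\<in>X. if v = v0 then real (t v) else 0)"
        using v0 False N_disjoint[of _ v0] by (intro sum.cong refl) (auto simp: incidence_def whisker_def)
      moreover have "\<dots> = real (t v0)" using v0 finite_X by simp
      ultimately show ?thesis
        unfolding split using t_le[of v0 u] v0 by (simp add: whisker_def)
    qed
  qed
  have "1 \<le> (\<Sum>v\<in>V. x' v * incidence v e)" if e: "T \<inter> e \<noteq> {}" for e
  proof -
    obtain v where v: "v \<in> T" "v \<in> e" using e by blast
    then have "1 = x' v * incidence v e" by (simp add: x'_def incidence_def)
    also have "\<dots> \<le> (\<Sum>v\<in>V. x' v * incidence v e)"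
      using v T_V finite_V by (intro member_le_sum) (auto simp: x'_def incidence_def)
    finally show ?thesis .
  qed
  moreover have "T \<inter> e \<noteq> {}" if "e \<in> E'" for e
  proof (cases "e \<in> E")
    case True
    then obtain v where "v \<in> S" "v \<in> e" using S_cover by blast
    then have "b v = v" "v \<in> X" by (auto simp: b_def S_def)
    then show ?thesis using \<open>v \<in> e\<close> unfolding T_def by (metis IntI empty_iff imageI)
  next
    case False
    then obtain v where "v \<in> X" "e = whisker v" using \<open>e \<in> E'\<close> by (auto simp: E'_def)
    then show ?thesis using b by (auto simp: T_def)
  qed
  ultimately have primal: "primal_feasible V E' x'"
    by (simp add: primal_feasible_def x'_def)
  have "primal_value V w x' = (\<Sum>u\<in>T. real (w u))"
    unfolding primal_value_def x'_def using T_V finite_V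
    by (intro sum.mono_neutral_cong_right) auto
  also have "\<dots> = (\<Sum>v\<in>X. real (w (b v)))"
    unfolding T_def by (simp add: sum.reindex[OF inj_b])
  also have "\<dots> = (\<Sum>v\<in>X. (if v \<in> S then real (w' v) else 0) + real (t v))"
    using wb by (intro sum.cong) auto
  also have "\<dots> = (\<Sum>v\<in>S. real (w' v)) + (\<Sum>v\<in>X. real (t v))"
    unfolding sum.distrib using finite_X
    by (simp add: sum.inter_restrict[symmetric]) (simp add: S_def Int_def conj_commute)
  also have "\<dots> \<le> dual_value E' y'"
    using S_weight split[of "\<lambda>_. 1"] by (simp add: dual_value_def)
  finally have le: "primal_value V w x' \<le> dual_value E' y'" .
  have "\<forall>v\<in>V. x' v \<in> \<int>" by (simp add: x'_def)
  moreover have "\<forall>e\<in>E'. y' e \<in> \<int>"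
    using y(2) by (auto simp: y'_def intro!: Ints_add Ints_sum)
  ultimately show "\<exists>x y. primal_optimal V E' w x \<and> (\<forall>v\<in>V. x v \<in> \<int>) \<and>
      dual_optimal V E' w y \<and> (\<forall>e\<in>E'. y e \<in> \<int>) \<and> primal_value V w x = dual_value E' y"
    using optimalI[OF finite_V primal dual le] by blast
qed

end

section \<open>Whiskers given by the indexed families \<open>x\<close> and \<open>y\<close>\<close>

theorem theorem3p2p3:
  fixes x :: "nat \<Rightarrow> 'v" and y :: "nat \<Rightarrow> nat \<Rightarrow> 'v"
    and n d :: nat
    and X Y V' :: "'v set" and E E' :: "'v set set"
  assumes X: "X = x ` {1..n}" and x_inj: "inj_on x {1..n}"
    and C: "clutter X E" and d_uniform: "uniform d E"
    and no_isolated: "\<not> (\<exists>v. isolated_vertex X E v)"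
    and Y: "Y = {y i j |i j. 1 \<le> i \<and> i \<le> n \<and> 1 \<le> j \<and> j \<le> d - 1}"
    and y_inj: "inj_on (\<lambda>(i, j). y i j) ({1..n} \<times> {1..d - 1})"
    and Y_new: "X \<inter> Y = {}"
    and V': "V' = X \<union> Y"
    and E': "E' = E \<union> {insert (x i) (y i ` {1..d - 1}) |i. 1 \<le> i \<and> i \<le> n}"
  shows "cohen_macaulay_ring
           ((poly_ring V' :: ('v, 'k::field) mpoly ring) Quot edge_ideal V' E') \<and>
         (packing_property TYPE('k) X E \<longrightarrow> packing_property TYPE('k) V' E') \<and>
         (max_flow_min_cut X E \<longrightarrow> max_flow_min_cut V' E')"
proof -
  \<comment> \<open>Injectivity of \<open>x\<close> lets the leaf set be read off from the vertex
    instead of its index.\<close>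
  define N where "N v = y (inv_into {1..n} x v) ` {1..d - 1}" for v
  have N: "N (x i) = y i ` {1..d - 1}" if "i \<in> {1..n}" for i
    using that x_inj by (simp add: N_def)
  have N_Y: "N v \<subseteq> Y" if v: "v \<in> X" for v
  proof -
    obtain i where "i \<in> {1..n}" "v = x i" using v X by blast
    then show ?thesis using N[of i] unfolding Y by force
  qed
  interpret W: whiskering X E N
  proof
    show "finite X" by (simp add: X)
    show "e \<subseteq> X" if "e \<in> E" for e using C that by (simp add: clutter_def)
    show "finite (N v)" for v by (simp add: N_def)
    show "N v \<inter> X = {}" if "v \<in> X" for v using N_Y[OF that] Y_new by blast
    show "N u \<inter> N v = {}" if uv: "u \<in> X" "v \<in> X" "u \<noteq> v" for u v
    proof -
      obtain i j where ij: "i \<in> {1..n}" "j \<in> {1..n}" "u = x i" "v = x j" using uv(1,2) X by blast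
      then have "i \<noteq> j" using uv(3) by blast
      then have "y i k \<noteq> y j l" if "k \<in> {1..d - 1}" "l \<in> {1..d - 1}" for k l
        using inj_onD[OF y_inj, of "(i, k)" "(j, l)"] ij that by auto
      then show ?thesis using N ij by auto
    qed
  qed
  have "W.leaves = (\<Union>i\<in>{1..n}. y i ` {1..d - 1})"
    unfolding W.leaves_def unfolding X using N by simp
  also have "\<dots> = Y" unfolding Y by force
  finally have V: "W.V = V'" by (simp add: W.V_def V')
  have "W.whisker ` X = (\<lambda>i. insert (x i) (y i ` {1..d - 1})) ` {1..n}"
    unfolding X image_image using N by (intro image_cong) (simp_all add: W.whisker_def)
  also have "\<dots> = {insert (x i) (y i ` {1..d - 1}) |i. 1 \<le> i \<and> i \<le> n}" by auto
  finally have E'': "W.E' = E'" by (simp add: W.E'_def E')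
  show ?thesis
    using W.cohen_macaulay_whiskering[where 'k = 'k] W.packing_property_whiskering[where 'k = 'k] W.max_flow_min_cut_whiskering
    unfolding V E'' by blast
qed

end
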